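(* Let $H$ satisfy the standing assumptions (H), let $m\in\mathscr C^{1,2}_{\mathrm{per}}((0,T)\times\mathbb T^d)$ and for $\varepsilon>0$ let $\lambda_H(m,\varepsilon)$ be the eigenvalue of $\partial_t-\Delta+\varepsilon H(\nabla_x\cdot)+m$. Write $\langle m\rangle:=\frac1{T|\mathbb T^d|}\iint_{(0,T)\times\mathbb T^d}m$. Let $\psi_0\in\mathscr C^{1,2}_{\mathrm{per}}((0,T)\times\mathbb T^d)$ be the unique solution of \[\partial_t\psi_0-\Delta\psi_0=\langle m\rangle-m\ \text{ in }(0,T)\times\mathbb T^d,\quad \psi_0(T,\cdot)=\psi_0(0,\cdot),\quad \iint_{(0,T)\times\mathbb T^d}\psi_0=0.\] Then \[\frac{-\lambda_H(m,\varepsilon)-\langle m\rangle}{\varepsilon}\xrightarrow[\varepsilon\to0]{}\frac1{T|\mathbb T^d|}\iint_{(0,T)\times\mathbb T^d}H(\nabla_x\psi_0).\]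
   Context: $\mathbb T^d$ is the $d$-dimensional torus and $T>0$ is fixed. $\mathscr C^{1,2}_{\mathrm{per}}((0,T)\times\mathbb T^d)$ denotes functions that are $T$-periodic in $t$, $\mathbb T^d$-periodic in $x$, $\mathscr C^1$ in $t$ and $\mathscr C^2$ in $x$. Standing assumptions (H) on $H:\mathbb R^d\to\mathbb R$: $H$ is $\mathscr C^2$; $H(p)>H(0)=0$ for $p\neq0$; $\nabla^2_{pp}H(p)$ is symmetric positive definite for $p\neq 0$; there is a continuous, coercive, convex, non-negative function $\mathcal H$ on $[0,\infty)$ with $\mathcal H(a)>\mathcal H(0)=0$ for $a>0$ such that $\mathcal H\big(\|f-\frac{1}{|\mathbb T^d|}\int_{\mathbb T^d}f\|_{L^1(\mathbb T^d)}\big)\le\int_{\mathbb T^d}H(\nabla f)$ for every $f\in\mathscr C^2(\mathbb T^d)$; and there is $\beta\in(0,1)$ with $aH(p)\ge H(a^\beta p)$ for all $a\in(0,1)$, $p\in\mathbb R^d$. Eigenvalue: the eigenvalue of $\partial_t-\Delta+\varepsilon H(\nabla_x\cdot)+m$ is the unique real $\lambda$ for which there exists $\varphi\in\mathscr C^{1,2}_{\mathrm{per}}((0,T)\times\mathbb T^d)$ with $\lambda+\partial_t\varphi-\Delta\varphi+\varepsilon H(\nabla_x\varphi)=-m$. *)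

theory Defs
  imports "HOL-Analysis.Analysis"
begin

text \<open>Conventions: the torus is T^d = R^d / Z^d (period 1 in every coordinate, so |T^d| = 1),
  with d = CARD('n). Functions on (0,T) x T^d are functions real => real^'n => real that are
  T-periodic in t and 1-periodic in every space coordinate.\<close>

definition pd :: "'n::finite \<Rightarrow> (real^'n \<Rightarrow> real) \<Rightarrow> real^'n \<Rightarrow> real" where
  "pd i g x = deriv (\<lambda>h. g (x + h *\<^sub>R axis i 1)) 0"

definition pdiff :: "'n::finite \<Rightarrow> (real^'n \<Rightarrow> real) \<Rightarrow> real^'n \<Rightarrow> bool" where
  "pdiff i g x \<longleftrightarrow> (\<lambda>h. g (x + h *\<^sub>R axis i 1)) differentiable (at 0)"

definition dt :: "(real \<Rightarrow> real^'n \<Rightarrow> real) \<Rightarrow> real \<Rightarrow> real^'n \<Rightarrow> real" where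
  "dt f t x = deriv (\<lambda>s. f s x) t"

definition grad :: "(real^'n::finite \<Rightarrow> real) \<Rightarrow> real^'n \<Rightarrow> real^'n" where
  "grad g x = (\<chi> i. pd i g x)"

definition lap :: "(real^'n::finite \<Rightarrow> real) \<Rightarrow> real^'n \<Rightarrow> real" where
  "lap g x = (\<Sum>i\<in>UNIV. pd i (pd i g) x)"

definition hess :: "(real^'n::finite \<Rightarrow> real) \<Rightarrow> real^'n \<Rightarrow> real^'n^'n" where
  "hess g p = (\<chi> i j. pd j (pd i g) p)"

definition C2 :: "(real^'n::finite \<Rightarrow> real) \<Rightarrow> bool" where
  "C2 g \<longleftrightarrow> continuous_on UNIV g
     \<and> (\<forall>i x. pdiff i g x) \<and> (\<forall>i. continuous_on UNIV (pd i g))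
     \<and> (\<forall>i j x. pdiff j (pd i g) x) \<and> (\<forall>i j. continuous_on UNIV (pd j (pd i g)))"

definition per_space :: "(real^'n::finite \<Rightarrow> real) \<Rightarrow> bool" where
  "per_space g \<longleftrightarrow> (\<forall>x i. g (x + axis i 1) = g x)"

definition C12per :: "real \<Rightarrow> (real \<Rightarrow> real^'n::finite \<Rightarrow> real) \<Rightarrow> bool" where
  "C12per T f \<longleftrightarrow>
     (\<forall>t x. f (t + T) x = f t x) \<and> (\<forall>t. per_space (f t))
     \<and> continuous_on UNIV (\<lambda>p. f (fst p) (snd p))
     \<and> (\<forall>t x. (\<lambda>s. f s x) differentiable (at t))
     \<and> continuous_on UNIV (\<lambda>p. dt f (fst p) (snd p))
     \<and> (\<forall>i t x. pdiff i (f t) x)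
     \<and> (\<forall>i. continuous_on UNIV (\<lambda>p. pd i (f (fst p)) (snd p)))
     \<and> (\<forall>i j t x. pdiff j (pd i (f t)) x)
     \<and> (\<forall>i j. continuous_on UNIV (\<lambda>p. pd j (pd i (f (fst p))) (snd p)))"

definition torus_int :: "(real^'n::finite \<Rightarrow> real) \<Rightarrow> real" where
  "torus_int g = integral (cbox 0 1) g"

definition cyl_int :: "real \<Rightarrow> (real \<Rightarrow> real^'n::finite \<Rightarrow> real) \<Rightarrow> real" where
  "cyl_int T f = integral (cbox (0, 0) (T, 1)) (\<lambda>p. f (fst p) (snd p))"

definition hyp_H :: "(real^'n::finite \<Rightarrow> real) \<Rightarrow> bool" where
  "hyp_H H \<longleftrightarrow> C2 H
     \<and> H 0 = 0 \<and> (\<forall>p. p \<noteq> 0 \<longrightarrow> H p > 0)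
     \<and> (\<forall>p. p \<noteq> 0 \<longrightarrow> transpose (hess H p) = hess H p
                  \<and> (\<forall>v. v \<noteq> 0 \<longrightarrow> v \<bullet> (hess H p *v v) > 0))
     \<and> (\<exists>HH :: real \<Rightarrow> real.
          continuous_on {0..} HH \<and> filterlim HH at_top at_top \<and> convex_on {0..} HH
          \<and> (\<forall>a\<ge>0. HH a \<ge> 0) \<and> HH 0 = 0 \<and> (\<forall>a>0. HH a > 0)
          \<and> (\<forall>f. C2 f \<and> per_space f \<longrightarrow>
               HH (torus_int (\<lambda>x. \<bar>f x - torus_int f / measure lborel (cbox (0::real^'n) 1)\<bar>))
                 \<le> torus_int (\<lambda>x. H (grad f x))))
     \<and> (\<exists>\<beta>. 0 < \<beta> \<and> \<beta> < 1 \<and> (\<forall>a p. 0 < a \<and> a < 1 \<longrightarrow> a * H p \<ge> H ((a powr \<beta>) *\<^sub>R p)))"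

definition eigenvalue :: "real \<Rightarrow> (real^'n::finite \<Rightarrow> real) \<Rightarrow> (real \<Rightarrow> real^'n \<Rightarrow> real) \<Rightarrow> real \<Rightarrow> real" where
  "eigenvalue T H m \<epsilon> = (THE lam. \<exists>\<phi>. C12per T \<phi> \<and>
      (\<forall>t x. lam + dt \<phi> t x - lap (\<phi> t) x + \<epsilon> * H (grad (\<phi> t) x) = - m t x))"

end

theory Submission
  imports Defs "HOL-Probability.Distributions"
begin

text \<open>Writing \<open>\<phi> = \<psi>\<^sub>0 - \<epsilon> w\<close> and \<open>\<lambda> = - \<langle>m\<rangle> - \<epsilon> \<mu>\<close>, the eigenvalue problem becomes
  \<open>\<partial>\<^sub>t w - \<Delta> w = f - \<mu>\<close> with \<open>f = H(\<nabla>\<psi>\<^sub>0 - \<epsilon> \<nabla>w)\<close>, so that \<open>\<mu>\<close> must be the mean of \<open>f\<close>.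
  The linear problem is solved by Duhamel's formula over the whole past,
  \<open>w(t) = \<integral>\<^sub>0\<^sup>\<infinity> (P\<^sub>s f(t - s) - mean) ds\<close> up to a function of time, where \<open>P\<^sub>s\<close> is convolution
  with the Gaussian kernel. A Doeblin minorisation of \<open>P\<^sub>1\<close> on the unit cube makes oscillations of periodic
  functions decay exponentially, and near \<open>s = 0\<close> both \<open>\<nabla>P\<^sub>s f\<close> (for bounded \<open>f\<close>) and \<open>\<nabla>\<^sup>2P\<^sub>s f\<close>
  (for \<open>f\<close> Lipschitz in space) are \<open>O(s\<^bsup>-1/2\<^esup>)\<close>. Hence \<open>f \<mapsto> \<nabla>w\<close> is bounded in the supremum norm and
  preserves Lipschitz bounds, and for small \<open>\<epsilon>\<close> the equation for \<open>f\<close> is a contraction. As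
  \<open>f = H(\<nabla>\<psi>\<^sub>0) + O(\<epsilon>)\<close> uniformly, \<open>\<mu>\<close> tends to the mean of \<open>H(\<nabla>\<psi>\<^sub>0)\<close>. The maximum
  principle identifies \<open>\<lambda>\<close> with the eigenvalue.\<close>

section \<open>Integrals depending on a parameter and the Gaussian kernel\<close>

text \<open>The source \<open>f\<close> is only continuous in time, so the potential cannot be
  differentiated in time by moving the derivative onto \<open>f\<close>. Its time increments are
  instead written, by Fubini, as integrals of its Laplacian plus the source, and only this identity
  is differentiated. The unknown of the fixed point is \<open>f\<close> rather than \<open>w\<close>
  because boundedness, periodicity and a spatial Lipschitz bound are closed conditions under uniform
  convergence. The contraction takes place in the supremum norm alone; the Lipschitz bound is merely
  carried along, and it is what gives the fixed point a potential with second derivatives. Removing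
  the spatial mean at each time makes the integral over the infinite past converge. The means return
  through an antiderivative in time, which is periodic exactly because \<mu> is the space-time mean.
  The construction is confined to small \<epsilon>, which suffices for a limit at 0.\<close>

lemma has_real_derivative_integral_dominated:
  fixes F :: "real \<Rightarrow> 'a \<Rightarrow> real"
  assumes d: "d > 0"
    and int: "\<And>h. \<bar>h - h0\<bar> < d \<Longrightarrow> integrable M (F h)"
    and der: "\<And>h y. \<bar>h - h0\<bar> < d \<Longrightarrow> y \<in> space M \<Longrightarrow> ((\<lambda>h. F h y) has_real_derivative F' h y) (at h)"
    and bd: "\<And>h y. \<bar>h - h0\<bar> < d \<Longrightarrow> y \<in> space M \<Longrightarrow> \<bar>F' h y\<bar> \<le> g y"
    and g: "integrable M g" and m: "F' h0 \<in> borel_measurable M"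
  shows "((\<lambda>h. \<integral>y. F h y \<partial>M) has_real_derivative (\<integral>y. F' h0 y \<partial>M)) (at h0)"
  unfolding DERIV_def tendsto_at_iff_sequentially
proof (intro allI impI)
  fix X :: "nat \<Rightarrow> real"
  assume X: "\<forall>i. X i \<in> UNIV - {0}" and X0: "X \<longlonglongrightarrow> 0"
  from X0 d obtain N where N: "\<And>n. n \<ge> N \<Longrightarrow> \<bar>X n\<bar> < d"
    by (metis LIMSEQ_D diff_zero real_norm_def)
  define Y where "Y n = X (n + N)" for n
  have Y0: "Y \<longlonglongrightarrow> 0" unfolding Y_def by (rule LIMSEQ_ignore_initial_segment[OF X0])
  have Yd: "\<bar>Y n\<bar> < d" "Y n \<noteq> 0" for n using N X unfolding Y_def by auto
  have "(\<lambda>n. \<integral>y. (F (h0 + Y n) y - F h0 y) / Y n \<partial>M) \<longlonglongrightarrow> (\<integral>y. F' h0 y \<partial>M)"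
  proof (rule integral_dominated_convergence[OF m _ g])
    show "(\<lambda>y. (F (h0 + Y n) y - F h0 y) / Y n) \<in> borel_measurable M" for n
    proof -
      have "integrable M (F (h0 + Y n))" "integrable M (F h0)" using Yd(1)[of n] d by (auto intro!: int)
      then show ?thesis by measurable
    qed
    show "AE y in M. (\<lambda>n. (F (h0 + Y n) y - F h0 y) / Y n) \<longlonglongrightarrow> F' h0 y"
    proof (rule AE_I2)
      fix y assume "y \<in> space M"
      from der[OF _ this, of h0] d have "((\<lambda>h. F h y) has_real_derivative F' h0 y) (at h0)" by simp
      then show "(\<lambda>n. (F (h0 + Y n) y - F h0 y) / Y n) \<longlonglongrightarrow> F' h0 y"
        unfolding DERIV_def tendsto_at_iff_sequentially using Y0 Yd(2) by (auto simp: o_def)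
    qed
    fix n
    show "AE y in M. norm ((F (h0 + Y n) y - F h0 y) / Y n) \<le> g y"
    proof (rule AE_I2)
      fix y assume y: "y \<in> space M"
      \<comment> \<open>The mean value inequality turns the bound on \<open>F'\<close> into one on
        the difference quotients, uniform in \<open>n\<close>, as dominated convergence
        requires.\<close>
      have "norm (F (h0 + Y n) y - F h0 y) \<le> g y * norm (h0 + Y n - h0)"
      proof (rule field_differentiable_bound[where S="{h0 - d<..<h0 + d}" and f'="\<lambda>h. F' h y"])
        fix h assume "h \<in> {h0 - d<..<h0 + d}"
        then have h: "\<bar>h - h0\<bar> < d" by auto
        show "((\<lambda>h. F h y) has_field_derivative F' h y) (at h within {h0 - d<..<h0 + d})"
          by (rule has_field_derivative_at_within[OF der[OF h y]])
        show "norm (F' h y) \<le> g y" using bd[OF h y] by simp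
      next
        show "h0 + Y n \<in> {h0 - d<..<h0 + d}" using Yd(1)[of n] by auto
      qed (use d in auto)
      then show "norm ((F (h0 + Y n) y - F h0 y) / Y n) \<le> g y"
        using Yd(2)[of n] by (simp add: field_simps)
    qed
  qed
  moreover have "(\<integral>y. (F (h0 + Y n) y - F h0 y) / Y n \<partial>M) = ((\<integral>y. F (h0 + Y n) y \<partial>M) - (\<integral>y. F h0 y \<partial>M)) / Y n" for n
    using Yd(1)[of n] d by (simp add: int)
  ultimately have "(\<lambda>n. ((\<integral>y. F (h0 + Y n) y \<partial>M) - (\<integral>y. F h0 y \<partial>M)) / Y n) \<longlonglongrightarrow> (\<integral>y. F' h0 y \<partial>M)"
    by (simp only:)
  then have "(\<lambda>n. ((\<integral>y. F (h0 + X (n + N)) y \<partial>M) - (\<integral>y. F h0 y \<partial>M)) / X (n + N)) \<longlonglongrightarrow> (\<integral>y. F' h0 y \<partial>M)"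
    by (simp add: Y_def)
  then have "(\<lambda>n. ((\<integral>y. F (h0 + X n) y \<partial>M) - (\<integral>y. F h0 y \<partial>M)) / X n) \<longlonglongrightarrow> (\<integral>y. F' h0 y \<partial>M)"
    by (rule LIMSEQ_offset)
  then show "((\<lambda>h. ((\<integral>y. F (h0 + h) y \<partial>M) - (\<integral>y. F h0 y \<partial>M)) / h) \<circ> X) \<longlonglongrightarrow> (\<integral>y. F' h0 y \<partial>M)"
    by (simp add: o_def)
qed

lemma continuous_on_integral_dominated:
  fixes F :: "'b::metric_space \<Rightarrow> 'a \<Rightarrow> real"
  assumes "\<And>x. x \<in> S \<Longrightarrow> F x \<in> borel_measurable M"
    and "\<And>y. y \<in> space M \<Longrightarrow> continuous_on S (\<lambda>x. F x y)"
    and "\<And>x y. x \<in> S \<Longrightarrow> y \<in> space M \<Longrightarrow> \<bar>F x y\<bar> \<le> g y"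
    and "integrable M g"
  shows "continuous_on S (\<lambda>x. \<integral>y. F x y \<partial>M)"
  unfolding continuous_on_sequentially
proof (intro allI ballI impI)
  fix X :: "nat \<Rightarrow> 'b" and a assume a: "a \<in> S" and "(\<forall>n. X n \<in> S) \<and> X \<longlonglongrightarrow> a"
  then have X: "\<forall>n. X n \<in> S" "X \<longlonglongrightarrow> a" by auto
  have "(\<lambda>n. \<integral>y. F (X n) y \<partial>M) \<longlonglongrightarrow> (\<integral>y. F a y \<partial>M)"
  proof (rule integral_dominated_convergence[OF assms(1)[OF a] _ assms(4)])
    show "AE y in M. (\<lambda>n. F (X n) y) \<longlonglongrightarrow> F a y"
    proof (rule AE_I2)
      fix y assume "y \<in> space M"
      from assms(2)[OF this] X a show "(\<lambda>n. F (X n) y) \<longlonglongrightarrow> F a y"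
        unfolding continuous_on_sequentially by (auto simp: o_def)
    qed
  qed (use X assms in auto)
  then show "((\<lambda>x. \<integral>y. F x y \<partial>M) \<circ> X) \<longlonglongrightarrow> (\<integral>y. F a y \<partial>M)" by (simp add: o_def)
qed

section \<open>The Gaussian kernel: normalisation and convolution\<close>

text \<open>The heat kernel of the whole space. It is not periodised: convolving a periodic function
  with it over the whole space already is the heat flow on the torus.\<close>

definition heat :: "real \<Rightarrow> real^'n::finite \<Rightarrow> real" where
  "heat s y = exp (- (norm y)\<^sup>2 / (4 * s)) / sqrt (4 * pi * s) ^ CARD('n)"

text \<open>In each coordinate the kernel is a centred Gaussian of variance \<open>2 * s\<close>, so
  its total mass reduces to that of the one-dimensional normal density.\<close>

lemma heat_prod:
  fixes y :: "real^'n::finite"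
  assumes "s > 0"
  shows "heat s y = (\<Prod>b\<in>Basis. normal_density 0 (sqrt (2 * s)) (y \<bullet> b))"
proof -
  have e: "(norm y)\<^sup>2 = (\<Sum>b\<in>Basis. (y \<bullet> b)\<^sup>2)"
    by (simp only: power2_norm_eq_inner euclidean_inner[of y y] power2_eq_square[symmetric])
  have "(\<Prod>b\<in>(Basis::(real^'n) set). normal_density 0 (sqrt (2 * s)) (y \<bullet> b))
      = (\<Prod>b\<in>(Basis::(real^'n) set). exp (- ((y \<bullet> b)\<^sup>2 / (4 * s))) / sqrt (4 * pi * s))"
    using assms by (intro prod.cong refl) (simp add: normal_density_def mult.commute mult.left_commute)
  also have "\<dots> = exp (- (norm y)\<^sup>2 / (4 * s)) / sqrt (4 * pi * s) ^ CARD('n)"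
    by (simp add: prod_dividef exp_sum[symmetric] e sum_negf sum_divide_distrib)
  finally show ?thesis by (simp add: heat_def)
qed

lemma heat_pos: "s > 0 \<Longrightarrow> heat s y > 0"
  by (simp add: heat_def)

lemma heat_measurable [measurable]: "heat s \<in> borel_measurable borel"
  unfolding heat_def by measurable

lemma has_bochner_integral_heat:
  assumes "s > 0"
  shows "has_bochner_integral lborel (heat s :: real^'n::finite \<Rightarrow> real) 1"
proof (rule has_bochner_integral_nn_integral)
  have "(\<integral>\<^sup>+ x. ennreal (heat s (x::real^'n)) \<partial>lborel)
      = (\<integral>\<^sup>+ x. (\<Prod>b\<in>Basis. ennreal (normal_density 0 (sqrt (2 * s)) (x \<bullet> b))) \<partial>(lborel :: (real^'n) measure))"
    using assms by (simp add: heat_prod prod_ennreal)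
  also have "\<dots> = (\<Prod>b\<in>(Basis::(real^'n) set). (\<integral>\<^sup>+ x. ennreal (normal_density 0 (sqrt (2 * s)) x) \<partial>lborel))"
    by (rule nn_integral_lborel_prod) auto
  also have "(\<integral>\<^sup>+ x. ennreal (normal_density 0 (sqrt (2 * s)) x) \<partial>lborel) = 1"
    using assms by (subst nn_integral_eq_integral) auto
  finally show "(\<integral>\<^sup>+ x. ennreal (heat s (x::real^'n)) \<partial>lborel) = ennreal 1" by simp
qed (use assms in \<open>auto intro!: AE_I2 less_imp_le heat_pos\<close>)

lemma heat_integrable: "s > 0 \<Longrightarrow> integrable lborel (heat s :: real^'n::finite \<Rightarrow> real)"
  using has_bochner_integral_heat by (auto simp: has_bochner_integral_iff)

lemma integral_heat: "s > 0 \<Longrightarrow> (\<integral>y. heat s (y :: real^'n::finite) \<partial>lborel) = 1"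
  using has_bochner_integral_heat by (auto simp: has_bochner_integral_iff)

section \<open>Translations and reflections in Lebesgue integrals\<close>

lemma lborel_integrable_shift:
  fixes f :: "'a::euclidean_space \<Rightarrow> real"
  shows "integrable lborel (\<lambda>z. f (x + z)) \<longleftrightarrow> integrable lborel f"
proof -
  have "integrable lborel f" if "integrable lborel (\<lambda>z. f (x + z))" for f :: "'a \<Rightarrow> real" and x
  proof -
    have fm: "f \<in> borel_measurable borel"
    proof -
      have "(\<lambda>z. f (x + z)) \<in> borel_measurable borel" using that by auto
      from measurable_compose[OF _ this, of "\<lambda>z. z - x" borel] show ?thesis by simp
    qed
    have "integrable (distr lborel borel ((+) x)) f"
      by (subst integrable_distr_eq) (use fm that in auto)
    then show ?thesis by (simp add: lborel_distr_plus)
  qed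
  from this[of f x] this[of "\<lambda>z. f (x + z)" "- x"] show ?thesis by auto
qed

lemma lborel_integral_shift:
  fixes f :: "'a::euclidean_space \<Rightarrow> real"
  shows "(\<integral>z. f (x + z) \<partial>lborel) = (\<integral>y. f y \<partial>lborel)"
proof (cases "integrable lborel f")
  case True
  have "(\<integral>y. f y \<partial>lborel) = integral\<^sup>L (distr lborel borel ((+) x)) f" by (simp add: lborel_distr_plus)
  also have "\<dots> = (\<integral>z. f (x + z) \<partial>lborel)" using True by (subst integral_distr) auto
  finally show ?thesis ..
next
  case False
  \<comment> \<open>If \<open>f\<close> is not integrable, neither is its translate, and both
    integrals have the default value 0.\<close>
  then show ?thesis by (metis lborel_integrable_shift not_integrable_integral_eq)
qed

lemma lborel_distr_uminus_euclidean: "distr lborel borel uminus = (lborel :: 'a::euclidean_space measure)"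
  using lborel_affine[of "-1" "0::'a"] by (simp add: density_1)

lemma lborel_integrable_reflect:
  fixes f :: "'a::euclidean_space \<Rightarrow> real"
  shows "integrable lborel (\<lambda>z. f (x - z)) \<longleftrightarrow> integrable lborel f"
proof -
  have *: "integrable lborel f" if "integrable lborel (\<lambda>z. f (- z))" for f :: "'a \<Rightarrow> real"
  proof -
    have fm: "f \<in> borel_measurable borel"
    proof -
      have "(\<lambda>z. f (- z)) \<in> borel_measurable borel" using that by auto
      from measurable_compose[OF _ this, of uminus borel] show ?thesis by simp
    qed
    have "integrable (distr lborel borel uminus) f"
      by (subst integrable_distr_eq) (use fm that in auto)
    then show ?thesis by (simp add: lborel_distr_uminus_euclidean)
  qed
  from *[of "\<lambda>z. f (x + z)"] *[of "\<lambda>z. f (x - z)"] lborel_integrable_shift[of f x] show ?thesis by auto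
qed

lemma lborel_integral_reflect:
  fixes f :: "'a::euclidean_space \<Rightarrow> real"
  shows "(\<integral>z. f (x - z) \<partial>lborel) = (\<integral>y. f y \<partial>lborel)"
proof (cases "integrable lborel f")
  case True
  have "(\<integral>z. f (x - z) \<partial>lborel) = integral\<^sup>L (distr lborel borel uminus) (\<lambda>z. f (x + z))"
    using True by (subst integral_distr) auto
  also have "\<dots> = (\<integral>y. f y \<partial>lborel)" by (simp add: lborel_distr_uminus_euclidean lborel_integral_shift)
  finally show ?thesis .
next
  case False
  then show ?thesis by (metis lborel_integrable_reflect not_integrable_integral_eq)
qed

text \<open>Completing the square in \<open>y\<close> factors the product into
  \<open>heat (s + t) x\<close> and a heat kernel centred at \<open>c\<close> whose time
  \<open>r\<close> is half the harmonic mean of \<open>s\<close> and \<open>t\<close>.\<close>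

lemma integral_heat_convolution:
  fixes x :: "real^'n::finite"
  assumes "s > 0" "t > 0"
  shows "integrable lborel (\<lambda>y. heat s (x - y) * heat t y)" "(\<integral>y. heat s (x - y) * heat t y \<partial>lborel) = heat (s + t) x"
proof -
  define r where "r = s * t / (s + t)"
  define c where "c = (t / (s + t)) *\<^sub>R x"
  have r: "r > 0" using assms by (simp add: r_def)
  \<comment> \<open>Here \<open>X\<close>, \<open>Y\<close>, \<open>q\<close> stand for |x|^2, x . y
    and |y|^2: this is the identity between the exponents.\<close>
  have gauss: "(X - 2 * Y + q) / (4 * s) + q / (4 * t) = X / (4 * u) + (q - 2 * (t / u) * Y + (t / u)\<^sup>2 * X) / (4 * (s * t / u))"
    if "u = s + t" for X Y q u
  proof -
    have u: "u > 0" using assms that by simp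
    have "(X - 2 * Y + q) / (4 * s) + q / (4 * t) = (t * u * (X - 2 * Y + q) + s * u * q) / (4 * s * t * u)"
      using assms u by (simp add: field_simps)
    also have "t * u * (X - 2 * Y + q) + s * u * q = s * t * X + u * u * q - 2 * t * u * Y + t * t * X"
      unfolding that by (simp add: algebra_simps)
    also have "\<dots> / (4 * s * t * u) = X / (4 * u) + (q - 2 * (t / u) * Y + (t / u)\<^sup>2 * X) / (4 * (s * t / u))"
      using assms u by (simp add: field_simps power2_eq_square)
    finally show ?thesis .
  qed
  have sq: "(norm (v - k *\<^sub>R w))\<^sup>2 = v \<bullet> v - 2 * k * (w \<bullet> v) + k\<^sup>2 * (w \<bullet> w)" for v w :: "real^'n" and k
    unfolding power2_norm_eq_inner by (simp add: inner_commute[of v w] power2_eq_square algebra_simps)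
  have eq: "heat s (x - y) * heat t y = heat (s + t) x * heat r (y - c)" for y
  proof -
    have n: "(norm (x - y))\<^sup>2 = x \<bullet> x - 2 * (x \<bullet> y) + y \<bullet> y"
      "(norm (y - c))\<^sup>2 = y \<bullet> y - 2 * (t / (s + t)) * (x \<bullet> y) + (t / (s + t))\<^sup>2 * (x \<bullet> x)"
      using sq[of x 1 y] sq[of y "t / (s + t)" x] by (simp_all add: c_def inner_commute[of y x])
    have st: "s + t > 0" using assms by simp
    have "(norm (x - y))\<^sup>2 / (4 * s) + (norm y)\<^sup>2 / (4 * t) = (norm x)\<^sup>2 / (4 * (s + t)) + (norm (y - c))\<^sup>2 / (4 * r)"
      unfolding n r_def power2_norm_eq_inner[of x] power2_norm_eq_inner[of y] by (rule gauss) simp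
    \<comment> \<open>The normalisations agree because \<open>s * t = (s + t) * r\<close>.\<close>
    moreover have "sqrt (4 * pi * s) * sqrt (4 * pi * t) = sqrt (4 * pi * (s + t)) * sqrt (4 * pi * r)"
      unfolding r_def real_sqrt_mult[symmetric] using st by simp
    moreover have "heat s (x - y) * heat t y = exp (- ((norm (x - y))\<^sup>2 / (4 * s) + (norm y)\<^sup>2 / (4 * t))) / (sqrt (4 * pi * s) * sqrt (4 * pi * t)) ^ CARD('n)"
      "heat (s + t) x * heat r (y - c) = exp (- ((norm x)\<^sup>2 / (4 * (s + t)) + (norm (y - c))\<^sup>2 / (4 * r))) / (sqrt (4 * pi * (s + t)) * sqrt (4 * pi * r)) ^ CARD('n)"
      unfolding heat_def minus_add_distrib exp_add power_mult_distrib by simp_all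
    ultimately show ?thesis by simp
  qed
  have "has_bochner_integral lborel (\<lambda>y. heat r (y - c)) 1"
    using lborel_integrable_shift[of "heat r" "-c"] lborel_integral_shift[of "heat r" "-c"] heat_integrable[OF r] integral_heat[OF r]
    by (simp add: has_bochner_integral_iff)
  then show "integrable lborel (\<lambda>y. heat s (x - y) * heat t y)" "(\<integral>y. heat s (x - y) * heat t y \<partial>lborel) = heat (s + t) x"
    unfolding eq by (auto simp: has_bochner_integral_iff)
qed

section \<open>Kernel derivatives and convolution\<close>

lemma continuous_on_uncurry:
  assumes "continuous_on (A \<times> B) (\<lambda>p. f (fst p) (snd p))" "continuous_on S a" "continuous_on S b"
    "\<And>x. x \<in> S \<Longrightarrow> a x \<in> A" "\<And>x. x \<in> S \<Longrightarrow> b x \<in> B"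
  shows "continuous_on S (\<lambda>x. f (a x) (b x))"
proof -
  have "continuous_on S (\<lambda>x. (a x, b x))" by (intro continuous_intros assms)
  from continuous_on_compose2[OF assms(1) this] assms(4,5) show ?thesis by auto
qed

definition heatD :: "'n::finite \<Rightarrow> real \<Rightarrow> real^'n \<Rightarrow> real" where
  "heatD i s y = - (y $ i) / (2 * s) * heat s y"

definition heatDD :: "'n::finite \<Rightarrow> 'n \<Rightarrow> real \<Rightarrow> real^'n \<Rightarrow> real" where
  "heatDD i j s y = (y $ i * y $ j / (4 * s\<^sup>2) - (if i = j then 1 else 0) / (2 * s)) * heat s y"

lemma norm_square_axis:
  fixes y :: "real^'n::finite"
  shows "(norm (y + h *\<^sub>R axis i 1))\<^sup>2 = (norm y)\<^sup>2 + 2 * h * y $ i + h\<^sup>2"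
  unfolding power2_norm_eq_inner
  by (simp add: inner_add_left inner_add_right inner_axis inner_commute[of "axis i 1" y] power2_eq_square algebra_simps)

lemma heat_deriv_space:
  fixes y :: "real^'n::finite"
  assumes "s > 0"
  shows "((\<lambda>h. heat s (y + h *\<^sub>R axis i 1)) has_real_derivative heatD i s (y + h *\<^sub>R axis i 1)) (at h)"
  unfolding heatD_def heat_def norm_square_axis using assms
  by (auto intro!: derivative_eq_intros simp: axis_def field_simps)

lemma heatD_deriv_space:
  fixes y :: "real^'n::finite"
  assumes "s > 0"
  shows "((\<lambda>h. heatD i s (y + h *\<^sub>R axis j 1)) has_real_derivative heatDD i j s (y + h *\<^sub>R axis j 1)) (at h)"
proof -
  have d: "((\<lambda>h. - ((y + h *\<^sub>R axis j 1) $ i) / (2 * s)) has_real_derivative - ((if i = j then 1 else 0) / (2 * s))) (at h)"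
    using assms by (auto intro!: derivative_eq_intros simp: axis_def)
  have a: "- (d / (2 * s)) * k + - b / (2 * s) * k * (- a / (2 * s)) = (a * b / (4 * s\<^sup>2) - d / (2 * s)) * k" for a b d k
    using assms by (simp add: field_simps power2_eq_square)
  note D = DERIV_mult[OF d heat_deriv_space[OF assms, of y j h]]
  show ?thesis
    unfolding heatD_def heatDD_def
    by (rule DERIV_cong[OF D]) (simp only: heatD_def a)
qed

lemma heat_exp_ln:
  fixes y :: "real^'n::finite"
  assumes "s > 0"
  shows "heat s y = exp (- (norm y)\<^sup>2 / (4 * s) - CARD('n) / 2 * ln (4 * pi * s))"
proof -
  have "sqrt (4 * pi * s) = exp (ln (4 * pi * s) / 2)"
    using assms by (simp add: ln_sqrt[symmetric])
  then have "sqrt (4 * pi * s) ^ CARD('n) = exp (CARD('n) / 2 * ln (4 * pi * s))"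
    by (simp add: exp_of_nat_mult[symmetric])
  then show ?thesis unfolding heat_def by (simp add: exp_diff)
qed

text \<open>This is the heat equation for the kernel: the sum is its Laplacian in
  \<open>y\<close>.\<close>

lemma heat_deriv_time:
  fixes y :: "real^'n::finite"
  assumes "s > 0"
  shows "((\<lambda>s. heat s y) has_real_derivative (\<Sum>i\<in>UNIV. heatDD i i s y)) (at s)"
proof -
  have "((\<lambda>s. exp (- (norm y)\<^sup>2 / (4 * s) - CARD('n) / 2 * ln (4 * pi * s))) has_real_derivative
      ((norm y)\<^sup>2 / (4 * s\<^sup>2) - CARD('n) / (2 * s)) * heat s y) (at s)"
    unfolding heat_exp_ln[OF assms] using assms
    by (auto intro!: derivative_eq_intros simp: field_simps power2_eq_square)
  moreover have "(norm y)\<^sup>2 = (\<Sum>i\<in>UNIV. (y $ i)\<^sup>2)"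
    unfolding power2_norm_eq_inner inner_vec_def by (simp add: power2_eq_square)
  then have "((norm y)\<^sup>2 / (4 * s\<^sup>2) - CARD('n) / (2 * s)) * heat s y = (\<Sum>i\<in>UNIV. heatDD i i s y)"
    by (simp add: heatDD_def sum_distrib_right[symmetric] sum_subtractf sum_divide_distrib power2_eq_square)
  ultimately show ?thesis
    by (rule_tac has_field_derivative_transform_within_open[where S="{0<..}"]) (auto simp: assms heat_exp_ln)
qed

section \<open>Pointwise bounds by the kernel at doubled time\<close>

text \<open>Cubing \<open>u \<le> 3 * exp (u\<^sup>2 / 24)\<close> gives both the 27 and the
  exponent 1/8; lower powers lie below the cube because the base is at least 1. Third powers are the
  highest needed, for |y| times a second derivative of the kernel.\<close>

lemma power_exp_bound:
  fixes u :: real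
  assumes "u \<ge> 0" "k \<le> 3"
  shows "u ^ k * exp (- u\<^sup>2 / 8) \<le> 27"
proof -
  have "0 \<le> (u - 4)\<^sup>2" by simp
  then have "u \<le> 3 * (1 + u\<^sup>2 / 24)" by (simp add: power2_eq_square algebra_simps)
  also have "\<dots> \<le> 3 * exp (u\<^sup>2 / 24)" by (rule mult_left_mono[OF exp_ge_add_one_self]) simp
  finally have "u ^ k \<le> (3 * exp (u\<^sup>2 / 24)) ^ k" using assms by (intro power_mono) auto
  also have "\<dots> \<le> (3 * exp (u\<^sup>2 / 24)) ^ 3"
  proof (rule power_increasing[OF assms(2)])
    have "1 \<le> exp (u\<^sup>2 / 24)" by simp
    then show "1 \<le> 3 * exp (u\<^sup>2 / 24)" by linarith
  qed
  also have "\<dots> = 27 * exp (u\<^sup>2 / 8)"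
    by (simp add: power_mult_distrib exp_of_nat_mult[symmetric])
  finally show ?thesis by (simp add: exp_minus field_simps)
qed

lemma sqrt_double: "sqrt (4 * pi * (2 * s)) = sqrt 2 * sqrt (4 * pi * s)"
  unfolding real_sqrt_mult[symmetric] by (simp add: ac_simps)

text \<open>The exponent is split into two equal halves. One is the exponent at time
  \<open>2 * s\<close>; the other is a Gaussian factor in |y| / sqrt s, available for absorbing
  polynomials.\<close>

lemma heat_double:
  fixes y :: "real^'n::finite"
  assumes "s > 0"
  shows "heat s y = sqrt 2 ^ CARD('n) * (exp (- (norm y / sqrt s)\<^sup>2 / 8) * heat (2 * s) y)"
proof -
  note sqrt_double
  moreover have "exp (- (norm y)\<^sup>2 / (4 * s)) = exp (- (norm y / sqrt s)\<^sup>2 / 8) * exp (- (norm y)\<^sup>2 / (4 * (2 * s)))"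
    using assms by (simp add: exp_add[symmetric] power_divide field_simps)
  ultimately show ?thesis
    unfolding heat_def by (simp add: power_mult_distrib)
qed

lemma heat_moment_bound:
  fixes y :: "real^'n::finite"
  assumes "s > 0" "k \<le> 3"
  shows "(norm y / sqrt s) ^ k * heat s y \<le> 27 * sqrt 2 ^ CARD('n) * heat (2 * s) y"
proof -
  have "(norm y / sqrt s) ^ k * heat s y
      = ((norm y / sqrt s) ^ k * exp (- (norm y / sqrt s)\<^sup>2 / 8)) * (sqrt 2 ^ CARD('n) * heat (2 * s) y)"
    by (subst heat_double[OF assms(1)]) simp
  also have "\<dots> \<le> 27 * (sqrt 2 ^ CARD('n) * heat (2 * s) y)"
    using assms heat_pos[of "2 * s" y] by (intro mult_right_mono power_exp_bound) auto
  finally show ?thesis by simp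
qed

text \<open>The 27 comes from \<open>power_exp_bound\<close>, the power of sqrt 2 from the change of
  normalisation between the times \<open>s\<close> and \<open>2 * s\<close>.\<close>

definition kernel_const :: "'n::finite itself \<Rightarrow> real" where
  "kernel_const _ = 27 * sqrt 2 ^ CARD('n)"

lemma kernel_const_pos: "kernel_const TYPE('n::finite) > 0"
  by (simp add: kernel_const_def)

lemma heat_bound:
  fixes y :: "real^'n::finite"
  shows "s > 0 \<Longrightarrow> \<bar>heat s y\<bar> \<le> kernel_const TYPE('n) * heat (2 * s) y"
  using heat_moment_bound[of s 0 y] heat_pos[of s y] by (simp add: kernel_const_def)

lemma heatD_bound:
  fixes y :: "real^'n::finite"
  assumes "s > 0"
  shows "\<bar>heatD i s y\<bar> \<le> kernel_const TYPE('n) / sqrt s * heat (2 * s) y"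
proof -
  have "\<bar>heatD i s y\<bar> = \<bar>y $ i\<bar> / (2 * s) * heat s y"
    using assms heat_pos[of s y] by (simp add: heatD_def abs_mult)
  also have "\<dots> \<le> norm y / s * heat s y"
    using assms heat_pos[of s y] component_le_norm_cart[of y i] by (intro mult_right_mono frac_le) auto
  also have "\<dots> = ((norm y / sqrt s) ^ 1 * heat s y) / sqrt s"
    using assms by (simp add: field_simps)
  also have "\<dots> \<le> kernel_const TYPE('n) * heat (2 * s) y / sqrt s"
    using assms heat_moment_bound[of s 1 y] by (intro divide_right_mono) (auto simp: kernel_const_def)
  finally show ?thesis by simp
qed

lemma heatDD_bound_aux:
  fixes y :: "real^'n::finite"
  assumes "s > 0"
  shows "\<bar>heatDD i j s y\<bar> \<le> ((norm y / sqrt s)\<^sup>2 / 4 + 1 / 2) / s * heat s y"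
proof -
  have "\<bar>y $ i * y $ j\<bar> \<le> norm y * norm y"
    unfolding abs_mult by (intro mult_mono component_le_norm_cart) auto
  then have "\<bar>y $ i * y $ j / (4 * s\<^sup>2)\<bar> \<le> (norm y)\<^sup>2 / (4 * s\<^sup>2)"
    using assms by (simp add: abs_mult power2_eq_square divide_right_mono)
  moreover have "\<bar>(if i = j then 1 else 0) / (2 * s)\<bar> \<le> 1 / (2 * s)" using assms by auto
  ultimately have "\<bar>y $ i * y $ j / (4 * s\<^sup>2) - (if i = j then 1 else 0) / (2 * s)\<bar> \<le> (norm y)\<^sup>2 / (4 * s\<^sup>2) + 1 / (2 * s)"
    by linarith
  also have "\<dots> = ((norm y / sqrt s)\<^sup>2 / 4 + 1 / 2) / s"
    using assms by (simp add: power_divide field_simps power2_eq_square)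
  finally show ?thesis
    unfolding heatDD_def abs_mult abs_of_pos[OF heat_pos[OF assms]]
    by (rule mult_right_mono) (use heat_pos[OF assms] in \<open>auto intro: less_imp_le\<close>)
qed

lemma heatDD_bound:
  fixes y :: "real^'n::finite"
  assumes "s > 0"
  shows "\<bar>heatDD i j s y\<bar> \<le> kernel_const TYPE('n) / s * heat (2 * s) y"
proof -
  note heatDD_bound_aux[OF assms, of i j y]
  also have "((norm y / sqrt s)\<^sup>2 / 4 + 1 / 2) / s * heat s y
      = ((norm y / sqrt s) ^ 2 * heat s y / 4 + (norm y / sqrt s) ^ 0 * heat s y / 2) / s"
    by (simp add: algebra_simps add_divide_distrib)
  also have "\<dots> \<le> (kernel_const TYPE('n) * heat (2 * s) y / 4 + kernel_const TYPE('n) * heat (2 * s) y / 2) / s"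
    using assms heat_moment_bound[of s 2 y] heat_moment_bound[of s 0 y] unfolding kernel_const_def
    by (intro divide_right_mono add_mono) auto
  also have "\<dots> \<le> kernel_const TYPE('n) * heat (2 * s) y / s"
    using assms heat_pos[of "2 * s" y] kernel_const_pos[where 'n='n] by (intro divide_right_mono) auto
  finally show ?thesis by simp
qed

text \<open>The factor |y| improves 1/s to 1/sqrt s, which is integrable at 0. It is supplied by a
  Lipschitz function once its value at the centre has been subtracted.\<close>

lemma norm_heatDD_bound:
  fixes y :: "real^'n::finite"
  assumes "s > 0"
  shows "norm y * \<bar>heatDD i j s y\<bar> \<le> kernel_const TYPE('n) / sqrt s * heat (2 * s) y"
proof -
  have "norm y * \<bar>heatDD i j s y\<bar> \<le> norm y * (((norm y / sqrt s)\<^sup>2 / 4 + 1 / 2) / s * heat s y)"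
    by (intro mult_left_mono heatDD_bound_aux assms) auto
  also have "\<dots> = ((norm y / sqrt s) ^ 3 * heat s y / 4 + (norm y / sqrt s) ^ 1 * heat s y / 2) / sqrt s"
    using assms by (simp add: field_simps power_divide power2_eq_square power3_eq_cube)
  also have "\<dots> \<le> (kernel_const TYPE('n) * heat (2 * s) y / 4 + kernel_const TYPE('n) * heat (2 * s) y / 2) / sqrt s"
    using assms heat_moment_bound[of s 3 y] heat_moment_bound[of s 1 y] unfolding kernel_const_def
    by (intro divide_right_mono add_mono) auto
  also have "\<dots> \<le> kernel_const TYPE('n) * heat (2 * s) y / sqrt s"
    using assms heat_pos[of "2 * s" y] kernel_const_pos[where 'n='n] by (intro divide_right_mono) auto
  finally show ?thesis by simp
qed

text \<open>Provides one majorant for all times in [a, b]: the exponential is taken at the latest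
  time and the normalisation at the earliest.\<close>

lemma heat_time_bound:
  fixes y :: "real^'n::finite"
  assumes "0 < a" "a \<le> s" "s \<le> b"
  shows "heat s y \<le> sqrt (b / a) ^ CARD('n) * heat b y"
proof -
  have "heat s y \<le> exp (- (norm y)\<^sup>2 / (4 * b)) / sqrt (4 * pi * a) ^ CARD('n)"
    unfolding heat_def using assms
    by (intro frac_le power_mono) (auto simp: frac_le)
  also have "\<dots> = sqrt (b / a) ^ CARD('n) * heat b y"
    unfolding heat_def using assms by (simp add: real_sqrt_divide real_sqrt_mult power_divide power_mult_distrib)
  finally show ?thesis .
qed

text \<open>Provides one majorant for all shifts up to sqrt s, as differentiation in space requires.
  It rests on \<open>(norm y)\<^sup>2 \<le> 2 * (norm (y + v))\<^sup>2 + 2 * (norm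
  v)\<^sup>2\<close>; the leading 2 bounds \<open>exp (1 / 4)\<close>.\<close>

lemma heat_shift_bound:
  fixes y v :: "real^'n::finite"
  assumes "s > 0" "norm v \<le> sqrt s"
  shows "heat s (y + v) \<le> 2 * sqrt 2 ^ CARD('n) * heat (2 * s) y"
proof -
  have "norm y \<le> norm (y + v) + norm v" by (metis add_diff_cancel norm_triangle_ineq4)
  then have "(norm y)\<^sup>2 \<le> (norm (y + v) + norm v)\<^sup>2" by (intro power_mono) auto
  also have "\<dots> \<le> 2 * (norm (y + v))\<^sup>2 + 2 * (norm v)\<^sup>2"
    using sum_squares_bound[of "norm (y + v)" "norm v"] by (simp add: power2_sum)
  also have "(norm v)\<^sup>2 \<le> s" using assms by (metis norm_ge_zero power_mono real_sqrt_pow2 less_imp_le)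
  finally have "- (norm (y + v))\<^sup>2 / (4 * s) \<le> 1 / 4 + - (norm y)\<^sup>2 / (4 * (2 * s))"
    using assms by (simp add: field_simps)
  then have "exp (- (norm (y + v))\<^sup>2 / (4 * s)) \<le> exp (1 / 4) * exp (- (norm y)\<^sup>2 / (4 * (2 * s)))"
    by (metis exp_add exp_le_cancel_iff)
  also have "exp (1 / 4 :: real) \<le> 2"
    using exp_bound_half[of "1/4::real"] by simp
  finally have "exp (- (norm (y + v))\<^sup>2 / (4 * s)) \<le> 2 * exp (- (norm y)\<^sup>2 / (4 * (2 * s)))"
    by simp
  then show ?thesis
    unfolding heat_def sqrt_double power_mult_distrib using divide_right_mono[of _ _ "sqrt (4 * pi * s) ^ CARD('n)"] assms
    by simp
qed

text \<open>What the kernel and its derivatives have in common. Up to a constant the amplitude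
  \<open>B s\<close> is 1, s^(-1/2) and s^(-1) for zero, one and two derivatives; its continuity
  makes it bounded on compact sets of positive times.\<close>

definition gaussian_kernel :: "(real \<Rightarrow> real^'n::finite \<Rightarrow> real) \<Rightarrow> (real \<Rightarrow> real) \<Rightarrow> bool" where
  "gaussian_kernel q B \<longleftrightarrow> (\<forall>s>0. \<forall>y. \<bar>q s y\<bar> \<le> B s * heat (2 * s) y)
     \<and> continuous_on ({0<..} \<times> UNIV) (\<lambda>p. q (fst p) (snd p)) \<and> continuous_on {0<..} B"

lemma gaussian_kernelD: "gaussian_kernel q B \<Longrightarrow> s > 0 \<Longrightarrow> \<bar>q s y\<bar> \<le> B s * heat (2 * s) y"
  by (simp add: gaussian_kernel_def)

lemma gaussian_kernel_continuous_bound: "gaussian_kernel q B \<Longrightarrow> continuous_on {0<..} B"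
  by (simp add: gaussian_kernel_def)

lemma continuous_on_heat: "continuous_on ({0<..} \<times> UNIV) (\<lambda>p. heat (fst p) (snd p :: real^'n::finite))"
  unfolding heat_def by (intro continuous_intros) auto

lemma gaussian_kernel_heat: "gaussian_kernel (heat :: real \<Rightarrow> real^'n::finite \<Rightarrow> real) (\<lambda>s. kernel_const TYPE('n))"
  using heat_bound continuous_on_heat unfolding gaussian_kernel_def by auto

lemma gaussian_kernel_heatD: "gaussian_kernel (heatD i :: real \<Rightarrow> real^'n::finite \<Rightarrow> real) (\<lambda>s. kernel_const TYPE('n) / sqrt s)"
  unfolding gaussian_kernel_def
proof (intro conjI)
  show "continuous_on ({0<..} \<times> UNIV) (\<lambda>p. heatD i (fst p) (snd p))"
    unfolding heatD_def by (intro continuous_intros continuous_on_heat) auto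
  show "continuous_on {0<..} (\<lambda>s. kernel_const TYPE('n) / sqrt s)" by (intro continuous_intros) auto
qed (use heatD_bound in auto)

lemma gaussian_kernel_heatDD: "gaussian_kernel (heatDD i j :: real \<Rightarrow> real^'n::finite \<Rightarrow> real) (\<lambda>s. kernel_const TYPE('n) / s)"
  unfolding gaussian_kernel_def
proof (intro conjI)
  show "continuous_on ({0<..} \<times> UNIV) (\<lambda>p. heatDD i j (fst p) (snd p))"
    unfolding heatDD_def by (intro continuous_intros continuous_on_heat) auto
  show "continuous_on {0<..} (\<lambda>s. kernel_const TYPE('n) / s)" by (intro continuous_intros) auto
qed (use heatDD_bound in auto)

lemma gaussian_kernel_continuous:
  assumes "gaussian_kernel q B" "s > 0"
  shows "continuous_on UNIV (q s)"
proof -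
  have "continuous_on UNIV (\<lambda>y. (\<lambda>p. q (fst p) (snd p)) (s, y))"
    by (rule continuous_on_compose2[of "{0<..} \<times> UNIV"])
      (use assms in \<open>auto simp: gaussian_kernel_def intro!: continuous_intros\<close>)
  then show ?thesis by simp
qed

lemma gaussian_kernel_integrable:
  assumes "gaussian_kernel q B" "s > 0"
  shows "integrable lborel (q s)"
proof (rule Bochner_Integration.integrable_bound)
  show "integrable lborel (\<lambda>y. B s * heat (2 * s) y)" using assms by (auto intro: heat_integrable)
  show "q s \<in> borel_measurable lborel"
    using borel_measurable_continuous_onI[OF gaussian_kernel_continuous[OF assms]] by simp
  show "AE x in lborel. norm (q s x) \<le> norm (B s * heat (2 * s) x)"
    using assms unfolding gaussian_kernel_def by (auto intro!: AE_I2 order_trans[OF _ abs_ge_self])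
qed

lemma gaussian_kernel_nonneg:
  fixes q :: "real \<Rightarrow> real^'n::finite \<Rightarrow> real"
  assumes "gaussian_kernel q B" "s > 0"
  shows "B s \<ge> 0"
proof -
  have "0 \<le> \<bar>q s 0\<bar>" by simp
  also have "\<dots> \<le> B s * heat (2 * s) (0::real^'n)" by (rule gaussian_kernelD[OF assms])
  finally show ?thesis using heat_pos[of "2 * s" "0::real^'n"] assms by (simp add: zero_le_mult_iff)
qed

section \<open>Convolution: bounds, continuity, differentiation\<close>

definition conv :: "(real^'n::finite \<Rightarrow> real) \<Rightarrow> (real^'n \<Rightarrow> real) \<Rightarrow> real^'n \<Rightarrow> real" where
  "conv q g x = (\<integral>y. q (x - y) * g y \<partial>lborel)"

text \<open>In the defining form \<open>x\<close> sits in the kernel, which serves differentiation;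
  here it sits in \<open>g\<close>, which serves bounds, continuity and periodicity.\<close>

lemma conv_commute: "conv q g x = (\<integral>z. q z * g (x - z) \<partial>lborel)"
  unfolding conv_def using lborel_integral_reflect[of "\<lambda>z. q z * g (x - z)" x] by simp

lemma integrable_mult_bounded:
  fixes q g :: "'a \<Rightarrow> real"
  assumes "integrable M q" "g \<in> borel_measurable M" "\<And>x. \<bar>g x\<bar> \<le> K"
  shows "integrable M (\<lambda>x. q x * g x)"
proof (rule Bochner_Integration.integrable_bound)
  show "integrable M (\<lambda>x. K * q x)" using assms by simp
  show "AE x in M. norm (q x * g x) \<le> norm (K * q x)"
  proof (rule AE_I2)
    fix x show "norm (q x * g x) \<le> norm (K * q x)"
      using mult_right_mono[OF order_trans[OF assms(3)[of x] abs_ge_self], of "\<bar>q x\<bar>"]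
      by (simp add: abs_mult mult.commute)
  qed
qed (use assms in measurable)

lemma continuous_lborel_measurable: "continuous_on UNIV (f :: 'a::euclidean_space \<Rightarrow> real) \<Longrightarrow> f \<in> borel_measurable lborel"
  using borel_measurable_continuous_onI by auto

lemma conv_integrable:
  fixes q g :: "real^'n::finite \<Rightarrow> real"
  assumes "integrable lborel q" "continuous_on UNIV g" "\<And>x. \<bar>g x\<bar> \<le> K"
  shows "integrable lborel (\<lambda>z. q z * g (x - z))" "integrable lborel (\<lambda>y. q (x - y) * g y)"
proof -
  have "continuous_on UNIV (\<lambda>z. g (x - z))"
    by (rule continuous_on_compose2[OF assms(2)]) (auto intro!: continuous_intros)
  then show *: "integrable lborel (\<lambda>z. q z * g (x - z))"
    by (rule integrable_mult_bounded[OF assms(1) continuous_lborel_measurable]) (rule assms(3))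
  show "integrable lborel (\<lambda>y. q (x - y) * g y)"
    using * lborel_integrable_reflect[of "\<lambda>z. q z * g (x - z)" x] by simp
qed

lemma conv_bound:
  fixes g :: "real^'n::finite \<Rightarrow> real"
  assumes q: "gaussian_kernel q B" and s: "s > 0" and g: "continuous_on UNIV g" "\<And>x. \<bar>g x\<bar> \<le> K"
  shows "\<bar>conv (q s) g x\<bar> \<le> B s * K"
proof -
  have "\<bar>conv (q s) g x\<bar> \<le> (\<integral>z. \<bar>q s z * g (x - z)\<bar> \<partial>lborel)"
    unfolding conv_commute by (rule integral_abs_bound)
  also have "\<dots> \<le> (\<integral>z. B s * K * heat (2 * s) (z::real^'n) \<partial>lborel)"
  proof (rule Bochner_Integration.integral_mono)
    show "integrable lborel (\<lambda>z. \<bar>q s z * g (x - z)\<bar>)"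
      by (intro integrable_abs conv_integrable[OF gaussian_kernel_integrable[OF q s] g])
    show "integrable lborel (\<lambda>z. B s * K * heat (2 * s) (z::real^'n))" using s by (simp add: heat_integrable)
    fix z :: "real^'n"
    have "\<bar>q s z * g (x - z)\<bar> \<le> (B s * heat (2 * s) z) * K"
      unfolding abs_mult using gaussian_kernelD[OF q s, of z] s g(2)[of "x - z"] gaussian_kernel_nonneg[OF q s] heat_pos[of "2 * s" z]
      by (intro mult_mono) auto
    then show "\<bar>q s z * g (x - z)\<bar> \<le> B s * K * heat (2 * s) z" by (simp add: ac_simps)
  qed
  also have "\<dots> = B s * K" using s by (simp add: integral_heat)
  finally show ?thesis .
qed

text \<open>The majorant depends on the range of times, so dominated convergence is applied for
  \<open>s\<close> in \<open>{a<..<b}\<close> with \<open>a > 0\<close>; continuity being local,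
  these ranges cover all positive times.\<close>

lemma continuous_on_conv:
  fixes f :: "'a::metric_space \<Rightarrow> real^'n::finite \<Rightarrow> real"
  assumes q: "gaussian_kernel q B"
    and f: "continuous_on UNIV (\<lambda>p. f (fst p) (snd p))" "\<And>t x. \<bar>f t x\<bar> \<le> K"
  shows "continuous_on ({0<..} \<times> UNIV) (\<lambda>p. conv (q (fst p)) (f (fst (snd p))) (snd (snd p)))"
proof -
  let ?F = "\<lambda>p::real \<times> 'a \<times> (real^'n). conv (q (fst p)) (f (fst (snd p))) (snd (snd p))"
  have ft: "continuous_on UNIV (f t)" for t
  proof -
    have "continuous_on UNIV (\<lambda>x::real^'n. (t, x))" by (intro continuous_intros)
    from continuous_on_compose2[OF f(1) this] show ?thesis by simp
  qed
  have part: "continuous_on ({a<..<b} \<times> UNIV) ?F" if ab: "0 < a" "a < b" for a b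
  proof -
    have "compact (B ` {a..b})"
      using ab by (intro compact_continuous_image continuous_on_subset[OF gaussian_kernel_continuous_bound[OF q]]) auto
    then have "bdd_above (B ` {a..b})" by (intro bounded_imp_bdd_above compact_imp_bounded)
    then obtain C where "\<forall>r\<in>B ` {a..b}. r \<le> C" unfolding bdd_above_def by blast
    then have C: "\<And>s. s \<in> {a..b} \<Longrightarrow> B s \<le> C" by blast
    have bd: "\<bar>q s z * f t (x - z)\<bar> \<le> C * K * sqrt (b / a) ^ CARD('n) * heat (2 * b) z" if s: "s \<in> {a<..<b}" for s t x z
    proof -
      have "\<bar>q s z\<bar> \<le> B s * heat (2 * s) z" by (rule gaussian_kernelD[OF q]) (use s ab in auto)
      also have "\<dots> \<le> C * (sqrt (b / a) ^ CARD('n) * heat (2 * b) z)"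
        using s ab C[of s] gaussian_kernel_nonneg[OF q, of s] heat_pos[of "2 * s" z] heat_time_bound[of "2 * a" "2 * s" "2 * b" z]
        by (intro mult_mono) auto
      finally have "\<bar>q s z\<bar> * \<bar>f t (x - z)\<bar> \<le> C * (sqrt (b / a) ^ CARD('n) * heat (2 * b) z) * K"
        using f(2)[of t "x - z"] by (intro mult_mono) auto
      then show ?thesis by (simp add: abs_mult ac_simps)
    qed
    have c: "continuous_on ({a<..<b} \<times> UNIV)
        (\<lambda>p::real \<times> 'a \<times> (real^'n). q (fst p) z * f (fst (snd p)) (snd (snd p) - z))" for z
    proof (intro continuous_on_mult)
      have "continuous_on ({0<..} \<times> UNIV) (\<lambda>p. q (fst p) (snd p))" using q by (simp add: gaussian_kernel_def)
      from this show "continuous_on ({a<..<b} \<times> UNIV) (\<lambda>p::real \<times> 'a \<times> (real^'n). q (fst p) z)"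
        by (rule continuous_on_uncurry) (use ab in \<open>auto intro!: continuous_intros\<close>)
      show "continuous_on ({a<..<b} \<times> UNIV) (\<lambda>p::real \<times> 'a \<times> (real^'n). f (fst (snd p)) (snd (snd p) - z))"
        by (rule continuous_on_uncurry[where A=UNIV and B=UNIV]) (use f(1) in \<open>auto intro!: continuous_intros\<close>)
    qed
    show ?thesis
      unfolding conv_commute
    proof (rule continuous_on_integral_dominated)
      show "integrable lborel (\<lambda>z. C * K * sqrt (b / a) ^ CARD('n) * heat (2 * b) (z::real^'n))"
        using ab by (simp add: heat_integrable)
      show "(\<lambda>z. q (fst p) z * f (fst (snd p)) (snd (snd p) - z)) \<in> borel_measurable lborel"
        if "p \<in> {a<..<b} \<times> UNIV" for p
      proof -
        have "integrable lborel (q (fst p))" using gaussian_kernel_integrable[OF q] that ab by auto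
        from conv_integrable(1)[OF this ft f(2)] show ?thesis by auto
      qed
    qed (use c bd in auto)
  qed
  have "continuous (at p) ?F" if p: "p \<in> {0<..} \<times> UNIV" for p
  proof -
    have "continuous_on ({fst p / 2<..<2 * fst p} \<times> UNIV) ?F" using p by (intro part) auto
    moreover have "open ({fst p / 2<..<2 * fst p} \<times> (UNIV :: ('a \<times> (real^'n)) set))" by (intro open_Times) auto
    ultimately show ?thesis using p by (auto simp: continuous_on_eq_continuous_at)
  qed
  then show ?thesis by (simp add: continuous_on_eq_continuous_at open_Times)
qed

lemma continuous_on_conv_space:
  fixes g :: "real^'n::finite \<Rightarrow> real"
  assumes "gaussian_kernel q B" "s > 0" "continuous_on UNIV g" "\<And>x. \<bar>g x\<bar> \<le> K"
  shows "continuous_on UNIV (conv (q s) g)"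
proof -
  have "continuous_on UNIV (\<lambda>p::real \<times> _. g (snd p))"
    by (rule continuous_on_compose2[OF assms(3)]) (auto intro!: continuous_intros)
  from continuous_on_conv[OF assms(1), of "\<lambda>t. g", OF this assms(4)]
  have "continuous_on ({0<..} \<times> UNIV) (\<lambda>p::real \<times> real \<times> _. conv (q (fst p)) g (snd (snd p)))" by simp
  moreover have "continuous_on UNIV (\<lambda>x::real^'n. (s, 0::real, x))" by (intro continuous_intros)
  ultimately have "continuous_on UNIV (\<lambda>x. conv (q (fst (s, 0::real, x))) g (snd (snd (s, 0::real, x))))"
    by (rule continuous_on_compose2) (use assms(2) in auto)
  then show ?thesis by simp
qed

lemma conv_deriv_space:
  fixes g :: "real^'n::finite \<Rightarrow> real"
  assumes q: "gaussian_kernel q B" and q': "gaussian_kernel q' B'" and s: "s > 0"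
    and der: "\<And>y h. ((\<lambda>h. q s (y + h *\<^sub>R axis i 1)) has_real_derivative q' s (y + h *\<^sub>R axis i 1)) (at h)"
    and g: "continuous_on UNIV g" "\<And>x. \<bar>g x\<bar> \<le> K"
  shows "((\<lambda>h. conv (q s) g (x + h *\<^sub>R axis i 1)) has_real_derivative conv (q' s) g (x + h *\<^sub>R axis i 1)) (at h)"
proof -
  let ?e = "axis i 1 :: real^'n"
  \<comment> \<open>It suffices to treat the increment 0 at every base point; translating the base
    point along the axis then gives all \<open>h\<close>.\<close>
  have main: "((\<lambda>h. conv (q s) g (x + h *\<^sub>R ?e)) has_real_derivative conv (q' s) g (x + 0 *\<^sub>R ?e)) (at 0)" for x
    unfolding conv_def
  \<comment> \<open>One doubling of time comes from the kernel bound, the other from absorbing the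
    shift, which may reach \<open>sqrt (2 * s)\<close>.\<close>
  proof (rule has_real_derivative_integral_dominated[where d="sqrt (2 * s)"
        and g="\<lambda>y. B' s * (2 * sqrt 2 ^ CARD('n) * heat (2 * (2 * s)) (x - y)) * K"])
    show "sqrt (2 * s) > 0" using s by simp
    fix h :: real
    have "integrable lborel (\<lambda>y. q s ((x + h *\<^sub>R ?e) - y) * g y)" 
      using conv_integrable(2)[OF gaussian_kernel_integrable[OF q s] g] .
    then show "integrable lborel (\<lambda>y. q s (x + h *\<^sub>R ?e - y) * g y)" .
  next
    fix h :: real and y :: "real^'n"
    have "((\<lambda>h. q s ((x - y) + h *\<^sub>R ?e)) has_real_derivative q' s ((x - y) + h *\<^sub>R ?e)) (at h)" by (rule der)
    then show "((\<lambda>h. q s (x + h *\<^sub>R ?e - y) * g y) has_real_derivative q' s (x + h *\<^sub>R ?e - y) * g y) (at h)"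
      by (intro DERIV_cmult_right) (simp add: algebra_simps)
    assume h: "\<bar>h - 0\<bar> < sqrt (2 * s)"
    have "\<bar>q' s (x + h *\<^sub>R ?e - y)\<bar> \<le> B' s * heat (2 * s) (x + h *\<^sub>R ?e - y)"
      by (rule gaussian_kernelD[OF q' s])
    also have "\<dots> \<le> B' s * (2 * sqrt 2 ^ CARD('n) * heat (2 * (2 * s)) (x - y))"
      using heat_shift_bound[of "2 * s" "h *\<^sub>R ?e" "x - y"] s h gaussian_kernel_nonneg[OF q' s]
      by (intro mult_left_mono) (auto simp: algebra_simps)
    finally have "\<bar>q' s (x + h *\<^sub>R ?e - y)\<bar> * \<bar>g y\<bar> \<le> B' s * (2 * sqrt 2 ^ CARD('n) * heat (2 * (2 * s)) (x - y)) * K"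
      using g(2)[of y] by (intro mult_mono) auto
    then show "\<bar>q' s (x + h *\<^sub>R ?e - y) * g y\<bar> \<le> B' s * (2 * sqrt 2 ^ CARD('n) * heat (2 * (2 * s)) (x - y)) * K"
      by (simp add: abs_mult)
  next
    have "integrable lborel (\<lambda>y. heat (2 * (2 * s)) (x - y))"
      using lborel_integrable_reflect[of "heat (2 * (2 * s))" x] heat_integrable[of "2 * (2 * s)"] s by auto
    then show "integrable lborel (\<lambda>y. B' s * (2 * sqrt 2 ^ CARD('n) * heat (2 * (2 * s)) (x - y)) * K)" by simp
    show "(\<lambda>y. q' s (x + 0 *\<^sub>R ?e - y) * g y) \<in> borel_measurable lborel"
      using conv_integrable(2)[OF gaussian_kernel_integrable[OF q' s] g, of x] by simp
  qed
  have "((\<lambda>k. conv (q s) g ((x + h *\<^sub>R ?e) + (k - h) *\<^sub>R ?e)) has_real_derivative conv (q' s) g (x + h *\<^sub>R ?e)) (at h)"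
  proof -
    have "((\<lambda>k. k - h) has_real_derivative 1) (at h)" by (auto intro!: derivative_eq_intros)
    moreover have "((\<lambda>k. conv (q s) g ((x + h *\<^sub>R ?e) + k *\<^sub>R ?e)) has_real_derivative conv (q' s) g (x + h *\<^sub>R ?e)) (at (h - h))"
      using main[of "x + h *\<^sub>R ?e"] by simp
    ultimately show ?thesis
      using DERIV_chain2[of "\<lambda>k. conv (q s) g ((x + h *\<^sub>R ?e) + k *\<^sub>R ?e)" _ "\<lambda>k. k - h"] by fastforce
  qed
  then show ?thesis by (simp add: algebra_simps)
qed

section \<open>Smoothing and decay of the heat flow on the torus\<close>

definition bcont :: "(real^'n::finite \<Rightarrow> real) \<Rightarrow> bool" where
  "bcont g \<longleftrightarrow> continuous_on UNIV g \<and> (\<exists>K. \<forall>x. \<bar>g x\<bar> \<le> K)"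

text \<open>The heat flow leaves constants alone, so decay can only be stated for the oscillation.
  Allowing any upper bound \<open>d\<close> keeps suprema out of the statements.\<close>

definition osc_le :: "(real^'n::finite \<Rightarrow> real) \<Rightarrow> real \<Rightarrow> bool" where
  "osc_le g d \<longleftrightarrow> (\<forall>x y. \<bar>g x - g y\<bar> \<le> d)"

lemma bcontE:
  assumes "bcont g"
  obtains K where "continuous_on UNIV g" "\<And>x. \<bar>g x\<bar> \<le> K"
  using assms unfolding bcont_def by blast

lemma bcont_const: "bcont (\<lambda>_. c)"
  unfolding bcont_def by auto

lemma bcont_diff:
  assumes "bcont f" "bcont g"
  shows "bcont (\<lambda>x. f x - g x)"
proof -
  from assms obtain K L where "continuous_on UNIV f" "\<And>x. \<bar>f x\<bar> \<le> K" "continuous_on UNIV g" "\<And>x. \<bar>g x\<bar> \<le> L"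
    by (metis bcont_def)
  then have "continuous_on UNIV (\<lambda>x. f x - g x)" "\<bar>f x - g x\<bar> \<le> K + L" for x
    by (auto intro!: continuous_intros order_trans[OF abs_triangle_ineq4 add_mono])
  then show ?thesis unfolding bcont_def by blast
qed

lemma bcont_conv:
  assumes "gaussian_kernel q B" "s > 0" "bcont g"
  shows "bcont (conv (q s) g)"
proof -
  from assms(3) obtain K where g: "continuous_on UNIV g" "\<And>x. \<bar>g x\<bar> \<le> K" by (rule bcontE) blast
  show ?thesis
    unfolding bcont_def
    using continuous_on_conv_space[OF assms(1,2) g] conv_bound[OF assms(1,2) g] by blast
qed

lemma conv_integrable':
  assumes "integrable lborel q" "bcont g"
  shows "integrable lborel (\<lambda>z. q z * g (x - z))" "integrable lborel (\<lambda>y. q (x - y) * g y)"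
proof -
  from assms(2) obtain K where g: "continuous_on UNIV g" "\<And>x. \<bar>g x\<bar> \<le> K" by (rule bcontE) blast
  show "integrable lborel (\<lambda>z. q z * g (x - z))" "integrable lborel (\<lambda>y. q (x - y) * g y)"
    by (rule conv_integrable[OF assms(1) g])+
qed

lemma conv_diff:
  assumes "integrable lborel q" "bcont f" "bcont g"
  shows "conv q (\<lambda>x. f x - g x) x = conv q f x - conv q g x"
  unfolding conv_def using conv_integrable'(2)[OF assms(1,2)] conv_integrable'(2)[OF assms(1,3)]
  by (simp add: right_diff_distrib)

lemma conv_const: "conv q (\<lambda>_. c) x = c * (\<integral>z. q z \<partial>lborel)"
  unfolding conv_commute by simp

lemma conv_heat_const: "s > 0 \<Longrightarrow> conv (heat s) (\<lambda>_. c) x = c"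
  by (simp add: conv_const integral_heat)

lemma conv_heat_deriv:
  assumes "s > 0" "bcont g"
  shows "((\<lambda>h. conv (heat s) g (x + h *\<^sub>R axis i 1)) has_real_derivative conv (heatD i s) g (x + h *\<^sub>R axis i 1)) (at h)"
proof -
  from assms(2) obtain K where g: "continuous_on UNIV g" "\<And>x. \<bar>g x\<bar> \<le> K" by (rule bcontE) blast
  show ?thesis
    by (rule conv_deriv_space[OF gaussian_kernel_heat gaussian_kernel_heatD assms(1) _ g]) (rule heat_deriv_space[OF assms(1)])
qed

lemma conv_heatD_deriv:
  assumes "s > 0" "bcont g"
  shows "((\<lambda>h. conv (heatD i s) g (x + h *\<^sub>R axis j 1)) has_real_derivative conv (heatDD i j s) g (x + h *\<^sub>R axis j 1)) (at h)"
proof -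
  from assms(2) obtain K where g: "continuous_on UNIV g" "\<And>x. \<bar>g x\<bar> \<le> K" by (rule bcontE) blast
  show ?thesis
    by (rule conv_deriv_space[OF gaussian_kernel_heatD gaussian_kernel_heatDD assms(1) _ g]) (rule heatD_deriv_space[OF assms(1)])
qed

text \<open>The heat flow of the constant 1 does not depend on \<open>x\<close>, and its derivative
  in \<open>x\<close> is this integral.\<close>

lemma integral_heatD:
  fixes i :: "'n::finite"
  assumes "s > 0" shows "(\<integral>z. heatD i s z \<partial>lborel) = 0"
proof -
  have "((\<lambda>h. conv (heat s) (\<lambda>_::real^'n. 1) (0 + h *\<^sub>R axis i 1)) has_real_derivative conv (heatD i s) (\<lambda>_. 1) (0 + 0 *\<^sub>R axis i 1)) (at 0)"
    by (rule conv_heat_deriv[OF assms bcont_const])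
  then have "((\<lambda>h::real. 1) has_real_derivative conv (heatD i s) (\<lambda>_. 1) 0) (at 0)"
    using assms by (simp add: conv_heat_const)
  from DERIV_unique[OF this DERIV_const] show ?thesis by (simp add: conv_const)
qed

lemma integral_heatDD:
  fixes i j :: "'n::finite"
  assumes "s > 0" shows "(\<integral>z. heatDD i j s z \<partial>lborel) = 0"
proof -
  have "((\<lambda>h. conv (heatD i s) (\<lambda>_::real^'n. 1) (0 + h *\<^sub>R axis j 1)) has_real_derivative conv (heatDD i j s) (\<lambda>_. 1) (0 + 0 *\<^sub>R axis j 1)) (at 0)"
    by (rule conv_heatD_deriv[OF assms bcont_const])
  then have "((\<lambda>h::real. 0) has_real_derivative conv (heatDD i j s) (\<lambda>_. 1) 0) (at 0)"
    using assms by (simp add: conv_const integral_heatD)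
  from DERIV_unique[OF this DERIV_const] show ?thesis by (simp add: conv_const)
qed

text \<open>A kernel of integral 0 does not see constants, so \<open>g\<close> may be replaced by
  \<open>g - g 0\<close>, whose size is at most the oscillation.\<close>

lemma conv_osc_bound:
  fixes g :: "real^'n::finite \<Rightarrow> real"
  assumes q: "gaussian_kernel q B" and s: "s > 0" and z: "(\<integral>z. q s z \<partial>lborel) = 0"
    and g: "bcont g" "osc_le g d"
  shows "\<bar>conv (q s) g x\<bar> \<le> B s * d"
proof -
  have "bcont (\<lambda>x. g x - g 0)" by (rule bcont_diff[OF g(1) bcont_const])
  then have "\<bar>conv (q s) (\<lambda>x. g x - g 0) x\<bar> \<le> B s * d"
    using g(2) by (intro conv_bound[OF q s]) (auto simp: bcont_def osc_le_def)
  moreover have "conv (q s) (\<lambda>x. g x - g 0) x = conv (q s) g x"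
    using conv_diff[OF gaussian_kernel_integrable[OF q s] g(1) bcont_const, of "g 0" x] by (simp add: conv_const z)
  ultimately show ?thesis by simp
qed

text \<open>Subtracting the value at \<open>x\<close> costs nothing because the kernel has integral
  0, and leaves a factor L |z| to be absorbed by \<open>norm_heatDD_bound\<close>.\<close>

lemma conv_heatDD_lipschitz_bound:
  fixes g :: "real^'n::finite \<Rightarrow> real"
  assumes s: "s > 0" and g: "bcont g" and lip: "\<And>x y. \<bar>g x - g y\<bar> \<le> L * norm (x - y)" and L: "L \<ge> 0"
  shows "\<bar>conv (heatDD i j s) g x\<bar> \<le> kernel_const TYPE('n) / sqrt s * L"
proof -
  note I = gaussian_kernel_integrable[OF gaussian_kernel_heatDD[of i j] s]
  have i1: "integrable lborel (\<lambda>z. heatDD i j s z * (g (x - z) - g x))"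
    using conv_integrable'(1)[OF I bcont_diff[OF g bcont_const[of "g x"]], of x] .
  have "conv (heatDD i j s) g x = (\<integral>z. heatDD i j s z * (g (x - z) - g x) \<partial>lborel)"
    using conv_diff[OF I g bcont_const[of "g x"], of x] integral_heatDD[OF s, of i j]
    unfolding conv_const unfolding conv_commute by simp
  also have "\<bar>\<dots>\<bar> \<le> (\<integral>z. \<bar>heatDD i j s z * (g (x - z) - g x)\<bar> \<partial>lborel)"
    by (rule integral_abs_bound)
  also have "\<dots> \<le> (\<integral>z. kernel_const TYPE('n) / sqrt s * L * heat (2 * s) (z::real^'n) \<partial>lborel)"
  proof (rule Bochner_Integration.integral_mono)
    show "integrable lborel (\<lambda>z. \<bar>heatDD i j s z * (g (x - z) - g x)\<bar>)" using i1 by (rule integrable_abs)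
    show "integrable lborel (\<lambda>z. kernel_const TYPE('n) / sqrt s * L * heat (2 * s) (z::real^'n))" using s by (simp add: heat_integrable)
    fix z :: "real^'n"
    have "\<bar>heatDD i j s z * (g (x - z) - g x)\<bar> \<le> \<bar>heatDD i j s z\<bar> * (L * norm z)"
      unfolding abs_mult using lip[of "x - z" x] by (intro mult_left_mono) auto
    also have "\<dots> = L * (norm z * \<bar>heatDD i j s z\<bar>)" by simp
    also have "\<dots> \<le> L * (kernel_const TYPE('n) / sqrt s * heat (2 * s) z)"
      by (intro mult_left_mono norm_heatDD_bound s L)
    finally show "\<bar>heatDD i j s z * (g (x - z) - g x)\<bar> \<le> kernel_const TYPE('n) / sqrt s * L * heat (2 * s) z" by (simp add: ac_simps)
  qed
  also have "\<dots> = kernel_const TYPE('n) / sqrt s * L" using s by (simp add: integral_heat)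
  finally show ?thesis .
qed

text \<open>Quantifies the convergence to the initial value; it is later used for continuity of the
  flow at \<open>s = 0\<close>.\<close>

lemma conv_heat_lipschitz_approx:
  fixes g :: "real^'n::finite \<Rightarrow> real"
  assumes s: "s > 0" and g: "bcont g" and lip: "\<And>x y. \<bar>g x - g y\<bar> \<le> L * norm (x - y)" and L: "L \<ge> 0"
  shows "\<bar>conv (heat s) g x - g x\<bar> \<le> kernel_const TYPE('n) * sqrt s * L"
proof -
  note I = heat_integrable[OF s, where 'n='n]
  have i1: "integrable lborel (\<lambda>z. heat s z * (g (x - z) - g x))"
    using conv_integrable'(1)[OF I bcont_diff[OF g bcont_const[of "g x"]], of x] .
  have "conv (heat s) g x - g x = (\<integral>z. heat s z * (g (x - z) - g x) \<partial>lborel)"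
    using conv_diff[OF I g bcont_const[of "g x"], of x] conv_heat_const[OF s, of "g x" x]
    unfolding conv_commute by simp
  also have "\<bar>\<dots>\<bar> \<le> (\<integral>z. \<bar>heat s z * (g (x - z) - g x)\<bar> \<partial>lborel)"
    by (rule integral_abs_bound)
  also have "\<dots> \<le> (\<integral>z. kernel_const TYPE('n) * sqrt s * L * heat (2 * s) (z::real^'n) \<partial>lborel)"
  proof (rule Bochner_Integration.integral_mono)
    show "integrable lborel (\<lambda>z. \<bar>heat s z * (g (x - z) - g x)\<bar>)" using i1 by (rule integrable_abs)
    show "integrable lborel (\<lambda>z. kernel_const TYPE('n) * sqrt s * L * heat (2 * s) (z::real^'n))" using s by (simp add: heat_integrable)
    fix z :: "real^'n"
    have "\<bar>heat s z * (g (x - z) - g x)\<bar> \<le> heat s z * (L * norm z)"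
      unfolding abs_mult using lip[of "x - z" x] heat_pos[OF s, of z] by (intro mult_mono) auto
    also have "\<dots> = L * sqrt s * ((norm z / sqrt s) ^ 1 * heat s z)" using s by simp
    also have "\<dots> \<le> L * sqrt s * (kernel_const TYPE('n) * heat (2 * s) z)"
      unfolding kernel_const_def using s L by (intro mult_left_mono heat_moment_bound) auto
    finally show "\<bar>heat s z * (g (x - z) - g x)\<bar> \<le> kernel_const TYPE('n) * sqrt s * L * heat (2 * s) z" by (simp add: ac_simps)
  qed
  also have "\<dots> = kernel_const TYPE('n) * sqrt s * L" using s by (simp add: integral_heat)
  finally show ?thesis .
qed

text \<open>Fubini reduces the claim to the convolution identity for Gaussians; integrability on the
  product space holds because the heat flow of |g| is bounded and continuous.\<close>

lemma conv_heat_semigroup: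
  fixes g :: "real^'n::finite \<Rightarrow> real"
  assumes s: "s > 0" and t: "t > 0" and g: "bcont g"
  shows "conv (heat s) (conv (heat t) g) x = conv (heat (s + t)) g x"
proof -
  from g obtain K where K: "continuous_on UNIV g" "\<And>x. \<bar>g x\<bar> \<le> K" by (rule bcontE) blast
  have gm[measurable]: "g \<in> borel_measurable borel" using continuous_lborel_measurable[OF K(1)] by simp
  let ?F = "\<lambda>(y, w). heat s (x - y) * (heat t (y - w) * g w)"
  have bcabs: "bcont (\<lambda>w. \<bar>g w\<bar>)" unfolding bcont_def using K by (auto intro!: continuous_intros exI[of _ K])
  have int: "integrable (lborel \<Otimes>\<^sub>M lborel) ?F"
  proof (rule lborel_pair.Fubini_integrable)
    show "?F \<in> borel_measurable (lborel \<Otimes>\<^sub>M lborel)" by measurable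
    have eq: "(\<lambda>y. \<integral>w. norm (?F (y, w)) \<partial>lborel) = (\<lambda>y. heat s (x - y) * conv (heat t) (\<lambda>w. \<bar>g w\<bar>) y)"
      by (simp add: conv_def abs_mult abs_of_pos[OF heat_pos[OF s]] abs_of_pos[OF heat_pos[OF t]])
    show "integrable lborel (\<lambda>y. \<integral>w. norm (?F (y, w)) \<partial>lborel)"
      unfolding eq by (rule conv_integrable'(2)[OF heat_integrable[OF s] bcont_conv[OF gaussian_kernel_heat t bcabs]])
    show "AE y in lborel. integrable lborel (\<lambda>w. ?F (y, w))"
      using conv_integrable'(2)[OF heat_integrable[OF t] g] by auto
  qed
  have "conv (heat s) (conv (heat t) g) x = (\<integral>y. \<integral>w. heat s (x - y) * (heat t (y - w) * g w) \<partial>lborel \<partial>lborel)"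
    unfolding conv_def by simp
  also have "\<dots> = (\<integral>w. \<integral>y. heat s (x - y) * (heat t (y - w) * g w) \<partial>lborel \<partial>lborel)"
    using lborel_pair.Fubini_integral[OF int] by simp
  also have "\<dots> = (\<integral>w. heat (s + t) (x - w) * g w \<partial>lborel)"
  proof (rule Bochner_Integration.integral_cong[OF refl])
    fix w
    have "(\<integral>y. heat s (x - y) * (heat t (y - w) * g w) \<partial>lborel) = (\<integral>y. heat s (x - y) * heat t (y - w) \<partial>lborel) * g w"
      by (simp add: mult.assoc[symmetric])
    also have "(\<integral>y. heat s (x - y) * heat t (y - w) \<partial>lborel) = (\<integral>y. heat s ((x - w) - y) * heat t y \<partial>lborel)"
      using lborel_integral_shift[of "\<lambda>y. heat s (x - y) * heat t (y - w)" w] by (simp add: algebra_simps)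
    also have "\<dots> = heat (s + t) (x - w)" by (rule integral_heat_convolution(2)[OF s t])
    finally show "(\<integral>y. heat s (x - y) * (heat t (y - w) * g w) \<partial>lborel) = heat (s + t) (x - w) * g w" .
  qed
  finally show ?thesis unfolding conv_def .
qed

text \<open>Both sides are the derivative in direction \<open>i\<close> of the same function, by
  \<open>conv_heat_semigroup\<close>. At large times this lets one unit of time pay for the
  derivative and the rest for decay.\<close>

lemma conv_heatD_semigroup:
  fixes g :: "real^'n::finite \<Rightarrow> real"
  assumes s: "s > 0" and t: "t > 0" and g: "bcont g"
  shows "conv (heatD i s) (conv (heat t) g) x = conv (heatD i (s + t)) g x"
proof -
  have "((\<lambda>h. conv (heat s) (conv (heat t) g) (x + h *\<^sub>R axis i 1)) has_real_derivative conv (heatD i s) (conv (heat t) g) (x + 0 *\<^sub>R axis i 1)) (at 0)"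
    by (rule conv_heat_deriv[OF s bcont_conv[OF gaussian_kernel_heat t g]])
  then have "((\<lambda>h. conv (heat (s + t)) g (x + h *\<^sub>R axis i 1)) has_real_derivative conv (heatD i s) (conv (heat t) g) (x + 0 *\<^sub>R axis i 1)) (at 0)"
    by (simp add: conv_heat_semigroup[OF s t g])
  moreover have "((\<lambda>h. conv (heat (s + t)) g (x + h *\<^sub>R axis i 1)) has_real_derivative conv (heatD i (s + t)) g (x + 0 *\<^sub>R axis i 1)) (at 0)"
    by (rule conv_heat_deriv[OF _ g]) (use s t in simp)
  ultimately have "conv (heatD i s) (conv (heat t) g) (x + 0 *\<^sub>R axis i 1) = conv (heatD i (s + t)) g (x + 0 *\<^sub>R axis i 1)" by (rule DERIV_unique)
  then show ?thesis by simp
qed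

lemma conv_heatDD_semigroup:
  fixes g :: "real^'n::finite \<Rightarrow> real"
  assumes s: "s > 0" and t: "t > 0" and g: "bcont g"
  shows "conv (heatDD i j s) (conv (heat t) g) x = conv (heatDD i j (s + t)) g x"
proof -
  have "((\<lambda>h. conv (heatD i s) (conv (heat t) g) (x + h *\<^sub>R axis j 1)) has_real_derivative conv (heatDD i j s) (conv (heat t) g) (x + 0 *\<^sub>R axis j 1)) (at 0)"
    by (rule conv_heatD_deriv[OF s bcont_conv[OF gaussian_kernel_heat t g]])
  then have "((\<lambda>h. conv (heatD i (s + t)) g (x + h *\<^sub>R axis j 1)) has_real_derivative conv (heatDD i j s) (conv (heat t) g) (x + 0 *\<^sub>R axis j 1)) (at 0)"
    by (simp add: conv_heatD_semigroup[OF s t g])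
  moreover have "((\<lambda>h. conv (heatD i (s + t)) g (x + h *\<^sub>R axis j 1)) has_real_derivative conv (heatDD i j (s + t)) g (x + 0 *\<^sub>R axis j 1)) (at 0)"
    by (rule conv_heatD_deriv[OF _ g]) (use s t in simp)
  ultimately have "conv (heatDD i j s) (conv (heat t) g) (x + 0 *\<^sub>R axis j 1) = conv (heatDD i j (s + t)) g (x + 0 *\<^sub>R axis j 1)" by (rule DERIV_unique)
  then show ?thesis by simp
qed

section \<open>Periodicity and Doeblin's contraction of oscillations\<close>

lemma per_space_conv:
  assumes "per_space g"
  shows "per_space (conv q g)"
  unfolding per_space_def conv_commute
proof (intro allI)
  fix x i
  have "g (x + axis i 1 - z) = g (x - z)" for z
    using assms unfolding per_space_def by (metis add_diff_eq add.commute)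
  then show "(\<integral>z. q z * g (x + axis i 1 - z) \<partial>lborel) = (\<integral>z. q z * g (x - z) \<partial>lborel)" by simp
qed

lemma per_space_int:
  assumes "per_space h"
  shows "h (x + of_int k *\<^sub>R axis i 1) = h x"
proof -
  have n: "h (x + of_nat n *\<^sub>R axis i 1) = h x" for n x
  proof (induction n)
    case (Suc n)
    have "x + of_nat (Suc n) *\<^sub>R axis i 1 = (x + of_nat n *\<^sub>R axis i 1) + axis i 1" by (simp add: algebra_simps)
    then show ?case using assms Suc unfolding per_space_def by metis
  qed simp
  show ?thesis
  proof (cases "k \<ge> 0")
    case True
    then show ?thesis using n[of x "nat k"] by simp
  next
    case False
    then show ?thesis using n[of "x + of_int k *\<^sub>R axis i 1" "nat (- k)"] by simp
  qed
qed

lemma per_space_int_vector: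
  assumes "per_space h"
  shows "h (x + (\<Sum>i\<in>I. of_int (k i) *\<^sub>R axis i 1)) = h x"
proof (induction I rule: infinite_finite_induct)
  case (insert i I)
  have "h (x + (\<Sum>i\<in>insert i I. of_int (k i) *\<^sub>R axis i 1)) = h ((x + (\<Sum>i\<in>I. of_int (k i) *\<^sub>R axis i 1)) + of_int (k i) *\<^sub>R axis i 1)"
    using insert by (simp add: algebra_simps)
  then show ?case using insert per_space_int[OF assms] by simp
qed auto

text \<open>Taking fractional parts in each coordinate is a choice of representative that does not
  depend on the function \<open>h\<close>.\<close>

lemma per_space_reduce:
  fixes x :: "real^'n::finite"
  obtains z where "z \<in> cbox 0 1" "\<And>h. per_space h \<Longrightarrow> h x = h z"
proof
  define z :: "real^'n" where "z = (\<chi> i. frac (x $ i))"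
  show "z \<in> cbox 0 1" 
    by (auto simp: mem_box_cart z_def frac_lt_1 less_imp_le)
  have "z + (\<Sum>i\<in>UNIV. of_int \<lfloor>x $ i\<rfloor> *\<^sub>R axis i 1) = x"
    by (simp add: vec_eq_iff z_def axis_def frac_def if_distrib cong: if_cong)
  then show "h x = h z" if "per_space h" for h
    using per_space_int_vector[OF that, of z "\<lambda>i. \<lfloor>x $ i\<rfloor>" UNIV] by simp
qed

lemma content_unit_cube: "measure lborel (cbox 0 (1::real^'n::finite)) = 1"
  by (subst content_cbox_cart) (auto simp: interval_ne_empty_cart)

text \<open>The value of \<open>heat 1\<close> at distance sqrt d, the diameter of the unit cube in
  dimension d = \<open>CARD('n)\<close>, hence its minimum over differences of two points of the
  cube.\<close>

definition doeblin_const :: "'n::finite itself \<Rightarrow> real" where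
  "doeblin_const _ = exp (- (real CARD('n) / 4)) / sqrt (4 * pi) ^ CARD('n)"

lemma doeblin_const_pos: "doeblin_const TYPE('n::finite) > 0"
  by (simp add: doeblin_const_def)

lemma doeblin_const_le_1: "doeblin_const TYPE('n::finite) \<le> 1"
proof -
  have "1 \<le> sqrt (4 * pi)" using pi_gt3 by simp
  then have "1 \<le> sqrt (4 * pi) ^ CARD('n)" by (rule one_le_power)
  moreover have "exp (- (real CARD('n) / 4)) \<le> 1" by simp
  ultimately have "exp (- (real CARD('n) / 4)) \<le> sqrt (4 * pi) ^ CARD('n)" by linarith
  then show ?thesis unfolding doeblin_const_def by (simp add: divide_le_eq)
qed

lemma heat_lower_bound:
  fixes x y :: "real^'n::finite"
  assumes "x \<in> cbox 0 1" "y \<in> cbox 0 1"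
  shows "doeblin_const TYPE('n) \<le> heat 1 (x - y)"
proof -
  have "(norm (x - y))\<^sup>2 = (\<Sum>i\<in>UNIV. ((x - y) $ i)\<^sup>2)"
    unfolding power2_norm_eq_inner inner_vec_def by (simp add: power2_eq_square)
  also have "\<dots> \<le> (\<Sum>i\<in>(UNIV::'n set). 1)"
  proof (rule sum_mono)
    fix i
    have "0 \<le> x $ i" "x $ i \<le> 1" "0 \<le> y $ i" "y $ i \<le> 1" using assms by (auto simp: mem_box_cart)
    then have "\<bar>(x - y) $ i\<bar> \<le> 1" by simp
    then show "((x - y) $ i)\<^sup>2 \<le> 1" by (simp add: abs_square_le_1)
  qed
  finally have "(norm (x - y))\<^sup>2 \<le> CARD('n)" by simp
  then show ?thesis unfolding doeblin_const_def heat_def by (simp add: divide_right_mono)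
qed

text \<open>From every point of the cube the kernel puts at least the density \<open>?c\<close> on
  the cube. With \<open>a\<close> and \<open>b\<close> the infimum and supremum of \<open>g\<close>
  and \<open>G\<close> its mean over the cube, the flow lies between \<open>a + ?c * (G - a)\<close>
  and \<open>b - ?c * (b - G)\<close>, an interval of length
  \<open>(1 - ?c) * (b - a)\<close>.\<close>

lemma doeblin:
  fixes g :: "real^'n::finite \<Rightarrow> real"
  assumes g: "bcont g" and per: "per_space g" and osc: "osc_le g d"
  shows "osc_le (conv (heat 1) g) ((1 - doeblin_const TYPE('n)) * d)"
proof -
  let ?c = "doeblin_const TYPE('n)"
  let ?Q = "cbox 0 (1::real^'n)"
  from g obtain K where K: "continuous_on UNIV g" "\<And>x. \<bar>g x\<bar> \<le> K" by (rule bcontE) blast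
  have gm[measurable]: "g \<in> borel_measurable borel" using continuous_lborel_measurable[OF K(1)] by simp
  define a b where "a = Inf (range g)" and "b = Sup (range g)"
  have "bdd_below (range g)" "bdd_above (range g)"
    using K(2) by (auto simp: abs_le_iff intro!: bdd_belowI2[of _ "-K"] bdd_aboveI2[of _ _ K]) (metis minus_le_iff)
  then have ab: "a \<le> g y" "g y \<le> b" for y
    unfolding a_def b_def by (auto intro: cINF_lower cSUP_upper)
  have "g x - d \<le> a" for x
    unfolding a_def using osc by (intro cINF_greatest) (auto simp: osc_le_def abs_le_iff algebra_simps)
  then have "b \<le> a + d" unfolding b_def by (intro cSUP_least) (auto simp: algebra_simps)
  then have bad: "b - a \<le> d" by simp
  \<comment> \<open>Nonnegativity of \<open>u\<close> allows the part of the integral outside the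
    cube to be discarded.\<close>
  have lower: "?c * (\<integral>y. indicator ?Q y * u y \<partial>lborel) \<le> conv (heat 1) u x"
    if u: "bcont u" "\<And>y. u y \<ge> 0" and x: "x \<in> ?Q" for u x
  proof -
    from u(1) obtain M where M: "continuous_on UNIV u" "\<And>x. \<bar>u x\<bar> \<le> M" by (rule bcontE) blast
    have "?c * (\<integral>y. indicator ?Q y * u y \<partial>lborel) = (\<integral>y. ?c * (indicator ?Q y * u y) \<partial>lborel)" by simp
    also have "\<dots> \<le> (\<integral>y. heat 1 (x - y) * u y \<partial>lborel)"
    proof (rule Bochner_Integration.integral_mono)
      have "integrable lborel (indicator ?Q :: _ \<Rightarrow> real)"
        by (intro integrable_real_indicator emeasure_lborel_cbox_finite) auto
      from integrable_mult_bounded[OF this continuous_lborel_measurable[OF M(1)] M(2)]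
      show "integrable lborel (\<lambda>y. ?c * (indicator ?Q y * u y))" by simp
      show "integrable lborel (\<lambda>y. heat 1 (x - y) * u y)" by (rule conv_integrable'(2)[OF heat_integrable u(1)]) simp
      fix y
      show "?c * (indicator ?Q y * u y) \<le> heat 1 (x - y) * u y"
        using heat_lower_bound[OF x, of y] u(2)[of y] heat_pos[of 1 "x - y"]
        by (cases "y \<in> ?Q") (auto intro: mult_right_mono)
    qed
    finally show ?thesis by (simp add: conv_def)
  qed
  define G where "G = (\<integral>y. indicator ?Q y * g y \<partial>lborel)"
  have iQ: "integrable lborel (indicator ?Q :: _ \<Rightarrow> real)"
    by (intro integrable_real_indicator emeasure_lborel_cbox_finite) auto
  have igQ: "integrable lborel (\<lambda>y. indicator ?Q y * g y)"
    by (rule integrable_mult_bounded[OF iQ continuous_lborel_measurable[OF K(1)] K(2)])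
  have m1: "(\<integral>y. indicator ?Q y \<partial>lborel) = (1::real)"
    by (simp add: content_unit_cube)
  have I1: "(\<integral>y. indicator ?Q y * (g y - a) \<partial>lborel) = G - a"
    unfolding G_def using igQ iQ m1 by (simp add: right_diff_distrib)
  have I2: "(\<integral>y. indicator ?Q y * (b - g y) \<partial>lborel) = b - G"
    unfolding G_def using igQ iQ m1 by (simp add: right_diff_distrib)
  have h1: "0 < (1::real)" by simp
  have cube: "\<bar>conv (heat 1) g x - conv (heat 1) g y\<bar> \<le> (1 - ?c) * d" if xy: "x \<in> ?Q" "y \<in> ?Q" for x y
  proof -
    have l: "?c * (G - a) \<le> conv (heat 1) g x - a" if "x \<in> ?Q" for x
      using lower[OF bcont_diff[OF g bcont_const[of a]] _ that] ab(1) I1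
        conv_diff[OF heat_integrable[OF h1] g bcont_const[of a], of x] conv_heat_const[OF h1, of a x] by simp
    have u: "?c * (b - G) \<le> b - conv (heat 1) g x" if "x \<in> ?Q" for x
      using lower[OF bcont_diff[OF bcont_const[of b] g] _ that] ab(2) I2
        conv_diff[OF heat_integrable[OF h1] bcont_const[of b] g, of x] conv_heat_const[OF h1, of b x] by simp
    have "\<bar>conv (heat 1) g x - conv (heat 1) g y\<bar> \<le> (b - a) - ?c * (b - a)"
      using l[OF xy(1)] l[OF xy(2)] u[OF xy(1)] u[OF xy(2)] by (simp add: abs_le_iff right_diff_distrib)
    also have "\<dots> = (1 - ?c) * (b - a)" by (simp add: left_diff_distrib)
    also have "\<dots> \<le> (1 - ?c) * d" using bad doeblin_const_le_1[where 'n='n] by (intro mult_left_mono) auto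
    finally show ?thesis .
  qed
  show ?thesis
    unfolding osc_le_def
  proof (intro allI)
    fix x y
    \<comment> \<open>The flow is periodic, so both points may be moved into the cube.\<close>
    obtain x' where x': "x' \<in> ?Q" "\<And>h. per_space h \<Longrightarrow> h x = h x'" using per_space_reduce[of x] by blast
    obtain y' where y': "y' \<in> ?Q" "\<And>h. per_space h \<Longrightarrow> h y = h y'" using per_space_reduce[of y] by blast
    show "\<bar>conv (heat 1) g x - conv (heat 1) g y\<bar> \<le> (1 - ?c) * d"
      using cube[OF x'(1) y'(1)] x'(2)[OF per_space_conv[OF per]] y'(2)[OF per_space_conv[OF per]] by simp
  qed
qed

lemma osc_le_conv_heat:
  fixes g :: "real^'n::finite \<Rightarrow> real"
  assumes s: "s > 0" and g: "bcont g" and osc: "osc_le g d"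
  shows "osc_le (conv (heat s) g) d"
  unfolding osc_le_def
proof (intro allI)
  fix x y
  note I = heat_integrable[OF s, where 'n='n]
  have i: "integrable lborel (\<lambda>z. heat s z * (g (x - z) - g (y - z)))"
    using Bochner_Integration.integrable_diff[OF conv_integrable'(1)[OF I g, of x] conv_integrable'(1)[OF I g, of y]]
    by (simp add: right_diff_distrib)
  have "conv (heat s) g x - conv (heat s) g y = (\<integral>z. heat s z * (g (x - z) - g (y - z)) \<partial>lborel)"
    unfolding conv_commute using conv_integrable'(1)[OF I g, of x] conv_integrable'(1)[OF I g, of y]
    by (simp add: right_diff_distrib)
  also have "\<bar>\<dots>\<bar> \<le> (\<integral>z. \<bar>heat s z * (g (x - z) - g (y - z))\<bar> \<partial>lborel)"
    by (rule integral_abs_bound)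
  also have "\<dots> \<le> (\<integral>z. d * heat s (z::real^'n) \<partial>lborel)"
  proof (rule Bochner_Integration.integral_mono)
    show "integrable lborel (\<lambda>z. \<bar>heat s z * (g (x - z) - g (y - z))\<bar>)" using i by (rule integrable_abs)
    show "integrable lborel (\<lambda>z. d * heat s (z::real^'n))" using I by simp
    fix z :: "real^'n"
    show "\<bar>heat s z * (g (x - z) - g (y - z))\<bar> \<le> d * heat s z"
      using osc heat_pos[OF s, of z] unfolding osc_le_def by (simp add: abs_mult mult.commute mult_right_mono)
  qed
  also have "\<dots> = d" using s by (simp add: integral_heat)
  finally show "\<bar>conv (heat s) g x - conv (heat s) g y\<bar> \<le> d" .
qed

text \<open>One application of \<open>doeblin\<close> per unit of time. The remainder
  \<open>s\<close> stays positive because \<open>heat 0\<close> is the zero function and not a unit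
  for convolution.\<close>

lemma osc_decay_nat:
  fixes g :: "real^'n::finite \<Rightarrow> real"
  assumes s: "s > 0" and g: "bcont g" "per_space g" "osc_le g d"
  shows "osc_le (conv (heat (real n + s)) g) ((1 - doeblin_const TYPE('n)) ^ n * d)"
proof (induction n)
  case 0
  then show ?case using osc_le_conv_heat[OF s g(1,3)] by simp
next
  case (Suc n)
  have pos: "real n + s > 0" using s by simp
  have "conv (heat 1) (conv (heat (real n + s)) g) = conv (heat (real (Suc n) + s)) g"
    using conv_heat_semigroup[OF _ pos g(1), of 1] by (auto simp: algebra_simps)
  with doeblin[OF bcont_conv[OF gaussian_kernel_heat pos g(1)] per_space_conv[OF g(2)] Suc]
  show ?case by (simp add: mult.assoc)
qed

text \<open>The inequality \<open>1 - ?c \<le> exp (- ?c)\<close> turns geometric decay into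
  exponential decay; the 3 is an upper bound for \<open>exp 1\<close>, the loss from rounding the
  time down.\<close>

lemma osc_decay:
  fixes g :: "real^'n::finite \<Rightarrow> real"
  assumes s: "s > 0" and g: "bcont g" "per_space g" "osc_le g d"
  shows "osc_le (conv (heat s) g) (3 * exp (- doeblin_const TYPE('n) * s) * d)"
proof -
  let ?c = "doeblin_const TYPE('n)"
  \<comment> \<open>This rounding leaves a remainder in (0, 1], positive also when \<open>s\<close>
    is an integer.\<close>
  define n where "n = nat (\<lceil>s\<rceil> - 1)"
  have n: "real n < s" "s \<le> real n + 1" using s unfolding n_def by linarith+
  have d: "d \<ge> 0" using g(3) by (auto simp: osc_le_def intro: order_trans[OF abs_ge_zero])
  have "(1 - ?c) ^ n \<le> exp (- ?c) ^ n"
    using exp_ge_add_one_self[of "- ?c"] doeblin_const_le_1[where 'n='n] by (intro power_mono) auto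
  also have "\<dots> = exp (- ?c * n)" by (simp add: exp_of_nat_mult[symmetric] mult.commute)
  also have "\<dots> \<le> exp (1 + - ?c * s)"
  proof -
    have "?c * (s - n) \<le> 1 * 1" using n doeblin_const_pos[where 'n='n] doeblin_const_le_1[where 'n='n] by (intro mult_mono) auto
    then show ?thesis by (simp add: algebra_simps)
  qed
  also have "\<dots> = exp 1 * exp (- ?c * s)" by (rule exp_add)
  also have "\<dots> \<le> 3 * exp (- ?c * s)" using exp_le by (intro mult_right_mono) auto
  finally have "(1 - ?c) ^ n * d \<le> 3 * exp (- ?c * s) * d" using d by (intro mult_right_mono)
  moreover have "osc_le (conv (heat (real n + (s - real n))) g) ((1 - ?c) ^ n * d)"
    using n by (intro osc_decay_nat g) auto
  ultimately show ?thesis unfolding osc_le_def by (auto intro: order_trans)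
qed

section \<open>A common integrable majorant in time\<close>

text \<open>Behaves like s^(-1/2) at 0 and like s^(-3/2) at infinity, so one formula covers the
  singularity of the kernels and their decay. It is the derivative of
  \<open>2 * arctan (sqrt s)\<close>, which makes its integrability explicit.\<close>

definition weight :: "real \<Rightarrow> real" where
  "weight s = 1 / (sqrt s * (1 + s))"

lemma weight_pos: "s > 0 \<Longrightarrow> weight s > 0"
  by (simp add: weight_def)

lemma weight_small: "0 < s \<Longrightarrow> s \<le> 1 \<Longrightarrow> 1 / sqrt s \<le> 2 * weight s"
  using mult_left_mono[of 1 "2 / (1 + s)" "1 / sqrt s"] by (simp add: weight_def)

lemma weight_exp:
  assumes c: "0 < c" "c \<le> 1" and s: "s > 0"
  shows "exp (- c * s) \<le> 4 / c\<^sup>2 * weight s"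
proof (cases "s \<le> 1")
  case True
  have "c\<^sup>2 \<le> 1" using c by (simp add: power_le_one)
  then have c2: "2 \<le> 4 / c\<^sup>2" using c by (simp add: field_simps)
  have "exp (- c * s) \<le> 1" using c s by simp
  also have "1 \<le> 1 / sqrt s" using True s by simp
  also have "\<dots> \<le> 2 * weight s" by (rule weight_small[OF s True])
  also have "\<dots> \<le> 4 / c\<^sup>2 * weight s" using c2 weight_pos[OF s] by (intro mult_right_mono) auto
  finally show ?thesis .
next
  case False
  then have s1: "s > 1" by simp
  have "(c * s)\<^sup>2 / 2 \<le> exp (c * s)"
  proof -
    have "0 \<le> c * s" using c s by simp
    with exp_lower_Taylor_quadratic[OF this] show ?thesis by linarith
  qed
  \<comment> \<open>For \<open>s > 1\<close> the denominator of \<open>weight s\<close> is at most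
    \<open>2 * s\<^sup>2\<close>, which the quadratic term of the exponential absorbs.\<close>
  moreover have "sqrt s * (1 + s) \<le> s * (2 * s)"
  proof (rule mult_mono)
    show "sqrt s \<le> s" using s1 by (intro real_le_lsqrt) (auto simp: power2_eq_square)
  qed (use s1 in auto)
  ultimately have "c\<^sup>2 * (sqrt s * (1 + s)) \<le> 4 * exp (c * s)"
    using mult_left_mono[of "sqrt s * (1 + s)" "s * (2 * s)" "c\<^sup>2"] by (simp add: power2_eq_square algebra_simps)
  moreover have "1 / e \<le> 4 / p" if "0 < p" "0 < e" "p \<le> 4 * e" for e p :: real
    using that by (simp add: field_simps)
  ultimately have "1 / exp (c * s) \<le> 4 / (c\<^sup>2 * (sqrt s * (1 + s)))" using c s by simp
  then show ?thesis by (simp add: weight_def exp_minus inverse_eq_divide)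
qed

text \<open>The 36 is 4 times 3 times 3: the 4 of \<open>weight_exp\<close>, the 3 of
  \<open>osc_decay\<close>, and another 3 for the unit of time spent on smoothing.\<close>

definition decay_const :: "'n::finite itself \<Rightarrow> real" where
  "decay_const _ = 36 * kernel_const TYPE('n) / (doeblin_const TYPE('n))\<^sup>2"

lemma decay_const_pos: "decay_const TYPE('n::finite) > 0"
  unfolding decay_const_def using kernel_const_pos[where 'n='n] doeblin_const_pos[where 'n='n] by simp

lemma decay_const_ge: "2 * kernel_const TYPE('n::finite) \<le> decay_const TYPE('n)" "12 / (doeblin_const TYPE('n))\<^sup>2 \<le> decay_const TYPE('n)"
proof -
  have "(doeblin_const TYPE('n))\<^sup>2 \<le> 1" using doeblin_const_pos[where 'n='n] doeblin_const_le_1[where 'n='n] by (simp add: power_le_one)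
  moreover have "(doeblin_const TYPE('n))\<^sup>2 > 0" using doeblin_const_pos[where 'n='n] by simp
  moreover have "kernel_const TYPE('n) \<ge> 1"
  proof -
    have "(1::real) \<le> sqrt 2 ^ CARD('n)" by (rule one_le_power) simp
    then show ?thesis unfolding kernel_const_def by linarith
  qed
  ultimately show "2 * kernel_const TYPE('n::finite) \<le> decay_const TYPE('n)" "12 / (doeblin_const TYPE('n))\<^sup>2 \<le> decay_const TYPE('n)"
    unfolding decay_const_def by (auto simp: field_simps)
qed

lemma osc_decay_weight:
  fixes g :: "real^'n::finite \<Rightarrow> real"
  assumes s: "s > 0" and g: "bcont g" "per_space g" "osc_le g d"
  shows "osc_le (conv (heat s) g) (decay_const TYPE('n) * weight s * d)"
proof -
  have d: "d \<ge> 0" using g(3) by (auto simp: osc_le_def intro: order_trans[OF abs_ge_zero])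
  have "3 * exp (- doeblin_const TYPE('n) * s) \<le> 3 * (4 / (doeblin_const TYPE('n))\<^sup>2 * weight s)"
    by (intro mult_left_mono weight_exp doeblin_const_pos doeblin_const_le_1 s) auto
  also have "\<dots> = 12 / (doeblin_const TYPE('n))\<^sup>2 * weight s" by simp
  also have "\<dots> \<le> decay_const TYPE('n) * weight s" using weight_pos[OF s] decay_const_ge by (intro mult_right_mono) auto
  finally have "3 * exp (- doeblin_const TYPE('n) * s) * d \<le> decay_const TYPE('n) * weight s * d" using d by (rule mult_right_mono)
  with osc_decay[OF s g] show ?thesis unfolding osc_le_def by (auto intro: order_trans)
qed

lemma large_time_weight:
  fixes d :: real
  assumes "s > 1" "d \<ge> 0"
  shows "kernel_const TYPE('n::finite) * (3 * exp (- doeblin_const TYPE('n) * (s - 1)) * d) \<le> decay_const TYPE('n) * weight s * d"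
proof -
  have "exp (- doeblin_const TYPE('n) * (s - 1)) = exp (doeblin_const TYPE('n)) * exp (- doeblin_const TYPE('n) * s)"
    by (simp add: exp_add[symmetric] algebra_simps)
  also have "\<dots> \<le> 3 * (4 / (doeblin_const TYPE('n))\<^sup>2 * weight s)"
  proof (intro mult_mono weight_exp doeblin_const_pos doeblin_const_le_1)
    have "exp (doeblin_const TYPE('n)) \<le> exp 1" using doeblin_const_le_1[where 'n='n] by simp
    then show "exp (doeblin_const TYPE('n)) \<le> 3" using exp_le by linarith
  qed (use assms in auto)
  finally have "kernel_const TYPE('n) * (3 * exp (- doeblin_const TYPE('n) * (s - 1)) * d) \<le> kernel_const TYPE('n) * (3 * (3 * (4 / (doeblin_const TYPE('n))\<^sup>2 * weight s)) * d)"
    using assms kernel_const_pos[where 'n='n] by (intro mult_left_mono mult_right_mono) auto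
  then show ?thesis by (simp add: decay_const_def ac_simps)
qed

text \<open>Up to time 1 the kernel bound is enough. Afterwards one unit of time is spent on the
  derivative, at a fixed cost, and the remaining \<open>s - 1\<close> on the decay of the
  oscillation.\<close>

lemma conv_heatD_decay:
  fixes g :: "real^'n::finite \<Rightarrow> real"
  assumes s: "s > 0" and g: "bcont g" "per_space g" "osc_le g d"
  shows "\<bar>conv (heatD i s) g x\<bar> \<le> decay_const TYPE('n) * weight s * d"
proof (cases "s \<le> 1")
  case True
  have d: "d \<ge> 0" using g(3) by (auto simp: osc_le_def intro: order_trans[OF abs_ge_zero])
  have "\<bar>conv (heatD i s) g x\<bar> \<le> kernel_const TYPE('n) / sqrt s * d"
    by (rule conv_osc_bound[OF gaussian_kernel_heatD s integral_heatD[OF s] g(1,3)])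
  also have "\<dots> \<le> decay_const TYPE('n) * weight s * d"
  proof (rule mult_right_mono[OF _ d])
    have "kernel_const TYPE('n) / sqrt s \<le> kernel_const TYPE('n) * (2 * weight s)"
      using mult_left_mono[OF weight_small[OF s True], of "kernel_const TYPE('n)"] kernel_const_pos[where 'n='n] by simp
    also have "\<dots> \<le> decay_const TYPE('n) * weight s"
      using mult_right_mono[OF decay_const_ge(1)[where 'n='n], of "weight s"] weight_pos[OF s] by simp
    finally show "kernel_const TYPE('n) / sqrt s \<le> decay_const TYPE('n) * weight s" .
  qed
  finally show ?thesis .
next
  case False
  then have s1: "s - 1 > 0" "s > 1" by auto
  have d: "d \<ge> 0" using g(3) by (auto simp: osc_le_def intro: order_trans[OF abs_ge_zero])
  have "conv (heatD i s) g x = conv (heatD i 1) (conv (heat (s - 1)) g) x"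
    using conv_heatD_semigroup[OF _ s1(1) g(1), of 1 i x] by simp
  also have "\<bar>\<dots>\<bar> \<le> kernel_const TYPE('n) / sqrt 1 * (3 * exp (- doeblin_const TYPE('n) * (s - 1)) * d)"
    by (rule conv_osc_bound[OF gaussian_kernel_heatD _ integral_heatD bcont_conv[OF gaussian_kernel_heat s1(1) g(1)] osc_decay[OF s1(1) g]]) auto
  also have "\<dots> \<le> decay_const TYPE('n) * weight s * d" using large_time_weight[OF s1(2) d, where 'n='n] by simp
  finally show ?thesis .
qed

text \<open>As for one derivative, except that at small times the singularity 1/s has to be weakened
  by the Lipschitz bound: \<open>L\<close> accounts for small times and \<open>d\<close> for large
  ones.\<close>

lemma conv_heatDD_decay:
  fixes g :: "real^'n::finite \<Rightarrow> real"
  assumes s: "s > 0" and g: "bcont g" "per_space g" "osc_le g d"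
    and lip: "\<And>x y. \<bar>g x - g y\<bar> \<le> L * norm (x - y)" and L: "L \<ge> 0"
  shows "\<bar>conv (heatDD i j s) g x\<bar> \<le> decay_const TYPE('n) * weight s * (L + d)"
proof (cases "s \<le> 1")
  case True
  have d: "d \<ge> 0" using g(3) by (auto simp: osc_le_def intro: order_trans[OF abs_ge_zero])
  have "\<bar>conv (heatDD i j s) g x\<bar> \<le> kernel_const TYPE('n) / sqrt s * L"
    by (rule conv_heatDD_lipschitz_bound[OF s g(1) lip L])
  also have "\<dots> \<le> decay_const TYPE('n) * weight s * L"
  proof (rule mult_right_mono[OF _ L])
    have "kernel_const TYPE('n) / sqrt s \<le> kernel_const TYPE('n) * (2 * weight s)"
      using mult_left_mono[OF weight_small[OF s True], of "kernel_const TYPE('n)"] kernel_const_pos[where 'n='n] by simp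
    also have "\<dots> \<le> decay_const TYPE('n) * weight s"
      using mult_right_mono[OF decay_const_ge(1)[where 'n='n], of "weight s"] weight_pos[OF s] by simp
    finally show "kernel_const TYPE('n) / sqrt s \<le> decay_const TYPE('n) * weight s" .
  qed
  also have "\<dots> \<le> decay_const TYPE('n) * weight s * (L + d)"
    using d decay_const_pos[where 'n='n] weight_pos[OF s] by (intro mult_left_mono) auto
  finally show ?thesis .
next
  case False
  then have s1: "s - 1 > 0" "s > 1" by auto
  have d: "d \<ge> 0" using g(3) by (auto simp: osc_le_def intro: order_trans[OF abs_ge_zero])
  have "conv (heatDD i j s) g x = conv (heatDD i j 1) (conv (heat (s - 1)) g) x"
    using conv_heatDD_semigroup[OF _ s1(1) g(1), of 1 i j x] by simp
  also have "\<bar>\<dots>\<bar> \<le> kernel_const TYPE('n) / 1 * (3 * exp (- doeblin_const TYPE('n) * (s - 1)) * d)"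
    by (rule conv_osc_bound[OF gaussian_kernel_heatDD _ integral_heatDD bcont_conv[OF gaussian_kernel_heat s1(1) g(1)] osc_decay[OF s1(1) g]]) auto
  also have "\<dots> \<le> decay_const TYPE('n) * weight s * d" using large_time_weight[OF s1(2) d, where 'n='n] by simp
  also have "\<dots> \<le> decay_const TYPE('n) * weight s * (L + d)"
    using L decay_const_pos[where 'n='n] weight_pos[OF s] by (intro mult_left_mono) auto
  finally show ?thesis .
qed

section \<open>Torus means and potentials\<close>

text \<open>The shifted cube sticks out of the unit cube by a slab of thickness \<open>a\<close>.
  Cutting at coordinate 1 and moving the slab back by one period reassembles the unit cube.\<close>

lemma torus_int_shift_axis_unit:
  fixes g :: "real^'n::finite \<Rightarrow> real"
  assumes g: "continuous_on UNIV g" "per_space g" and a: "0 \<le> a" "a \<le> 1"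
  shows "torus_int (\<lambda>x. g (x + a *\<^sub>R axis i 1)) = torus_int g"
proof -
  let ?e = "axis i 1 :: real^'n" and ?v = "a *\<^sub>R axis i 1 :: real^'n"
  have int: "g integrable_on cbox c d" for c d
    by (rule integrable_continuous[OF continuous_on_subset[OF g(1)]]) auto
  have e: "?e \<in> Basis" by simp
  have cb: "cbox p q = {x. p $ i \<le> x $ i \<and> x $ i \<le> q $ i \<and> (\<forall>j. j \<noteq> i \<longrightarrow> p $ j \<le> x $ j \<and> x $ j \<le> q $ j)}" for p q :: "real^'n"
    unfolding set_eq_iff mem_box_cart by auto
  have in_e: "x \<bullet> ?e = x $ i" for x by (simp add: inner_axis)
  have "torus_int (\<lambda>x. g (x + ?v)) = integral (cbox ?v (1 + ?v)) g"
    using integral_shift_cbox[of ?v ?v "1 + ?v" g] by (simp add: torus_int_def)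
  also have "\<dots> = integral (cbox ?v (1 + ?v) \<inter> {x. x \<bullet> ?e \<le> 1}) g + integral (cbox ?v (1 + ?v) \<inter> {x. x \<bullet> ?e \<ge> 1}) g"
    by (rule integral_split[OF int e])
  also have "cbox ?v (1 + ?v) \<inter> {x. x \<bullet> ?e \<le> 1} = cbox ?v 1"
    unfolding in_e cb using a by (auto simp: axis_def)
  also have "cbox ?v (1 + ?v) \<inter> {x. x \<bullet> ?e \<ge> 1} = cbox ?e (1 + ?v)"
    unfolding in_e cb using a by (auto simp: axis_def)
  also have "integral (cbox ?e (1 + ?v)) g = integral (cbox 0 (1 + ?v - ?e)) g"
  proof -
    have "g (x + ?e) = g x" for x using g(2) by (simp add: per_space_def)
    then show ?thesis using integral_shift_cbox[of ?e ?e "1 + ?v" g] by simp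
  qed
  also have "cbox 0 (1 + ?v - ?e) = cbox 0 1 \<inter> {x. x \<bullet> ?e \<le> a}"
    unfolding in_e cb using a by (auto simp: axis_def)
  also have "cbox ?v 1 = cbox 0 1 \<inter> {x. x \<bullet> ?e \<ge> a}"
    unfolding in_e cb using a by (auto simp: axis_def)
  also have "integral (cbox 0 1 \<inter> {x. x \<bullet> ?e \<ge> a}) g + integral (cbox 0 1 \<inter> {x. x \<bullet> ?e \<le> a}) g = torus_int g"
    using integral_split[OF int e, of 0 1 a] by (simp add: torus_int_def)
  finally show ?thesis .
qed

lemma torus_int_shift_axis:
  fixes g :: "real^'n::finite \<Rightarrow> real"
  assumes g: "continuous_on UNIV g" "per_space g"
  shows "torus_int (\<lambda>x. g (x + a *\<^sub>R axis i 1)) = torus_int g"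
proof -
  have "g (x + a *\<^sub>R axis i 1) = g (x + frac a *\<^sub>R axis i 1)" for x
    using per_space_int[OF g(2), of "x + frac a *\<^sub>R axis i 1" "\<lfloor>a\<rfloor>" i]
    by (simp add: frac_def algebra_simps)
  then show ?thesis
    using torus_int_shift_axis_unit[OF g, of "frac a" i] by (simp add: frac_lt_1 less_imp_le)
qed

text \<open>A general shift is performed one coordinate at a time, by induction on the set of
  coordinates moved so far.\<close>

lemma torus_int_shift:
  fixes g :: "real^'n::finite \<Rightarrow> real"
  assumes g: "continuous_on UNIV g" "per_space g"
  shows "torus_int (\<lambda>x. g (x + z)) = torus_int g"
proof -
  have "torus_int (\<lambda>x. g (x + (\<Sum>i\<in>I. z $ i *\<^sub>R axis i 1))) = torus_int g" if "finite I" for I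
    using that
  proof (induction I)
    case (insert i I)
    let ?h = "\<lambda>x. g (x + (\<Sum>i\<in>I. z $ i *\<^sub>R axis i 1))"
    have "continuous_on UNIV ?h"
      by (rule continuous_on_compose2[OF g(1)]) (auto intro!: continuous_intros)
    moreover have "per_space ?h"
      unfolding per_space_def
    proof (intro allI)
      fix x and j :: 'n
      show "?h (x + axis j 1) = ?h x"
      proof -
        have "x + axis j 1 + (\<Sum>i\<in>I. z $ i *\<^sub>R axis i 1) = (x + (\<Sum>i\<in>I. z $ i *\<^sub>R axis i 1)) + axis j 1"
          by (simp add: ac_simps)
        then show ?thesis using g(2) unfolding per_space_def by metis
      qed
    qed
    ultimately have "torus_int (\<lambda>x. ?h (x + z $ i *\<^sub>R axis i 1)) = torus_int ?h" by (rule torus_int_shift_axis)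
    then show ?case using insert by (simp add: algebra_simps)
  qed simp
  from this[of UNIV] show ?thesis
    by (simp add: basis_expansion scalar_mult_eq_scaleR[symmetric])
qed

lemma set_integrable_cube:
  fixes g :: "real^'n::finite \<Rightarrow> real"
  assumes "continuous_on UNIV g"
  shows "integrable lborel (\<lambda>x. indicator (cbox 0 1) x * g x)"
  using borel_integrable_compact[of "cbox 0 1" g] continuous_on_subset[OF assms] by auto

lemma torus_int_lborel:
  fixes g :: "real^'n::finite \<Rightarrow> real"
  assumes "continuous_on UNIV g"
  shows "torus_int g = (\<integral>x. indicator (cbox 0 1) x * g x \<partial>lborel)"
  using set_borel_integral_eq_integral(2)[of "cbox 0 1" g] set_integrable_cube[OF assms]
  by (simp add: torus_int_def set_integrable_def set_lebesgue_integral_def)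

lemma torus_int_const: "torus_int (\<lambda>_::real^'n::finite. c) = c"
  by (simp add: torus_int_def content_unit_cube)

lemma torus_int_bounds:
  fixes g :: "real^'n::finite \<Rightarrow> real"
  assumes g: "continuous_on UNIV g" and b: "\<And>x. a \<le> g x" "\<And>x. g x \<le> b"
  shows "a \<le> torus_int g" "torus_int g \<le> b"
proof -
  have int: "g integrable_on cbox 0 1" "(\<lambda>x. c) integrable_on cbox 0 (1::real^'n)" for c :: real
    by (auto intro!: integrable_continuous continuous_on_subset[OF g])
  have "torus_int (\<lambda>_::real^'n. a) \<le> torus_int g" "torus_int g \<le> torus_int (\<lambda>_::real^'n. b)"
    unfolding torus_int_def by (intro integral_le int b)+
  then show "a \<le> torus_int g" "torus_int g \<le> b" by (simp_all add: torus_int_const)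
qed

lemma torus_int_osc:
  fixes g :: "real^'n::finite \<Rightarrow> real"
  assumes g: "continuous_on UNIV g" "osc_le g d"
  shows "\<bar>g x - torus_int g\<bar> \<le> d"
proof -
  have "\<bar>g x - g y\<bar> \<le> d" for y using g(2) by (simp add: osc_le_def)
  then have "g x - d \<le> g y" "g y \<le> g x + d" for y by (auto simp: abs_le_iff algebra_simps)
  from torus_int_bounds[OF g(1) this] show ?thesis by auto
qed

text \<open>After exchanging the integrals, every translate of \<open>g\<close> has the same torus
  integral and the kernel has mass 1.\<close>

lemma torus_int_conv_heat:
  fixes g :: "real^'n::finite \<Rightarrow> real"
  assumes s: "s > 0" and g: "bcont g" "per_space g"
  shows "torus_int (conv (heat s) g) = torus_int g"
proof -
  from g(1) obtain K where K: "continuous_on UNIV g" "\<And>x. \<bar>g x\<bar> \<le> K" by (rule bcontE) blast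
  have gm[measurable]: "g \<in> borel_measurable borel" using continuous_lborel_measurable[OF K(1)] by simp
  have cc: "continuous_on UNIV (conv (heat s) g)" using bcont_conv[OF gaussian_kernel_heat s g(1)] by (simp add: bcont_def)
  let ?Q = "cbox 0 (1::real^'n)"
  let ?F = "\<lambda>(x::real^'n, z). indicator ?Q x * (heat s z * g (x - z))"
  have iQ: "integrable lborel (indicator ?Q :: _ \<Rightarrow> real)"
    by (intro integrable_real_indicator emeasure_lborel_cbox_finite) auto
  have bcabs: "bcont (\<lambda>w. \<bar>g w\<bar>)" unfolding bcont_def using K by (auto intro!: continuous_intros exI[of _ K])
  have int: "integrable (lborel \<Otimes>\<^sub>M lborel) ?F"
  proof (rule lborel_pair.Fubini_integrable)
    have [measurable]: "?Q \<in> sets borel" by simp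
    show "?F \<in> borel_measurable (lborel \<Otimes>\<^sub>M lborel)" by measurable
    have eq: "(\<lambda>x. \<integral>z. norm (?F (x, z)) \<partial>lborel) = (\<lambda>x. indicator ?Q x * conv (heat s) (\<lambda>w. \<bar>g w\<bar>) x)"
      by (simp add: conv_commute abs_mult abs_of_pos[OF heat_pos[OF s]])
    have "continuous_on UNIV (conv (heat s) (\<lambda>w. \<bar>g w\<bar>))" using bcont_conv[OF gaussian_kernel_heat s bcabs] by (simp add: bcont_def)
    from set_integrable_cube[OF this]
    show "integrable lborel (\<lambda>x. \<integral>z. norm (?F (x, z)) \<partial>lborel)" unfolding eq .
    show "AE x in lborel. integrable lborel (\<lambda>z. ?F (x, z))"
      using conv_integrable'(1)[OF heat_integrable[OF s] g(1)] by auto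
  qed
  have sh: "continuous_on UNIV (\<lambda>x. g (x - z))" for z
    by (rule continuous_on_compose2[OF K(1)]) (auto intro!: continuous_intros)
  have "torus_int (conv (heat s) g) = (\<integral>x. \<integral>z. indicator ?Q x * (heat s z * g (x - z)) \<partial>lborel \<partial>lborel)"
    by (simp add: torus_int_lborel[OF cc] conv_commute)
  also have "\<dots> = (\<integral>z. \<integral>x. indicator ?Q x * (heat s z * g (x - z)) \<partial>lborel \<partial>lborel)"
    using lborel_pair.Fubini_integral[OF int] by simp
  also have "\<dots> = (\<integral>z. heat s (z::real^'n) * torus_int g \<partial>lborel)"
  proof (rule Bochner_Integration.integral_cong[OF refl])
    fix z :: "real^'n"
    have "(\<integral>x. indicator ?Q x * (heat s z * g (x - z)) \<partial>lborel) = (\<integral>x. heat s z * (indicator ?Q x * g (x - z)) \<partial>lborel)"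
      by (simp add: ac_simps)
    also have "\<dots> = heat s z * torus_int (\<lambda>x. g (x - z))" by (simp add: torus_int_lborel[OF sh])
    also have "torus_int (\<lambda>x. g (x - z)) = torus_int g" using torus_int_shift[OF K(1) g(2), of "- z"] by simp
    finally show "(\<integral>x. indicator ?Q x * (heat s z * g (x - z)) \<partial>lborel) = heat s z * torus_int g" .
  qed
  also have "\<dots> = torus_int g" using integral_heat[OF s, where 'n='n] by simp
  finally show ?thesis .
qed

text \<open>Since the flow preserves the mean, decay of its oscillation is convergence to the mean
  of \<open>g\<close> itself.\<close>

lemma mean_decay:
  fixes g :: "real^'n::finite \<Rightarrow> real"
  assumes s: "s > 0" and g: "bcont g" "per_space g" "osc_le g d"
  shows "\<bar>conv (heat s) g x - torus_int g\<bar> \<le> decay_const TYPE('n) * weight s * d"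
proof -
  have "continuous_on UNIV (conv (heat s) g)" using bcont_conv[OF gaussian_kernel_heat s g(1)] by (simp add: bcont_def)
  from torus_int_osc[OF this osc_decay_weight[OF s g]] show ?thesis by (simp add: torus_int_conv_heat[OF s g(1,2)])
qed

lemma conv_heat_deriv_time:
  fixes g :: "real^'n::finite \<Rightarrow> real"
  assumes s: "s > 0" and g: "bcont g"
  shows "((\<lambda>s. conv (heat s) g x) has_real_derivative (\<Sum>i\<in>UNIV. conv (heatDD i i s) g x)) (at s)"
proof -
  from g obtain K where K: "continuous_on UNIV g" "\<And>x. \<bar>g x\<bar> \<le> K" by (rule bcontE) blast
  let ?C = "real CARD('n) * (kernel_const TYPE('n) / (s / 2) * sqrt 3 ^ CARD('n)) * K"
  have "((\<lambda>s. \<integral>y. heat s (x - y) * g y \<partial>lborel) has_real_derivative (\<integral>y. (\<Sum>i\<in>UNIV. heatDD i i s (x - y)) * g y \<partial>lborel)) (at s)"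
  \<comment> \<open>For |r - s| < s / 2 the time \<open>2 * r\<close> lies between \<open>s\<close>
    and \<open>3 * s\<close>; hence the majorant at time \<open>3 * s\<close> and, from the ratio of
    these ends, the power of sqrt 3.\<close>
  proof (rule has_real_derivative_integral_dominated[where d="s / 2" and g="\<lambda>y. ?C * heat (3 * s) (x - y)"])
    show "s / 2 > 0" using s by simp
    fix r assume r: "\<bar>r - s\<bar> < s / 2"
    then have r0: "r > 0" "s / 2 \<le> r" "2 * r \<le> 3 * s" "s \<le> 2 * r" using s unfolding abs_less_iff by linarith+
    show "integrable lborel (\<lambda>y. heat r (x - y) * g y)" by (rule conv_integrable'(2)[OF heat_integrable[OF r0(1)] g])
    fix y
    show "((\<lambda>r. heat r (x - y) * g y) has_real_derivative (\<Sum>i\<in>UNIV. heatDD i i r (x - y)) * g y) (at r)"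
      by (intro DERIV_cmult_right heat_deriv_time r0)
    have "\<bar>heatDD i i r (x - y)\<bar> \<le> kernel_const TYPE('n) / (s / 2) * (sqrt 3 ^ CARD('n) * heat (3 * s) (x - y))" for i
    proof -
      have "\<bar>heatDD i i r (x - y)\<bar> \<le> kernel_const TYPE('n) / r * heat (2 * r) (x - y)" by (rule heatDD_bound[OF r0(1)])
      also have "\<dots> \<le> kernel_const TYPE('n) / (s / 2) * (sqrt (3 * s / s) ^ CARD('n) * heat (3 * s) (x - y))"
        using s r0 kernel_const_pos[where 'n='n] heat_pos[of "2 * r" "x - y"]
        by (intro mult_mono[OF divide_left_mono heat_time_bound]) auto
      finally show ?thesis using s by simp
    qed
    then have "(\<Sum>i\<in>UNIV. \<bar>heatDD i i r (x - y)\<bar>) \<le> real CARD('n) * (kernel_const TYPE('n) / (s / 2) * (sqrt 3 ^ CARD('n) * heat (3 * s) (x - y)))"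
      by (intro sum_bounded_above)
    then have "\<bar>\<Sum>i\<in>UNIV. heatDD i i r (x - y)\<bar> \<le> real CARD('n) * (kernel_const TYPE('n) / (s / 2) * (sqrt 3 ^ CARD('n) * heat (3 * s) (x - y)))"
      by (rule order_trans[OF sum_abs])
    then have "\<bar>\<Sum>i\<in>UNIV. heatDD i i r (x - y)\<bar> * \<bar>g y\<bar> \<le> real CARD('n) * (kernel_const TYPE('n) / (s / 2) * (sqrt 3 ^ CARD('n) * heat (3 * s) (x - y))) * K"
      using K(2)[of y] by (intro mult_mono) auto
    then show "\<bar>(\<Sum>i\<in>UNIV. heatDD i i r (x - y)) * g y\<bar> \<le> ?C * heat (3 * s) (x - y)"
      unfolding abs_mult by (simp only: ac_simps)
  next
    show "integrable lborel (\<lambda>y. ?C * heat (3 * s) (x - y))"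
      using lborel_integrable_reflect[of "heat (3 * s)" x] heat_integrable[of "3 * s"] s by auto
    have "integrable lborel (\<lambda>y. heatDD i i s (x - y) * g y)" for i
      by (rule conv_integrable'(2)[OF gaussian_kernel_integrable[OF gaussian_kernel_heatDD s] g])
    then have "integrable lborel (\<lambda>y. \<Sum>i\<in>UNIV. heatDD i i s (x - y) * g y)" by (rule Bochner_Integration.integrable_sum)
    then show "(\<lambda>y. (\<Sum>i\<in>UNIV. heatDD i i s (x - y)) * g y) \<in> borel_measurable lborel"
      by (auto simp: sum_distrib_right)
  qed
  moreover have "(\<integral>y. (\<Sum>i\<in>UNIV. heatDD i i s (x - y)) * g y \<partial>lborel) = (\<Sum>i\<in>UNIV. conv (heatDD i i s) g x)"
    unfolding conv_def sum_distrib_right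
    by (rule Bochner_Integration.integral_sum) (rule conv_integrable'(2)[OF gaussian_kernel_integrable[OF gaussian_kernel_heatDD s] g])
  ultimately show ?thesis by (simp add: conv_def)
qed

lemma weight_integrable: "integrable lborel (\<lambda>s. indicator {0<..} s * weight s)"
proof -
  have "set_integrable lborel (einterval 0 \<infinity>) weight"
  proof (rule interval_integral_FTC_nonneg(1)[where F="\<lambda>s. 2 * arctan (sqrt s)" and A=0 and B=pi])
    show "((\<lambda>s. 2 * arctan (sqrt s)) has_real_derivative weight x) (at x)" if "0 < ereal x" for x
    proof -
      have "x > 0" using that by (simp add: zero_ereal_def)
      then show ?thesis
        by (auto intro!: derivative_eq_intros simp: weight_def) (simp add: divide_simps)
    qed
    show "isCont weight x" if "0 < ereal x" for x
      using that unfolding weight_def by (auto intro!: continuous_intros simp: zero_ereal_def)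
    show "AE x in lborel. 0 < ereal x \<longrightarrow> ereal x < \<infinity> \<longrightarrow> 0 \<le> weight x"
      by (auto simp: zero_ereal_def intro!: AE_I2 less_imp_le weight_pos)
    show "(((\<lambda>s. 2 * arctan (sqrt s)) \<circ> real_of_ereal) \<longlongrightarrow> 0) (at_right 0)"
      unfolding zero_ereal_def ereal_tendsto_simps
      by (auto intro!: tendsto_eq_intros)
    have "((\<lambda>s. 2 * arctan (sqrt s)) \<longlongrightarrow> 2 * (pi / 2)) at_top"
      by (intro tendsto_intros filterlim_compose[OF tendsto_arctan_at_top] sqrt_at_top)
    then show "(((\<lambda>s. 2 * arctan (sqrt s)) \<circ> real_of_ereal) \<longlongrightarrow> pi) (at_left \<infinity>)"
      unfolding ereal_tendsto_simps by simp
  qed simp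
  moreover have "einterval 0 \<infinity> = {0<..}" by (auto simp: einterval_def zero_ereal_def)
  ultimately show ?thesis by (simp add: set_integrable_def)
qed

section \<open>Integrals over elapsed time\<close>

text \<open>\<open>s\<close> is the time elapsed since the source acted. The integral runs over the
  whole line with an indicator so that it can be reflected and shifted like any Lebesgue
  integral.\<close>

definition potential :: "(real \<Rightarrow> 'a \<Rightarrow> real) \<Rightarrow> 'a \<Rightarrow> real" where
  "potential w p = (\<integral>s. indicator {0<..} s * w s p \<partial>lborel)"

definition weight_int :: real where
  "weight_int = (\<integral>s. indicator {0<..} s * weight s \<partial>lborel)"

lemma potential_integrable:
  assumes "continuous_on {0<..} (\<lambda>s. w s p)" "\<And>s. s > 0 \<Longrightarrow> \<bar>w s p\<bar> \<le> C * weight s"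
  shows "integrable lborel (\<lambda>s. indicator {0<..} s * w s p)"
proof (rule Bochner_Integration.integrable_bound)
  show "integrable lborel (\<lambda>s. C * (indicator {0<..} s * weight s))" using weight_integrable by simp
  show "(\<lambda>s. indicator {0<..} s * w s p) \<in> borel_measurable lborel"
    using borel_measurable_continuous_on_indicator[OF _ assms(1)] by simp
  show "AE s in lborel. norm (indicator {0<..} s * w s p) \<le> norm (C * (indicator {0<..} s * weight s))"
    using assms(2) by (auto intro!: AE_I2 order_trans[OF _ abs_ge_self] simp: indicator_def)
qed

lemma potential_bound:
  assumes "continuous_on {0<..} (\<lambda>s. w s p)" "\<And>s. s > 0 \<Longrightarrow> \<bar>w s p\<bar> \<le> C * weight s"
  shows "\<bar>potential w p\<bar> \<le> C * weight_int"
proof -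
  have "\<bar>potential w p\<bar> \<le> (\<integral>s. \<bar>indicator {0<..} s * w s p\<bar> \<partial>lborel)"
    unfolding potential_def by (rule integral_abs_bound)
  also have "\<dots> \<le> (\<integral>s. C * (indicator {0<..} s * weight s) \<partial>lborel)"
  proof (rule Bochner_Integration.integral_mono)
    show "integrable lborel (\<lambda>s. \<bar>indicator {0<..} s * w s p\<bar>)"
      by (intro integrable_abs potential_integrable[where w=w and p=p and C=C, OF assms])
    show "integrable lborel (\<lambda>s. C * (indicator {0<..} s * weight s))" using weight_integrable by simp
  qed (use assms(2) in \<open>auto simp: indicator_def\<close>)
  finally show ?thesis by (simp add: weight_int_def)
qed

lemma weight_int_nonneg: "weight_int \<ge> 0"
  unfolding weight_int_def
  by (rule Bochner_Integration.integral_nonneg) (auto simp: indicator_def less_imp_le weight_pos)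

lemma potential_continuous:
  fixes w :: "real \<Rightarrow> 'a::metric_space \<Rightarrow> real"
  assumes c: "continuous_on ({0<..} \<times> UNIV) (\<lambda>p. w (fst p) (snd p))" and b: "\<And>s p. s > 0 \<Longrightarrow> \<bar>w s p\<bar> \<le> C * weight s"
  shows "continuous_on UNIV (potential w)"
proof -
  have c1: "continuous_on {0<..} (\<lambda>s. w s p)" for p
    by (rule continuous_on_uncurry[OF c]) (auto intro!: continuous_intros)
  have c2: "continuous_on UNIV (\<lambda>p. w s p)" if "s > 0" for s
    by (rule continuous_on_uncurry[OF c]) (use that in \<open>auto intro!: continuous_intros\<close>)
  have "continuous_on UNIV (\<lambda>p. \<integral>s. indicator {0<..} s * w s p \<partial>lborel)"
  proof (rule continuous_on_integral_dominated)
    show "(\<lambda>s. indicator {0<..} s * w s p) \<in> borel_measurable lborel" for p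
      using potential_integrable[where w=w and p=p and C=C, OF c1 b] by blast
    show "continuous_on UNIV (\<lambda>p. indicator {0<..} s * w s p)" for s
      using c2[of s] by (cases "s > 0") auto
    show "integrable lborel (\<lambda>s. C * (indicator {0<..} s * weight s))" using weight_integrable by simp
    show "\<bar>indicator {0<..} s * w s p\<bar> \<le> C * (indicator {0<..} s * weight s)" for s p
      using b by (auto simp: indicator_def)
  qed
  then show ?thesis by (simp add: potential_def[abs_def])
qed

lemma potential_deriv:
  assumes c: "\<And>p. continuous_on {0<..} (\<lambda>s. w s p)" "\<And>p. continuous_on {0<..} (\<lambda>s. w' s p)"
    and b: "\<And>s p. s > 0 \<Longrightarrow> \<bar>w s p\<bar> \<le> C * weight s" "\<And>s p. s > 0 \<Longrightarrow> \<bar>w' s p\<bar> \<le> C' * weight s"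
    and d: "\<And>s h. s > 0 \<Longrightarrow> ((\<lambda>h. w s (\<gamma> h)) has_real_derivative w' s (\<gamma> h)) (at h)"
  shows "((\<lambda>h. potential w (\<gamma> h)) has_real_derivative potential w' (\<gamma> h)) (at h)"
  unfolding potential_def
proof (rule has_real_derivative_integral_dominated[where d=1 and g="\<lambda>s. C' * (indicator {0<..} s * weight s)"])
  show "integrable lborel (\<lambda>s. indicator {0<..} s * w s (\<gamma> k))" for k
    by (rule potential_integrable[where w=w and p="\<gamma> k" and C=C, OF c(1) b(1)])
  show "((\<lambda>h. indicator {0<..} s * w s (\<gamma> h)) has_real_derivative indicator {0<..} s * w' s (\<gamma> k)) (at k)" for s k
    using d[of s k] by (cases "s > 0") auto
  show "\<bar>indicator {0<..} s * w' s (\<gamma> k)\<bar> \<le> C' * (indicator {0<..} s * weight s)" for s k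
    using b(2) by (auto simp: indicator_def)
  show "integrable lborel (\<lambda>s. C' * (indicator {0<..} s * weight s))" using weight_integrable by simp
  show "(\<lambda>s. indicator {0<..} s * w' s (\<gamma> h)) \<in> borel_measurable lborel"
    using potential_integrable[where w=w' and p="\<gamma> h" and C=C', OF c(2) b(2)] by blast
qed simp

section \<open>Duhamel potential of a periodic source\<close>

text \<open>The regularity of the nonlinear source: Lipschitz in space, continuous in time.
  Periodicity in time is added where the solution itself has to be periodic.\<close>

locale source =
  fixes f :: "real \<Rightarrow> real^'n::finite \<Rightarrow> real" and M L :: real
  assumes cont: "continuous_on UNIV (\<lambda>p. f (fst p) (snd p))"
    and bd: "\<And>t x. \<bar>f t x\<bar> \<le> M"
    and per: "\<And>t. per_space (f t)"
    and lip: "\<And>t x y. \<bar>f t x - f t y\<bar> \<le> L * norm (x - y)"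
    and L0: "L \<ge> 0"
begin

lemma M0: "M \<ge> 0"
  using bd[of 0 0] by linarith

lemma cont': "continuous_on (UNIV \<times> UNIV) (\<lambda>p. f (fst p) (snd p))"
  using cont by simp

lemma cont_slice: "continuous_on UNIV (f t)"
  by (rule continuous_on_uncurry[OF cont']) (auto intro!: continuous_intros)

lemma bcont_f: "bcont (f t)"
  unfolding bcont_def using cont_slice bd by blast

lemma osc_f: "osc_le (f t) (2 * M)"
  unfolding osc_le_def
proof (intro allI)
  show "\<bar>f t x - f t y\<bar> \<le> 2 * M" for x y using bd[of t x] bd[of t y] by linarith
qed

definition kern :: "(real \<Rightarrow> real^'n \<Rightarrow> real) \<Rightarrow> real \<Rightarrow> real \<times> (real^'n) \<Rightarrow> real" where
  "kern q s p = conv (q s) (f (fst p - s)) (snd p)"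

text \<open>The flow of \<open>f\<close> tends to the mean of \<open>f\<close> and not to 0, so the
  mean has to be removed before integrating over an infinite past. The kernels of derivatives
  annihilate constants and take no such correction.\<close>

definition kern0 :: "real \<Rightarrow> real \<times> (real^'n) \<Rightarrow> real" where
  "kern0 s p = kern heat s p - torus_int (f (fst p - s))"

lemma kern_cont:
  assumes "gaussian_kernel q B"
  shows "continuous_on ({0<..} \<times> UNIV) (\<lambda>p. kern q (fst p) (snd p))"
proof -
  have "continuous_on ({0<..} \<times> UNIV) (\<lambda>p. conv (q (fst p)) (f (fst (snd p))) (snd (snd p)))"
    by (rule continuous_on_conv[OF assms cont bd])
  then show ?thesis
    unfolding kern_def
    by (rule continuous_on_compose2[where g="\<lambda>p. conv (q (fst p)) (f (fst (snd p))) (snd (snd p))"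
          and f="\<lambda>p. (fst p, fst (snd p) - fst p, snd (snd p))", simplified])
      (auto intro!: continuous_intros)
qed

lemma kern_cont_time:
  assumes "gaussian_kernel q B"
  shows "continuous_on {0<..} (\<lambda>s. kern q s p)"
  by (rule continuous_on_uncurry[OF kern_cont[OF assms]]) (auto intro!: continuous_intros)

lemma cont_mean: "continuous_on UNIV (\<lambda>t. torus_int (f t))"
proof -
  have "continuous_on (UNIV \<times> cbox 0 1) (\<lambda>(t, x). f t x)"
    using continuous_on_subset[OF cont, of "UNIV \<times> cbox 0 1"] by (simp add: case_prod_beta)
  then show ?thesis unfolding torus_int_def by (rule integral_continuous_on_param)
qed

lemma kern0_cont: "continuous_on ({0<..} \<times> UNIV) (\<lambda>p. kern0 (fst p) (snd p))"
proof -
  have "continuous_on ({0<..} \<times> UNIV) (\<lambda>p::real \<times> real \<times> (real^'n). torus_int (f (fst (snd p) - fst p)))"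
    by (rule continuous_on_compose2[OF cont_mean]) (auto intro!: continuous_intros)
  with kern_cont[OF gaussian_kernel_heat] show ?thesis unfolding kern0_def by (rule continuous_on_diff)
qed

lemma kern0_cont_time: "continuous_on {0<..} (\<lambda>s. kern0 s p)"
  by (rule continuous_on_uncurry[OF kern0_cont]) (auto intro!: continuous_intros)

lemma kern0_bound: "s > 0 \<Longrightarrow> \<bar>kern0 s p\<bar> \<le> (decay_const TYPE('n) * (2 * M)) * weight s"
  using mean_decay[OF _ bcont_f per osc_f, of s "fst p - s" "snd p"] by (simp add: kern0_def kern_def ac_simps)

lemma kern_heatD_bound: "s > 0 \<Longrightarrow> \<bar>kern (heatD i) s p\<bar> \<le> (decay_const TYPE('n) * (2 * M)) * weight s"
  using conv_heatD_decay[OF _ bcont_f per osc_f, of s i "fst p - s" "snd p"] by (simp add: kern_def ac_simps)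

lemma kern_heatDD_bound: "s > 0 \<Longrightarrow> \<bar>kern (heatDD i j) s p\<bar> \<le> (decay_const TYPE('n) * (L + 2 * M)) * weight s"
  using conv_heatDD_decay[OF _ bcont_f per osc_f lip L0, of s i j "fst p - s" "snd p"] by (simp add: kern_def ac_simps)

text \<open>The Duhamel potential, and the candidates for its first and second spatial derivatives
  obtained by differentiating the kernel.\<close>

definition "Phi p = potential kern0 p"
definition "G i p = potential (kern (heatD i)) p"
definition "GG i j p = potential (kern (heatDD i j)) p"

lemma Phi_cont: "continuous_on UNIV Phi"
  using potential_continuous[OF kern0_cont kern0_bound] by (simp add: Phi_def[abs_def])

lemma G_cont: "continuous_on UNIV (G i)"
  using potential_continuous[OF kern_cont[OF gaussian_kernel_heatD] kern_heatD_bound] by (simp add: G_def[abs_def])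

lemma GG_cont: "continuous_on UNIV (GG i j)"
  using potential_continuous[OF kern_cont[OF gaussian_kernel_heatDD] kern_heatDD_bound] by (simp add: GG_def[abs_def])

text \<open>The right-hand side involves the supremum bound \<open>M\<close> alone; this makes the
  later iteration a contraction in the supremum norm.\<close>

lemma G_bound: "\<bar>G i p\<bar> \<le> 2 * decay_const TYPE('n) * weight_int * M"
  using potential_bound[where w="kern (heatD i)" and p=p, OF kern_cont_time[OF gaussian_kernel_heatD] kern_heatD_bound]
  by (simp add: G_def ac_simps)

lemma GG_bound: "\<bar>GG i j p\<bar> \<le> (decay_const TYPE('n) * (L + 2 * M)) * weight_int"
  using potential_bound[where w="kern (heatDD i j)" and p=p, OF kern_cont_time[OF gaussian_kernel_heatDD] kern_heatDD_bound]
  by (simp add: GG_def)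

lemma Phi_deriv: "((\<lambda>h. Phi (t, x + h *\<^sub>R axis i 1)) has_real_derivative G i (t, x + h *\<^sub>R axis i 1)) (at h)"
  unfolding Phi_def G_def
proof (rule potential_deriv[where \<gamma>="\<lambda>h. (t, x + h *\<^sub>R axis i 1)" and C="decay_const TYPE('n) * (2 * M)" and C'="decay_const TYPE('n) * (2 * M)"])
  show "((\<lambda>h. kern0 s (t, x + h *\<^sub>R axis i 1)) has_real_derivative kern (heatD i) s (t, x + h *\<^sub>R axis i 1)) (at h)"
    if "s > 0" for s h
    unfolding kern0_def kern_def fst_conv snd_conv
    using DERIV_diff[OF conv_heat_deriv[OF that bcont_f, of "t - s" x i h] DERIV_const[of "torus_int (f (t - s))"]] by simp
qed (rule kern0_cont_time kern_cont_time[OF gaussian_kernel_heatD] kern0_bound kern_heatD_bound; assumption)+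

lemma G_deriv: "((\<lambda>h. G i (t, x + h *\<^sub>R axis j 1)) has_real_derivative GG i j (t, x + h *\<^sub>R axis j 1)) (at h)"
  unfolding G_def GG_def
proof (rule potential_deriv[where \<gamma>="\<lambda>h. (t, x + h *\<^sub>R axis j 1)" and C="decay_const TYPE('n) * (2 * M)" and C'="decay_const TYPE('n) * (L + 2 * M)"])
  show "((\<lambda>h. kern (heatD i) s (t, x + h *\<^sub>R axis j 1)) has_real_derivative kern (heatDD i j) s (t, x + h *\<^sub>R axis j 1)) (at h)"
    if "s > 0" for s h
    unfolding kern_def fst_conv snd_conv by (rule conv_heatD_deriv[OF that bcont_f])
qed (rule kern_cont_time[OF gaussian_kernel_heatDD] kern_cont_time[OF gaussian_kernel_heatD] kern_heatDD_bound kern_heatD_bound; assumption)+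

lemma per_Phi: "Phi (t, x + axis i 1) = Phi (t, x)"
  using per_space_conv[OF per] by (simp add: Phi_def potential_def kern0_def kern_def per_space_def)

lemma per_G: "G j (t, x + axis i 1) = G j (t, x)"
  using per_space_conv[OF per] by (simp add: G_def potential_def kern_def per_space_def)

lemma per_time:
  assumes "\<And>t x. f (t + T) x = f t x"
  shows "Phi (t + T, x) = Phi (t, x)" "G j (t + T, x) = G j (t, x)"
proof -
  have "f (t + T - s) = f (t - s)" for s
    using assms[of "t - s"] by (simp add: fun_eq_iff algebra_simps)
  then show "Phi (t + T, x) = Phi (t, x)" "G j (t + T, x) = G j (t, x)"
    by (simp_all add: Phi_def G_def potential_def kern0_def kern_def)
qed

text \<open>Extending the increment of the heat flow by zero to non-positive times lets Duhamel's formula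
  be differentiated through Fubini's theorem without case distinctions.\<close>

definition E :: "real^'n \<Rightarrow> real \<Rightarrow> real \<Rightarrow> real" where
  "E x s r = (if s > 0 then conv (heat s) (f r) x - f r x else 0)"

text \<open>For \<open>s > 0\<close> this is the spatial Laplacian at \<open>x\<close> of the heat
  flow of \<open>f r\<close>, hence the derivative of \<open>E x s r\<close> in
  \<open>s\<close>.\<close>

definition V :: "real^'n \<Rightarrow> real \<Rightarrow> real \<Rightarrow> real" where
  "V x s r = (\<Sum>i\<in>UNIV. conv (heatDD i i s) (f r) x)"

lemma V_bound: "s > 0 \<Longrightarrow> \<bar>V x s r\<bar> \<le> real CARD('n) * (decay_const TYPE('n) * (L + 2 * M)) * weight s"
proof -
  assume s: "s > 0"
  have "\<bar>V x s r\<bar> \<le> (\<Sum>i\<in>UNIV. \<bar>conv (heatDD i i s) (f r) x\<bar>)" unfolding V_def by (rule sum_abs)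
  also have "\<dots> \<le> real CARD('n) * ((decay_const TYPE('n) * (L + 2 * M)) * weight s)"
    using conv_heatDD_decay[OF s bcont_f per osc_f lip L0] by (intro sum_bounded_above) (simp add: ac_simps)
  finally show ?thesis by simp
qed

lemma V_cont: "continuous_on ({0<..} \<times> UNIV) (\<lambda>p. V x (fst p) (snd p))"
proof -
  have "continuous_on ({0<..} \<times> UNIV) (\<lambda>p. conv (heatDD i i (fst p)) (f (snd p)) x)" for i
  proof -
    have "continuous_on ({0<..} \<times> UNIV) (\<lambda>p. conv (heatDD i i (fst p)) (f (fst (snd p))) (snd (snd p)))"
      by (rule continuous_on_conv[OF gaussian_kernel_heatDD cont bd])
    then show ?thesis
      by (rule continuous_on_compose2[where g="\<lambda>p. conv (heatDD i i (fst p)) (f (fst (snd p))) (snd (snd p))"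
            and f="\<lambda>p. (fst p, snd p, x)", simplified])
        (auto intro!: continuous_intros)
  qed
  then show ?thesis unfolding V_def by (intro continuous_on_sum)
qed

lemma V_integrable: "integrable lborel (\<lambda>s. indicator {0<..} s * V x s r)"
proof -
  have "continuous_on {0<..} (\<lambda>s. V x s r)"
    by (rule continuous_on_uncurry[OF V_cont]) (auto intro!: continuous_intros)
  then show ?thesis
    by (rule potential_integrable[where w="\<lambda>s p. V x s r" and C="real CARD('n) * (decay_const TYPE('n) * (L + 2 * M))"]) (rule V_bound)
qed

text \<open>At positive times the flow is differentiable in \<open>s\<close>; at 0 the Lipschitz
  bound on the source gives the rate sqrt s.\<close>

lemma heat_flow_cont: "continuous_on {0..} (\<lambda>s. E x s r)"
  unfolding continuous_on_eq_continuous_within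
proof
  fix s :: real assume "s \<in> {0..}"
  show "continuous (at s within {0..}) (\<lambda>s. E x s r)"
  proof (cases "s > 0")
    case True
    have "((\<lambda>s. conv (heat s) (f r) x - f r x) has_real_derivative (\<Sum>i\<in>UNIV. conv (heatDD i i s) (f r) x) - 0) (at s)"
      by (rule DERIV_diff[OF conv_heat_deriv_time[OF True bcont_f] DERIV_const])
    then have "((\<lambda>s. E x s r) has_real_derivative (\<Sum>i\<in>UNIV. conv (heatDD i i s) (f r) x) - 0) (at s)"
      by (rule has_field_derivative_transform_within_open[where S="{0<..}"]) (use True in \<open>auto simp: E_def\<close>)
    then show ?thesis by (rule continuous_at_imp_continuous_at_within[OF DERIV_isCont])
  next
    case False
    then have s0: "s = 0" using \<open>s \<in> {0..}\<close> by simp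
    have "((\<lambda>s. E x s r) \<longlongrightarrow> 0) (at 0 within {0..})"
    proof (rule Lim_null_comparison)
      show "\<forall>\<^sub>F s in at 0 within {0..}. norm (E x s r) \<le> kernel_const TYPE('n) * sqrt s * L"
      proof -
        have "norm (E x s r) \<le> kernel_const TYPE('n) * sqrt s * L" if "s \<in> {0..}" for s
          using conv_heat_lipschitz_approx[OF _ bcont_f lip L0, of s r x] that by (cases "s = 0") (auto simp: E_def)
        then show ?thesis by (simp add: eventually_at_filter)
      qed
      have "((\<lambda>s. kernel_const TYPE('n) * sqrt s * L) \<longlongrightarrow> kernel_const TYPE('n) * sqrt 0 * L) (at 0 within {0..})"
        by (intro tendsto_intros)
      then show "((\<lambda>s. kernel_const TYPE('n) * sqrt s * L) \<longlongrightarrow> 0) (at 0 within {0..})" by simp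
    qed
    then show ?thesis unfolding s0 continuous_within by (simp add: E_def)
  qed
qed

text \<open>The fundamental theorem of calculus on the nonnegative part of the interval. As
  \<open>V\<close> may be singular at 0, the version that asks only for continuity at the end points
  is used.\<close>

lemma E_increment:
  assumes "s1 \<le> s2"
  shows "(\<integral>u. indicator {s1..s2} u * (indicator {0<..} u * V x u r) \<partial>lborel) = E x s2 r - E x s1 r"
proof (cases "s2 > 0")
  case False
  then have "(\<lambda>u. indicator {s1..s2} u * (indicator {0<..} u * V x u r)) = (\<lambda>u. 0)" by (auto simp: indicator_def)
  moreover have "E x s2 r = 0" "E x s1 r = 0" using False assms by (auto simp: E_def)
  ultimately show ?thesis by (simp only: Bochner_Integration.integral_zero diff_self)
next
  case True
  \<comment> \<open>Negative times contribute nothing to either side, since \<open>E\<close> and the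
    indicator vanish there.\<close>
  define s0 where "s0 = max s1 0"
  have s0: "0 \<le> s0" "s0 \<le> s2" "E x s0 r = E x s1 r" using True assms by (auto simp: s0_def E_def)
  have "((\<lambda>u. V x u r) has_integral E x s2 r - E x s0 r) {s0..s2}"
  proof (rule fundamental_theorem_of_calculus_interior[OF s0(2)])
    show "continuous_on {s0..s2} (\<lambda>u. E x u r)"
      by (rule continuous_on_subset[OF heat_flow_cont]) (use s0 in auto)
    fix u assume u: "u \<in> {s0<..<s2}"
    then have u0: "u > 0" using s0 by auto
    have "((\<lambda>s. conv (heat s) (f r) x - f r x) has_real_derivative V x u r - 0) (at u)"
      unfolding V_def by (rule DERIV_diff[OF conv_heat_deriv_time[OF u0 bcont_f] DERIV_const])
    then have "((\<lambda>s. E x s r) has_real_derivative V x u r - 0) (at u)"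
      by (rule has_field_derivative_transform_within_open[where S="{0<..}"]) (use u0 in \<open>auto simp: E_def\<close>)
    then show "((\<lambda>u. E x u r) has_vector_derivative V x u r) (at u)"
      by (simp add: has_real_derivative_iff_has_vector_derivative)
  qed
  then have "((\<lambda>u. V x u r) has_integral E x s2 r - E x s0 r) ({s1..s2} \<inter> {0<..})"
  proof (rule has_integral_spike_set_eq[THEN iffD1, rotated -1])
    show "negligible {u \<in> {s0..s2} - {s1..s2} \<inter> {0<..}. V x u r \<noteq> 0}"
      by (rule negligible_subset[of "{0}"]) (auto simp: s0_def)
    show "negligible {u \<in> {s1..s2} \<inter> {0<..} - {s0..s2}. V x u r \<noteq> 0}"
      by (rule negligible_subset[of "{0}"]) (auto simp: s0_def)
  qed
  then have "((\<lambda>u. if u \<in> {s1..s2} \<inter> {0<..} then V x u r else 0) has_integral E x s2 r - E x s0 r) UNIV"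
    by (simp only: has_integral_restrict_UNIV)
  moreover have eq: "(\<lambda>u. if u \<in> {s1..s2} \<inter> {0<..} then V x u r else 0) = (\<lambda>u. indicator {s1..s2} u * (indicator {0<..} u * V x u r))"
    by (auto simp: indicator_def)
  ultimately have h1: "((\<lambda>u. indicator {s1..s2} u * (indicator {0<..} u * V x u r)) has_integral E x s2 r - E x s0 r) UNIV"
    by (simp only:)
  have "integrable lborel (\<lambda>u. indicator {s1..s2} u * (indicator {0<..} u * V x u r))"
    using integrable_mult_indicator[OF _ V_integrable[of x r], of "{s1..s2}"] by simp
  from has_integral_unique[OF has_integral_integral_lborel[OF this] h1] show ?thesis by (simp only: s0(3))
qed

section \<open>The time derivative of the potential\<close>

definition "lapPhi p = (\<Sum>i\<in>UNIV. GG i i p)"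

lemma lapPhi_cont: "continuous_on UNIV lapPhi"
  unfolding lapPhi_def[abs_def] by (intro continuous_on_sum GG_cont)

text \<open>The substitution \<sigma> = r - s replaces elapsed time by the time at which the source
  acts, the variable that stays fixed when one integrates in \<open>r\<close>.\<close>

lemma lapPhi_eq: "lapPhi (r, x) = (\<integral>\<sigma>. indicator {0<..} (r - \<sigma>) * V x (r - \<sigma>) \<sigma> \<partial>lborel)"
proof -
  have "lapPhi (r, x) = (\<integral>s. (\<Sum>i\<in>UNIV. indicator {0<..} s * kern (heatDD i i) s (r, x)) \<partial>lborel)"
    unfolding lapPhi_def GG_def potential_def
    by (rule Bochner_Integration.integral_sum[symmetric])
      (rule potential_integrable[where w="kern (heatDD _ _)", OF kern_cont_time[OF gaussian_kernel_heatDD] kern_heatDD_bound])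
  also have "\<dots> = (\<integral>s. indicator {0<..} (r - (r - s)) * V x (r - (r - s)) (r - s) \<partial>lborel)"
    by (simp add: V_def kern_def sum_distrib_left)
  also have "\<dots> = (\<integral>\<sigma>. indicator {0<..} (r - \<sigma>) * V x (r - \<sigma>) \<sigma> \<partial>lborel)"
    by (rule lborel_integral_reflect[where f="\<lambda>\<sigma>. indicator {0<..} (r - \<sigma>) * V x (r - \<sigma>) \<sigma>"])
  finally show ?thesis .
qed

definition "dev x t = f t x - torus_int (f t)"

lemma dev_cont: "continuous_on UNIV (dev x)"
proof -
  have "continuous_on UNIV (\<lambda>t. f t x)"
    by (rule continuous_on_uncurry[OF cont']) (auto intro!: continuous_intros)
  then show ?thesis unfolding dev_def[abs_def] by (intro continuous_on_diff cont_mean)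
qed

text \<open>In source time \<open>kern0\<close> splits into the increment \<open>E\<close> and the
  deviation \<open>dev\<close>. Over an infinite past neither term needs to be integrable alone, so
  they are kept in one integral.\<close>

lemma Phi_eq:
  shows "Phi (t, x) = (\<integral>\<sigma>. E x (t - \<sigma>) \<sigma> + indicator {..<t} \<sigma> * dev x \<sigma> \<partial>lborel)"
    and "integrable lborel (\<lambda>\<sigma>. E x (t - \<sigma>) \<sigma> + indicator {..<t} \<sigma> * dev x \<sigma>)"
proof -
  have eq: "indicator {0<..} s * kern0 s (t, x) = E x (t - (t - s)) (t - s) + indicator {..<t} (t - s) * dev x (t - s)" for s
    by (simp add: E_def kern0_def kern_def dev_def indicator_def)
  show "Phi (t, x) = (\<integral>\<sigma>. E x (t - \<sigma>) \<sigma> + indicator {..<t} \<sigma> * dev x \<sigma> \<partial>lborel)"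
    unfolding Phi_def potential_def eq
    by (rule lborel_integral_reflect[where f="\<lambda>\<sigma>. E x (t - \<sigma>) \<sigma> + indicator {..<t} \<sigma> * dev x \<sigma>"])
  have "integrable lborel (\<lambda>s. indicator {0<..} s * kern0 s (t, x))"
    by (rule potential_integrable[where w=kern0, OF kern0_cont_time kern0_bound])
  then show "integrable lborel (\<lambda>\<sigma>. E x (t - \<sigma>) \<sigma> + indicator {..<t} \<sigma> * dev x \<sigma>)"
    unfolding eq using lborel_integrable_reflect[where f="\<lambda>\<sigma>. E x (t - \<sigma>) \<sigma> + indicator {..<t} \<sigma> * dev x \<sigma>" and x=t] by blast
qed

text \<open>Integrate the Laplacian over [a, b] and exchange integrals: for each source time
  \<sigma> the integral in \<open>r\<close> collapses to a difference of values of \<open>E\<close>,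
  without differentiating \<open>f\<close> in time. The \<open>dev\<close> term accounts for the
  sources that start to act between \<open>a\<close> and \<open>b\<close>.\<close>

lemma Phi_increment:
  assumes ab: "a \<le> b"
  shows "((\<lambda>r. lapPhi (r, x) + dev x r) has_integral Phi (b, x) - Phi (a, x)) {a..b}"
proof -
  let ?F = "\<lambda>(r, \<sigma>). indicator {a..b} r * (indicator {0<..} (r - \<sigma>) * V x (r - \<sigma>) \<sigma>)"
  \<comment> \<open>Continuity of \<open>V\<close> is known for positive elapsed times; since the
    half-plane r > \<sigma> is open, the extension by 0 is measurable.\<close>
  have Vm: "(\<lambda>(r, \<sigma>). indicator {0<..} (r - \<sigma>) * V x (r - \<sigma>) \<sigma>) \<in> borel_measurable (lborel \<Otimes>\<^sub>M lborel)"
  proof -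
    let ?S = "{p::real \<times> real. fst p - snd p > 0}"
    have "open ?S" by (intro open_Collect_less continuous_intros)
    moreover have "continuous_on ?S (\<lambda>p. V x (fst p - snd p) (snd p))"
      by (rule continuous_on_uncurry[OF V_cont]) (auto intro!: continuous_intros)
    ultimately have "(\<lambda>p. indicator ?S p *\<^sub>R V x (fst p - snd p) (snd p)) \<in> borel_measurable borel"
      by (intro borel_measurable_continuous_on_indicator) auto
    moreover have "(\<lambda>p. indicator ?S p *\<^sub>R V x (fst p - snd p) (snd p)) = (\<lambda>(r, \<sigma>). indicator {0<..} (r - \<sigma>) * V x (r - \<sigma>) \<sigma>)"
      by (auto simp: indicator_def)
    ultimately show ?thesis by (simp add: lborel_prod)
  qed
  have Fm: "?F \<in> borel_measurable (lborel \<Otimes>\<^sub>M lborel)"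
  proof -
    have "(\<lambda>p. indicator {a..b} (fst p) :: real) \<in> borel_measurable (lborel \<Otimes>\<^sub>M lborel)" by measurable
    from borel_measurable_times[OF this Vm] show ?thesis by (simp add: case_prod_beta')
  qed
  have Vi: "integrable lborel (\<lambda>\<sigma>. indicator {0<..} (r - \<sigma>) * V x (r - \<sigma>) \<sigma>)" for r
  proof -
    have "continuous_on {0<..} (\<lambda>s. V x s (r - s))"
      by (rule continuous_on_uncurry[OF V_cont]) (auto intro!: continuous_intros)
    then have "integrable lborel (\<lambda>s. indicator {0<..} s * V x s (r - s))"
      by (rule potential_integrable[where w="\<lambda>s p. V x s (r - s)" and C="real CARD('n) * (decay_const TYPE('n) * (L + 2 * M))"]) (rule V_bound)
    then show ?thesis
      using lborel_integrable_reflect[where f="\<lambda>\<sigma>. indicator {0<..} (r - \<sigma>) * V x (r - \<sigma>) \<sigma>" and x=r] by simp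
  qed
  \<comment> \<open>The bound is uniform in \<open>r\<close>, so the integral over the bounded
    interval [a, b] stays finite and Fubini applies.\<close>
  have Vb: "(\<integral>\<sigma>. \<bar>indicator {0<..} (r - \<sigma>) * V x (r - \<sigma>) \<sigma>\<bar> \<partial>lborel) \<le> real CARD('n) * (decay_const TYPE('n) * (L + 2 * M)) * weight_int" for r
  proof -
    have "integrable lborel (\<lambda>s. real CARD('n) * (decay_const TYPE('n) * (L + 2 * M)) * (indicator {0<..} s * weight s))" using weight_integrable by simp
    then have i: "integrable lborel (\<lambda>\<sigma>. real CARD('n) * (decay_const TYPE('n) * (L + 2 * M)) * (indicator {0<..} (r - \<sigma>) * weight (r - \<sigma>)))"
      using lborel_integrable_reflect[where f="\<lambda>s. real CARD('n) * (decay_const TYPE('n) * (L + 2 * M)) * (indicator {0<..} s * weight s)" and x=r] by simp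
    have "(\<integral>\<sigma>. \<bar>indicator {0<..} (r - \<sigma>) * V x (r - \<sigma>) \<sigma>\<bar> \<partial>lborel)
        \<le> (\<integral>\<sigma>. real CARD('n) * (decay_const TYPE('n) * (L + 2 * M)) * (indicator {0<..} (r - \<sigma>) * weight (r - \<sigma>)) \<partial>lborel)"
      by (rule Bochner_Integration.integral_mono[OF integrable_abs[OF Vi] i]) (auto simp: indicator_def V_bound)
    also have "\<dots> = real CARD('n) * (decay_const TYPE('n) * (L + 2 * M)) * weight_int"
      using lborel_integral_reflect[where f="\<lambda>s. real CARD('n) * (decay_const TYPE('n) * (L + 2 * M)) * (indicator {0<..} s * weight s)" and x=r]
      by (simp add: weight_int_def)
    finally show ?thesis .
  qed
  have int: "integrable (lborel \<Otimes>\<^sub>M lborel) ?F"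
  proof (rule lborel_pair.Fubini_integrable[OF Fm])
    have "integrable lborel (\<lambda>r. \<integral>\<sigma>. \<bar>?F (r, \<sigma>)\<bar> \<partial>lborel)"
    proof (rule Bochner_Integration.integrable_bound)
      show "integrable lborel (\<lambda>r. real CARD('n) * (decay_const TYPE('n) * (L + 2 * M)) * weight_int * indicator {a..b} r)"
        by (intro integrable_mult_right integrable_real_indicator) (auto simp: emeasure_lborel_Icc_eq)
      have "(\<lambda>p. \<bar>?F p\<bar>) \<in> borel_measurable (lborel \<Otimes>\<^sub>M lborel)" using Fm by measurable
      then have "(\<lambda>(r, \<sigma>). \<bar>?F (r, \<sigma>)\<bar>) \<in> borel_measurable (lborel \<Otimes>\<^sub>M lborel)" by (simp add: case_prod_beta')
      from lborel.borel_measurable_lebesgue_integral[OF this]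
      show "(\<lambda>r. \<integral>\<sigma>. \<bar>?F (r, \<sigma>)\<bar> \<partial>lborel) \<in> borel_measurable lborel" .
      show "AE r in lborel. norm (\<integral>\<sigma>. \<bar>?F (r, \<sigma>)\<bar> \<partial>lborel) \<le> norm (real CARD('n) * (decay_const TYPE('n) * (L + 2 * M)) * weight_int * indicator {a..b} r)"
      proof (rule AE_I2)
        fix r :: real
        have "norm (\<integral>\<sigma>. \<bar>?F (r, \<sigma>)\<bar> \<partial>lborel) = (\<integral>\<sigma>. \<bar>?F (r, \<sigma>)\<bar> \<partial>lborel)"
          by (simp add: Bochner_Integration.integral_nonneg)
        also have "\<dots> = indicator {a..b} r * (\<integral>\<sigma>. \<bar>indicator {0<..} (r - \<sigma>) * V x (r - \<sigma>) \<sigma>\<bar> \<partial>lborel)"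
          by (simp add: abs_mult)
        also have "\<dots> \<le> indicator {a..b} r * (real CARD('n) * (decay_const TYPE('n) * (L + 2 * M)) * weight_int)"
          by (intro mult_left_mono Vb) auto
        finally show "norm (\<integral>\<sigma>. \<bar>?F (r, \<sigma>)\<bar> \<partial>lborel) \<le> norm (real CARD('n) * (decay_const TYPE('n) * (L + 2 * M)) * weight_int * indicator {a..b} r)"
          by (simp add: ac_simps)
      qed
    qed
    then show "integrable lborel (\<lambda>r. \<integral>\<sigma>. norm (?F (r, \<sigma>)) \<partial>lborel)" by simp
    show "AE r in lborel. integrable lborel (\<lambda>\<sigma>. ?F (r, \<sigma>))" using Vi by auto
  qed
  have inner: "(\<integral>r. ?F (r, \<sigma>) \<partial>lborel) = E x (b - \<sigma>) \<sigma> - E x (a - \<sigma>) \<sigma>" for \<sigma>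
  proof -
    have "(\<integral>r. ?F (r, \<sigma>) \<partial>lborel) = (\<integral>u. ?F (\<sigma> + u, \<sigma>) \<partial>lborel)"
      by (rule lborel_integral_shift[symmetric])
    also have "\<dots> = (\<integral>u. indicator {a - \<sigma>..b - \<sigma>} u * (indicator {0<..} u * V x u \<sigma>) \<partial>lborel)"
      by (rule Bochner_Integration.integral_cong[OF refl]) (auto simp: indicator_def)
    also have "\<dots> = E x (b - \<sigma>) \<sigma> - E x (a - \<sigma>) \<sigma>" by (rule E_increment) (use ab in simp)
    finally show ?thesis .
  qed
  have "(\<integral>r. indicator {a..b} r * lapPhi (r, x) \<partial>lborel) = (\<integral>r. \<integral>\<sigma>. ?F (r, \<sigma>) \<partial>lborel \<partial>lborel)"
    by (simp add: lapPhi_eq)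
  also have "\<dots> = (\<integral>\<sigma>. \<integral>r. ?F (r, \<sigma>) \<partial>lborel \<partial>lborel)"
    using lborel_pair.Fubini_integral[OF int] by simp
  finally have lap: "(\<integral>r. indicator {a..b} r * lapPhi (r, x) \<partial>lborel) = (\<integral>\<sigma>. E x (b - \<sigma>) \<sigma> - E x (a - \<sigma>) \<sigma> \<partial>lborel)"
    unfolding inner .
  have idev: "integrable lborel (\<lambda>\<sigma>. indicator {a..b} \<sigma> * dev x \<sigma>)"
    using borel_integrable_compact[of "{a..b}" "dev x"] continuous_on_subset[OF dev_cont] by auto
  have clap: "continuous_on UNIV (\<lambda>r. lapPhi (r, x))"
    by (rule continuous_on_compose2[OF lapPhi_cont]) (auto intro!: continuous_intros)
  have ilap: "integrable lborel (\<lambda>r. indicator {a..b} r * lapPhi (r, x))"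
    using borel_integrable_compact[of "{a..b}" "\<lambda>r. lapPhi (r, x)"] continuous_on_subset[OF clap] by auto
  have Em: "integrable lborel (\<lambda>\<sigma>. E x (b - \<sigma>) \<sigma> - E x (a - \<sigma>) \<sigma>)"
    using lborel_pair.integrable_fst'[OF lborel_pair.integrable_product_swap[OF int]] unfolding case_prod_conv inner[unfolded case_prod_conv] .
  \<comment> \<open>The two sides differ at most at \<sigma> = b: the difference of the half-lines
    is \<open>{a..<b}\<close>, whereas \<open>{a..b}\<close> is closed.\<close>
  have ae: "AE \<sigma> in lborel. E x (b - \<sigma>) \<sigma> - E x (a - \<sigma>) \<sigma> + indicator {a..b} \<sigma> * dev x \<sigma>
      = (E x (b - \<sigma>) \<sigma> + indicator {..<b} \<sigma> * dev x \<sigma>) - (E x (a - \<sigma>) \<sigma> + indicator {..<a} \<sigma> * dev x \<sigma>)"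
    using AE_lborel_singleton[of b] by eventually_elim (use ab in \<open>auto simp: indicator_def\<close>)
  have "(\<integral>r. indicator {a..b} r * lapPhi (r, x) \<partial>lborel) + (\<integral>\<sigma>. indicator {a..b} \<sigma> * dev x \<sigma> \<partial>lborel)
      = (\<integral>\<sigma>. E x (b - \<sigma>) \<sigma> - E x (a - \<sigma>) \<sigma> + indicator {a..b} \<sigma> * dev x \<sigma> \<partial>lborel)"
    unfolding lap using Em idev by simp
  also have "\<dots> = (\<integral>\<sigma>. (E x (b - \<sigma>) \<sigma> + indicator {..<b} \<sigma> * dev x \<sigma>) - (E x (a - \<sigma>) \<sigma> + indicator {..<a} \<sigma> * dev x \<sigma>) \<partial>lborel)"
    using ae Em idev Phi_eq(2)[of x b] Phi_eq(2)[of x a] by (intro integral_cong_AE) auto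
  also have "\<dots> = Phi (b, x) - Phi (a, x)"
    unfolding Phi_eq(1) by (rule Bochner_Integration.integral_diff[OF Phi_eq(2) Phi_eq(2)])
  finally have sum: "(\<integral>r. indicator {a..b} r * (lapPhi (r, x) + dev x r) \<partial>lborel) = Phi (b, x) - Phi (a, x)"
    using ilap idev by (simp add: distrib_left)
  have "integrable lborel (\<lambda>r. indicator {a..b} r * (lapPhi (r, x) + dev x r))"
    using ilap idev by (simp add: distrib_left)
  from has_integral_integral_lborel[OF this]
  have "((\<lambda>r. indicator {a..b} r * (lapPhi (r, x) + dev x r)) has_integral Phi (b, x) - Phi (a, x)) UNIV"
    unfolding sum .
  moreover have "(\<lambda>r. indicator {a..b} r * (lapPhi (r, x) + dev x r)) = (\<lambda>r. if r \<in> {a..b} then lapPhi (r, x) + dev x r else 0)"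
    by (auto simp: indicator_def)
  ultimately show ?thesis by (simp only: has_integral_restrict_UNIV)
qed

text \<open>The integrand in \<open>Phi_increment\<close> is continuous, so its integral can be
  differentiated; starting at \<open>t - 1\<close> makes \<open>t\<close> an interior point.\<close>

lemma Phi_deriv_time: "((\<lambda>t. Phi (t, x)) has_real_derivative lapPhi (t, x) + dev x t) (at t)"
proof -
  have clap: "continuous_on UNIV (\<lambda>r. lapPhi (r, x))"
    by (rule continuous_on_compose2[OF lapPhi_cont]) (auto intro!: continuous_intros)
  have c: "continuous_on {t - 1..t + 1} (\<lambda>r. lapPhi (r, x) + dev x r)"
    by (intro continuous_intros continuous_on_subset[OF clap] continuous_on_subset[OF dev_cont]) auto
  have "((\<lambda>u. integral {t - 1..u} (\<lambda>r. lapPhi (r, x) + dev x r)) has_real_derivative lapPhi (t, x) + dev x t) (at t within {t - 1..t + 1})"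
    by (rule integral_has_real_derivative[OF c]) auto
  then have "((\<lambda>u. integral {t - 1..u} (\<lambda>r. lapPhi (r, x) + dev x r)) has_real_derivative lapPhi (t, x) + dev x t) (at t)"
    by (subst (asm) at_within_interior) auto
  then have "((\<lambda>u. Phi (t - 1, x) + integral {t - 1..u} (\<lambda>r. lapPhi (r, x) + dev x r)) has_real_derivative 0 + (lapPhi (t, x) + dev x t)) (at t)"
    by (intro DERIV_add DERIV_const)
  then have "((\<lambda>t. Phi (t, x)) has_real_derivative 0 + (lapPhi (t, x) + dev x t)) (at t)"
  proof (rule has_field_derivative_transform_within_open[where S="{t - 1<..}"])
    fix u assume "u \<in> {t - 1<..}"
    then have "t - 1 \<le> u" by simp
    from integral_unique[OF Phi_increment[OF this]]
    show "Phi (t - 1, x) + integral {t - 1..u} (\<lambda>r. lapPhi (r, x) + dev x r) = Phi (u, x)" by simp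
  qed auto
  then show ?thesis by simp
qed

end

section \<open>Periodic solutions and uniqueness of the eigenvalue\<close>

lemma C12perD:
  assumes "C12per T f"
  shows "f (t + T) x = f t x" "per_space (f t)" "continuous_on UNIV (\<lambda>p. f (fst p) (snd p))"
    "(\<lambda>s. f s x) differentiable (at t)" "continuous_on UNIV (\<lambda>p. dt f (fst p) (snd p))"
    "pdiff i (f t) x" "continuous_on UNIV (\<lambda>p. pd i (f (fst p)) (snd p))"
    "pdiff j (pd i (f t)) x" "continuous_on UNIV (\<lambda>p. pd j (pd i (f (fst p))) (snd p))"
  using assms unfolding C12per_def by blast+

lemma pdI:
  assumes "((\<lambda>h. g (x + h *\<^sub>R axis i 1)) has_real_derivative D) (at 0)"
  shows "pdiff i g x" "pd i g x = D"
  using assms by (auto simp: pdiff_def pd_def real_differentiable_def intro: DERIV_imp_deriv)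

lemma pd_has_derivative:
  assumes "\<And>x. pdiff i g x"
  shows "((\<lambda>h. g (x + h *\<^sub>R axis i 1)) has_real_derivative pd i g (x + h *\<^sub>R axis i 1)) (at h)"
proof -
  have "((\<lambda>k. g ((x + h *\<^sub>R axis i 1) + k *\<^sub>R axis i 1)) has_real_derivative pd i g (x + h *\<^sub>R axis i 1)) (at (h - h))"
    using assms[of "x + h *\<^sub>R axis i 1"] unfolding pdiff_def pd_def
    by (auto simp: real_differentiable_def DERIV_imp_deriv)
  moreover have "((\<lambda>k. k - h) has_real_derivative 1) (at h)" by (auto intro!: derivative_eq_intros)
  ultimately have "((\<lambda>k. g ((x + h *\<^sub>R axis i 1) + (k - h) *\<^sub>R axis i 1)) has_real_derivative pd i g (x + h *\<^sub>R axis i 1) * 1) (at h)"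
    by (rule DERIV_chain2)
  then show ?thesis by (simp add: algebra_simps)
qed

lemma dt_has_derivative:
  assumes "C12per T f"
  shows "((\<lambda>s. f s x) has_real_derivative dt f t x) (at t)"
  using C12perD(4)[OF assms, of x t] unfolding dt_def by (auto simp: real_differentiable_def DERIV_imp_deriv)

text \<open>Serves for the difference of two eigenfunctions (\<open>c = -1\<close>) and for the
  correction of \<open>\<psi>0\<close> by the solution of the linear problem
  (\<open>c = - \<epsilon>\<close>).\<close>

lemma C12per_combination:
  assumes a: "C12per T a" and b: "C12per T b"
  shows "C12per T (\<lambda>t x. a t x + c * b t x)"
    and "dt (\<lambda>t x. a t x + c * b t x) t x = dt a t x + c * dt b t x"
    and "pd i (\<lambda>x. a t x + c * b t x) x = pd i (a t) x + c * pd i (b t) x"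
    and "lap (\<lambda>x. a t x + c * b t x) x = lap (a t) x + c * lap (b t) x"
proof -
  note A = C12perD[OF a] and B = C12perD[OF b]
  let ?f = "\<lambda>t x. a t x + c * b t x"
  have d: "((\<lambda>s. ?f s x) has_real_derivative dt a t x + c * dt b t x) (at t)" for t x
    by (intro DERIV_add DERIV_cmult dt_has_derivative[OF a] dt_has_derivative[OF b])
  then show dt: "dt ?f t x = dt a t x + c * dt b t x" for t x
    unfolding dt_def[of ?f] by (rule DERIV_imp_deriv)
  have p: "((\<lambda>h. ?f t (x + h *\<^sub>R axis i 1)) has_real_derivative
      pd i (a t) (x + 0 *\<^sub>R axis i 1) + c * pd i (b t) (x + 0 *\<^sub>R axis i 1)) (at 0)" for t x i
    by (intro DERIV_add DERIV_cmult pd_has_derivative A B)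
  have pd: "pd i (?f t) = (\<lambda>x. pd i (a t) x + c * pd i (b t) x)" for t i
    using pdI(2)[OF p] by (auto simp: fun_eq_iff)
  then show "pd i (?f t) x = pd i (a t) x + c * pd i (b t) x" for i t x by simp
  have q: "((\<lambda>h. (\<lambda>x. pd i (a t) x + c * pd i (b t) x) (x + h *\<^sub>R axis j 1)) has_real_derivative
      pd j (pd i (a t)) (x + 0 *\<^sub>R axis j 1) + c * pd j (pd i (b t)) (x + 0 *\<^sub>R axis j 1)) (at 0)" for t x i j
    by (intro DERIV_add DERIV_cmult pd_has_derivative A B)
  have pd2: "pd j (pd i (?f t)) x = pd j (pd i (a t)) x + c * pd j (pd i (b t)) x" for t i j x
    unfolding pd using pdI(2)[OF q] by simp
  then show "lap (?f t) x = lap (a t) x + c * lap (b t) x" for t x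
    by (simp add: lap_def sum.distrib sum_distrib_left)
  show "C12per T ?f"
    unfolding C12per_def
  proof (intro conjI allI)
    show "a (t + T) x + c * b (t + T) x = a t x + c * b t x" for t x using A(1) B(1) by simp
    show "per_space (?f t)" for t using A(2)[of t] B(2)[of t] by (simp add: per_space_def)
    show "continuous_on UNIV (\<lambda>p. ?f (fst p) (snd p))" by (intro continuous_intros A B)
    show "(\<lambda>s. ?f s x) differentiable at t" for t x using d unfolding real_differentiable_def by blast
    show "continuous_on UNIV (\<lambda>p. dt ?f (fst p) (snd p))" unfolding dt by (intro continuous_intros A B)
    show "pdiff i (?f t) x" for i t x by (rule pdI(1)[OF p])
    show "continuous_on UNIV (\<lambda>p. pd i (?f (fst p)) (snd p))" for i unfolding pd by (intro continuous_intros A B)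
    show "pdiff j (pd i (?f t)) x" for i j t x unfolding pd by (rule pdI(1)[OF q])
    show "continuous_on UNIV (\<lambda>p. pd j (pd i (?f (fst p))) (snd p))" for i j unfolding pd2 by (intro continuous_intros A B)
  qed
qed

section \<open>Lipschitz bounds from partial derivatives\<close>

text \<open>Only partial derivatives are at hand, so the way from \<open>x\<close> to
  \<open>y\<close> is taken one coordinate at a time. The path stays within the l1 distance of
  \<open>x\<close>, the region in which \<open>K\<close> is asked for.\<close>

lemma coordinate_lipschitz:
  fixes u :: "real^'n::finite \<Rightarrow> real"
  assumes diff: "\<And>i x. pdiff i u x"
    and K: "\<And>z i. norm (z - x) \<le> (\<Sum>j\<in>UNIV. \<bar>y $ j - x $ j\<bar>) \<Longrightarrow> \<bar>pd i u z\<bar> \<le> K"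
  shows "\<bar>u y - u x\<bar> \<le> K * (\<Sum>j\<in>UNIV. \<bar>y $ j - x $ j\<bar>)"
proof -
  let ?v = "\<lambda>j. y $ j - x $ j"
  \<comment> \<open>The point reached from \<open>x\<close> after the coordinates in
    \<open>I\<close> have been moved to those of \<open>y\<close>.\<close>
  let ?z = "\<lambda>I. x + (\<Sum>j\<in>I. ?v j *\<^sub>R axis j 1)"
  have nz: "norm (?z I + s *\<^sub>R axis i 1 - x) \<le> (\<Sum>j\<in>UNIV. \<bar>?v j\<bar>)" if "i \<notin> I" "\<bar>s\<bar> \<le> \<bar>?v i\<bar>" for I i s
  proof -
    have "norm (?z I + s *\<^sub>R axis i 1 - x) \<le> norm (\<Sum>j\<in>I. ?v j *\<^sub>R axis j 1 :: real^'n) + norm (s *\<^sub>R axis i 1 :: real^'n)"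
      using norm_triangle_ineq[of "\<Sum>j\<in>I. ?v j *\<^sub>R axis j 1 :: real^'n" "s *\<^sub>R axis i 1"] by (simp add: algebra_simps)
    also have "\<dots> \<le> (\<Sum>j\<in>I. \<bar>?v j\<bar>) + \<bar>?v i\<bar>"
      using that by (intro add_mono sum_norm_le) auto
    also have "\<dots> = (\<Sum>j\<in>insert i I. \<bar>?v j\<bar>)" using that by simp
    also have "\<dots> \<le> (\<Sum>j\<in>UNIV. \<bar>?v j\<bar>)" by (intro sum_mono2) auto
    finally show ?thesis .
  qed
  have "\<bar>u (?z I) - u x\<bar> \<le> K * (\<Sum>j\<in>I. \<bar>?v j\<bar>)" if "finite I" for I
    using that
  proof (induction I)
    case (insert i I)
    let ?S = "{- \<bar>?v i\<bar>..\<bar>?v i\<bar>}"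
    have "norm (u (?z I + ?v i *\<^sub>R axis i 1) - u (?z I + 0 *\<^sub>R axis i 1)) \<le> K * norm (?v i - 0)"
    proof (rule field_differentiable_bound[where S="?S" and f'="\<lambda>h. pd i u (?z I + h *\<^sub>R axis i 1)"])
      fix s assume "s \<in> ?S"
      then have s: "\<bar>s\<bar> \<le> \<bar>?v i\<bar>" by (simp add: abs_le_iff)
      show "((\<lambda>h. u (?z I + h *\<^sub>R axis i 1)) has_field_derivative pd i u (?z I + s *\<^sub>R axis i 1)) (at s within ?S)"
        by (rule has_field_derivative_at_within[OF pd_has_derivative[OF diff]])
      show "norm (pd i u (?z I + s *\<^sub>R axis i 1)) \<le> K"
        using K[OF nz[OF insert(2) s]] by simp
    qed auto
    then have "\<bar>u (?z (insert i I)) - u (?z I)\<bar> \<le> K * \<bar>?v i\<bar>" using insert by (simp add: algebra_simps)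
    then show ?case using insert by (simp add: algebra_simps)
  qed simp
  from this[of UNIV] have "\<bar>u (?z UNIV) - u x\<bar> \<le> K * (\<Sum>j\<in>UNIV. \<bar>?v j\<bar>)" by simp
  moreover have "?z UNIV = y"
    by (simp add: vec_eq_iff axis_def if_distrib cong: if_cong)
  ultimately show ?thesis by simp
qed

lemma sum_abs_le_norm:
  fixes v :: "real^'n::finite"
  shows "(\<Sum>j\<in>UNIV. \<bar>v $ j\<bar>) \<le> real CARD('n) * norm v"
  using sum_bounded_above[of UNIV "\<lambda>j. \<bar>v $ j\<bar>" "norm v"] component_le_norm_cart[of v] by simp

lemma norm_vec_le:
  fixes v :: "real^'n::finite"
  assumes "\<And>i. \<bar>v $ i\<bar> \<le> K"
  shows "norm v \<le> real CARD('n) * K"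
  using order_trans[OF norm_le_l1_cart sum_bounded_above[of UNIV "\<lambda>j. \<bar>v $ j\<bar>" K]] assms by simp

lemma lipschitz_pd_bounded:
  fixes u :: "real^'n::finite \<Rightarrow> real"
  assumes "\<And>i x. pdiff i u x" "\<And>i x. \<bar>pd i u x\<bar> \<le> K"
  shows "\<bar>u x - u y\<bar> \<le> K * real CARD('n) * norm (x - y)"
proof -
  have "K \<ge> 0" using assms(2)[of undefined 0] by linarith
  have "\<bar>u x - u y\<bar> \<le> K * (\<Sum>j\<in>UNIV. \<bar>x $ j - y $ j\<bar>)" by (rule coordinate_lipschitz[OF assms])
  also have "\<dots> \<le> K * (real CARD('n) * norm (x - y))"
    using sum_abs_le_norm[of "x - y"] \<open>K \<ge> 0\<close> by (intro mult_left_mono) auto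
  finally show ?thesis by simp
qed

lemma C2_locally_lipschitz:
  fixes H :: "real^'n::finite \<Rightarrow> real"
  assumes "C2 H"
  obtains K where "K \<ge> 0" "\<And>p q. norm p \<le> R \<Longrightarrow> norm q \<le> R \<Longrightarrow> \<bar>H p - H q\<bar> \<le> K * norm (p - q)"
proof -
  \<comment> \<open>The coordinate path between two points of the ball of radius \<open>R\<close>
    may leave that ball, by at most its l1 length; the derivatives are therefore bounded on a larger
    ball.\<close>
  define R' where "R' = \<bar>R\<bar> + real CARD('n) * (2 * \<bar>R\<bar>)"
  have "\<exists>K. \<forall>z\<in>cball 0 R'. \<bar>pd i H z\<bar> \<le> K" for i
  proof -
    have "continuous_on (cball 0 R') (pd i H)" using assms by (auto simp: C2_def intro: continuous_on_subset)
    then have "bounded (pd i H ` cball 0 R')" by (intro compact_imp_bounded compact_continuous_image) auto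
    then show ?thesis by (auto simp: bounded_iff)
  qed
  then obtain k where k: "\<And>i z. z \<in> cball 0 R' \<Longrightarrow> \<bar>pd i H z\<bar> \<le> k i" by metis
  define K where "K = (\<Sum>i\<in>UNIV. \<bar>k i\<bar>)"
  have K: "\<bar>pd i H z\<bar> \<le> K" if "z \<in> cball 0 R'" for i z
    using k[OF that, of i] member_le_sum[of i UNIV "\<lambda>i. \<bar>k i\<bar>"] unfolding K_def by (simp add: abs_le_iff)
  have K0: "K \<ge> 0" unfolding K_def by (intro sum_nonneg) auto
  have "\<bar>H p - H q\<bar> \<le> K * real CARD('n) * norm (p - q)" if "norm p \<le> R" "norm q \<le> R" for p q
  proof -
    have s: "(\<Sum>j\<in>UNIV. \<bar>p $ j - q $ j\<bar>) \<le> real CARD('n) * norm (p - q)"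
      using sum_abs_le_norm[of "p - q"] by simp
    have "norm (p - q) \<le> 2 * \<bar>R\<bar>" using norm_triangle_ineq4[of p q] that by linarith
    then have s2: "(\<Sum>j\<in>UNIV. \<bar>p $ j - q $ j\<bar>) \<le> real CARD('n) * (2 * \<bar>R\<bar>)"
      using s mult_left_mono[of "norm (p - q)" "2 * \<bar>R\<bar>" "real CARD('n)"] by linarith
    have "\<bar>H p - H q\<bar> \<le> K * (\<Sum>j\<in>UNIV. \<bar>p $ j - q $ j\<bar>)"
    proof (rule coordinate_lipschitz)
      show "pdiff i H x" for i x using assms by (simp add: C2_def)
      fix z i assume "norm (z - q) \<le> (\<Sum>j\<in>UNIV. \<bar>p $ j - q $ j\<bar>)"
      then have "norm z \<le> R'" using s2 that(2) norm_triangle_ineq[of "z - q" q] unfolding R'_def by simp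
      then show "\<bar>pd i H z\<bar> \<le> K" by (intro K) simp
    qed
    also have "\<dots> \<le> K * (real CARD('n) * norm (p - q))" by (intro mult_left_mono s K0)
    finally show ?thesis by simp
  qed
  then show ?thesis using that[of "K * real CARD('n)"] K0 by simp
qed

section \<open>Maximum principle and uniqueness of the eigenvalue\<close>

lemma time_periodic_int:
  fixes u :: "real \<Rightarrow> 'a"
  assumes "\<And>t. u (t + T) = u t"
  shows "u (t + of_int k * T) = u t"
proof -
  have n: "u (t + real n * T) = u t" for n t
  proof (induction n)
    case (Suc n)
    have "u (t + real (Suc n) * T) = u ((t + real n * T) + T)" by (simp add: algebra_simps)
    then show ?case using assms Suc by simp
  qed simp
  show ?thesis
  proof (cases "k \<ge> 0")
    case True
    then show ?thesis using n[of t "nat k"] by simp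
  next
    case False
    then show ?thesis using n[of "t + of_int k * T" "nat (- k)"] by simp
  qed
qed

lemma periodic_attains_max:
  fixes u :: "real \<Rightarrow> real^'n::finite \<Rightarrow> real"
  assumes T: "T > 0" and c: "continuous_on UNIV (\<lambda>p. u (fst p) (snd p))"
    and pt: "\<And>t x. u (t + T) x = u t x" and px: "\<And>t. per_space (u t)"
  obtains t0 x0 where "\<And>t x. u t x \<le> u t0 x0"
proof -
  let ?S = "{0..T} \<times> cbox 0 (1::real^'n)"
  have "0 \<in> cbox 0 (1::real^'n)" by (simp add: mem_box_cart)
  then have "compact ?S" "?S \<noteq> {}" using T by (auto intro!: compact_Times)
  from continuous_attains_sup[OF this continuous_on_subset[OF c]]
  obtain p where "\<forall>q\<in>?S. u (fst q) (snd q) \<le> u (fst p) (snd p)" by blast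
  then have p: "\<And>q. q \<in> ?S \<Longrightarrow> u (fst q) (snd q) \<le> u (fst p) (snd p)" by blast
  have "u t x \<le> u (fst p) (snd p)" for t x
  proof -
    obtain z where z: "z \<in> cbox 0 1" "\<And>h. per_space h \<Longrightarrow> h x = h z" using per_space_reduce[of x] by blast
    define k where "k = \<lfloor>t / T\<rfloor>"
    have "of_int k \<le> t / T" "t / T < of_int k + 1" unfolding k_def by linarith+
    then have "of_int k * T \<le> t" "t \<le> (of_int k + 1) * T" using T by (auto simp: field_simps)
    then have "(t - of_int k * T, z) \<in> ?S" using z by (simp add: algebra_simps)
    from p[OF this] have "u (t - of_int k * T) z \<le> u (fst p) (snd p)" by simp
    moreover have "u (t - of_int k * T) = u t"
      using time_periodic_int[of u T t "- k"] pt by (simp add: fun_eq_iff)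
    ultimately show ?thesis using z(2)[OF px] by simp
  qed
  then show ?thesis by (rule that)
qed

lemma periodic_bounded:
  fixes u :: "real \<Rightarrow> real^'n::finite \<Rightarrow> real"
  assumes T: "T > 0" and c: "continuous_on UNIV (\<lambda>p. u (fst p) (snd p))"
    and pt: "\<And>t x. u (t + T) x = u t x" and px: "\<And>t. per_space (u t)"
  obtains K where "\<And>t x. \<bar>u t x\<bar> \<le> K"
proof -
  obtain t0 x0 where 1: "\<And>t x. u t x \<le> u t0 x0"
    using periodic_attains_max[OF T c pt px] by blast
  have "continuous_on UNIV (\<lambda>p. - u (fst p) (snd p))" by (intro continuous_intros c)
  moreover have "per_space (\<lambda>x. - u t x)" for t using px[of t] by (simp add: per_space_def)
  ultimately obtain t1 x1 where 2: "\<And>t x. - u t x \<le> - u t1 x1"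
    using periodic_attains_max[OF T, of "\<lambda>t x. - u t x"] pt by auto
  have "\<bar>u t x\<bar> \<le> \<bar>u t0 x0\<bar> + \<bar>u t1 x1\<bar>" for t x using 1[of t x] 2[of t x] by linarith
  then show ?thesis by (rule that)
qed

text \<open>If \<open>D\<close> were positive, \<open>v'\<close> would be positive just to the right
  of 0, and the mean value theorem would give a larger value of \<open>v\<close> there.\<close>

lemma second_derivative_nonpos_at_max:
  fixes v v' :: "real \<Rightarrow> real"
  assumes v: "\<And>h. (v has_real_derivative v' h) (at h)" and v': "(v' has_real_derivative D) (at 0)"
    and max: "\<And>h. v h \<le> v 0"
  shows "v' 0 = 0" "D \<le> 0"
proof -
  show z: "v' 0 = 0" using DERIV_local_max[OF v[of 0], of 1] max by simp
  show "D \<le> 0"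
  proof (rule ccontr)
    assume "\<not> D \<le> 0"
    then obtain d where d: "d > 0" "\<And>h. 0 < h \<Longrightarrow> h < d \<Longrightarrow> v' 0 < v' (0 + h)"
      using DERIV_pos_inc_right[OF v'] by auto
    have "0 < d / 2" using d(1) by simp
    from MVT2[OF this v] obtain h where h: "0 < h" "h < d / 2" "v (d / 2) - v 0 = (d / 2 - 0) * v' h" by blast
    have "v' h > 0" using d(2)[of h] h z d(1) by simp
    then have "(d / 2 - 0) * v' h > 0" using d(1) by simp
    then have "v (d / 2) > v 0" using h(3) by simp
    then show False using max[of "d / 2"] by simp
  qed
qed

text \<open>At a maximum of \<open>\<phi>1 - \<phi>2\<close> the time derivatives and the gradients
  agree, so the terms in \<open>H\<close> cancel, while the Laplacians are ordered; subtracting the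
  equations orders \<open>l1\<close> and \<open>l2\<close>.\<close>

lemma eigenvalue_le:
  fixes \<phi>1 \<phi>2 m :: "real \<Rightarrow> real^'n::finite \<Rightarrow> real"
  assumes T: "T > 0" and c1: "C12per T \<phi>1" and c2: "C12per T \<phi>2"
    and e1: "\<And>t x. l1 + dt \<phi>1 t x - lap (\<phi>1 t) x + \<epsilon> * H (grad (\<phi>1 t) x) = - m t x"
    and e2: "\<And>t x. l2 + dt \<phi>2 t x - lap (\<phi>2 t) x + \<epsilon> * H (grad (\<phi>2 t) x) = - m t x"
  shows "l1 \<le> l2"
proof -
  define u where "u = (\<lambda>t x. \<phi>1 t x + (-1) * \<phi>2 t x)"
  note C = C12per_combination[OF c1 c2, where c="-1", folded u_def]
  note D = C12perD[OF C(1)]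
  obtain t0 x0 where max: "\<And>t x. u t x \<le> u t0 x0"
    using periodic_attains_max[OF T D(3) D(1) D(2)] by blast
  have "dt u t0 x0 = 0"
    using DERIV_local_max[OF dt_has_derivative[OF C(1)], where d=1] max by auto
  then have dt: "dt \<phi>1 t0 x0 = dt \<phi>2 t0 x0" using C(2) unfolding u_def by simp
  have s: "pd i (u t0) x0 = 0 \<and> pd i (pd i (u t0)) x0 \<le> 0" for i
  proof -
    have a: "((\<lambda>h. u t0 (x0 + h *\<^sub>R axis i 1)) has_real_derivative pd i (u t0) (x0 + h *\<^sub>R axis i 1)) (at h)" for h
      by (rule pd_has_derivative[OF D(6)])
    have b: "((\<lambda>h. pd i (u t0) (x0 + h *\<^sub>R axis i 1)) has_real_derivative pd i (pd i (u t0)) (x0 + 0 *\<^sub>R axis i 1)) (at 0)"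
      by (rule pd_has_derivative[OF D(8)])
    show ?thesis using second_derivative_nonpos_at_max[OF a b] max by simp
  qed
  have "grad (\<phi>1 t0) x0 = grad (\<phi>2 t0) x0"
    using s C(3)[where t=t0 and x=x0] unfolding u_def by (simp add: grad_def vec_eq_iff)
  moreover have "lap (u t0) x0 \<le> 0" unfolding lap_def using s by (intro sum_nonpos) auto
  then have "lap (\<phi>1 t0) x0 \<le> lap (\<phi>2 t0) x0" using C(4)[where t=t0 and x=x0] unfolding u_def by simp
  ultimately show ?thesis using e1[of t0 x0] e2[of t0 x0] dt by simp
qed

lemma eigenvalue_eqI:
  fixes \<phi> m :: "real \<Rightarrow> real^'n::finite \<Rightarrow> real"
  assumes T: "T > 0" and c: "C12per T \<phi>"
    and e: "\<And>t x. l + dt \<phi> t x - lap (\<phi> t) x + \<epsilon> * H (grad (\<phi> t) x) = - m t x"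
  shows "eigenvalue T H m \<epsilon> = l"
  unfolding eigenvalue_def
proof (rule the_equality)
  show "\<exists>\<phi>. C12per T \<phi> \<and> (\<forall>t x. l + dt \<phi> t x - lap (\<phi> t) x + \<epsilon> * H (grad (\<phi> t) x) = - m t x)"
    using c e by blast
  fix l' assume "\<exists>\<phi>. C12per T \<phi> \<and> (\<forall>t x. l' + dt \<phi> t x - lap (\<phi> t) x + \<epsilon> * H (grad (\<phi> t) x) = - m t x)"
  then obtain \<phi>' where "C12per T \<phi>'" "\<And>t x. l' + dt \<phi>' t x - lap (\<phi>' t) x + \<epsilon> * H (grad (\<phi>' t) x) = - m t x" by blast
  then show "l' = l" using eigenvalue_le[OF T _ c _ e] eigenvalue_le[OF T c _ e] by (metis order_antisym)
qed

section \<open>Periodic solutions of the linear problem\<close>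

lemma ex_antiderivative:
  fixes k :: "real \<Rightarrow> real"
  assumes k: "continuous_on UNIV k"
  obtains F where "\<And>t. (F has_real_derivative k t) (at t)"
proof
  fix t
  \<comment> \<open>The oriented integral from 0 covers negative \<open>u\<close> as well.\<close>
  have "((\<lambda>u. LBINT y=0..u. k y) has_vector_derivative k t) (at t within {- \<bar>t\<bar> - 1..\<bar>t\<bar> + 1})"
    using interval_integral_FTC2[of "- \<bar>t\<bar> - 1" 0 "\<bar>t\<bar> + 1" k t] continuous_on_subset[OF k] by (auto simp: zero_ereal_def)
  moreover have "at t within {- \<bar>t\<bar> - 1..\<bar>t\<bar> + 1} = at t"
    by (rule at_within_interior) (auto simp: abs_if)
  ultimately show "((\<lambda>u. LBINT y=0..u. k y) has_real_derivative k t) (at t)"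
    by (simp add: has_real_derivative_iff_has_vector_derivative)
qed

text \<open>\<open>Phi\<close> solves the equation with the source reduced by its spatial mean at
  each time. The function \<open>h\<close> of time restores that mean up to \<open>\<mu>\<close>; it
  is periodic because its derivative has integral 0 over a period.\<close>

lemma (in source) linear_solution:
  assumes T: "T > 0" and ft: "\<And>t x. f (t + T) x = f t x"
  obtains w where "C12per T w" "\<And>t x. dt w t x - lap (w t) x = f t x - cyl_int T f / T"
    "\<And>t x. grad (w t) x = (\<chi> i. G i (t, x))"
proof -
  define \<mu> where "\<mu> = cyl_int T f / T"
  have mean_cont: "continuous_on UNIV (\<lambda>t. torus_int (f t) - \<mu>)" by (intro continuous_intros cont_mean)
  obtain h where h: "\<And>t. (h has_real_derivative torus_int (f t) - \<mu>) (at t)" using ex_antiderivative[OF mean_cont] by blast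
  have "((\<lambda>t. torus_int (f t) - \<mu>) has_integral h T - h 0) {0..T}"
    using T h by (intro fundamental_theorem_of_calculus)
      (auto simp: has_real_derivative_iff_has_vector_derivative[symmetric] intro: has_field_derivative_at_within)
  moreover have "((\<lambda>t. torus_int (f t) - \<mu>) has_integral cyl_int T f - \<mu> * T) {0..T}"
  proof -
    have "cyl_int T f = integral (cbox 0 T) (\<lambda>t. integral (cbox 0 1) (\<lambda>x. f t x))"
      unfolding cyl_int_def
      using integral_prod_continuous[of 0 0 T 1 "\<lambda>p. f (fst p) (snd p)"] continuous_on_subset[OF cont] by simp
    then have "cyl_int T f = integral {0..T} (\<lambda>t. torus_int (f t))" by (simp add: torus_int_def)
    moreover have "(\<lambda>t. torus_int (f t)) integrable_on {0..T}"
      by (intro integrable_continuous_real continuous_on_subset[OF cont_mean]) auto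
    ultimately have "((\<lambda>t. torus_int (f t)) has_integral cyl_int T f) {0..T}" by (simp add: has_integral_integral)
    moreover have "((\<lambda>t. \<mu>) has_integral \<mu> * T) {0..T}" using has_integral_const_real[of \<mu> 0 T] T by (simp add: mult.commute)
    ultimately show ?thesis by (rule has_integral_diff)
  qed
  ultimately have "h T - h 0 = cyl_int T f - \<mu> * T" by (rule has_integral_unique)
  then have hT: "h T = h 0" using T by (simp add: \<mu>_def)
  have "((\<lambda>t. h (t + T) - h t) has_real_derivative 0) (at t)" for t
  proof -
    have "f (t + T) = f t" using ft by (simp add: fun_eq_iff)
    moreover have "((\<lambda>t. h (t + T)) has_real_derivative torus_int (f (t + T)) - \<mu>) (at t)"
      using h[of "t + T"] by (simp add: DERIV_shift)
    ultimately show ?thesis using DERIV_diff[of "\<lambda>t. h (t + T)" _ t UNIV h] h[of t] by fastforce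
  qed
  then have "h (t + T) - h t = h (0 + T) - h 0" for t by (intro DERIV_isconst_all) auto
  then have hper: "h (t + T) = h t" for t using hT by simp
  define w where "w t x = Phi (t, x) + h t" for t x
  have dw: "((\<lambda>s. w s x) has_real_derivative lapPhi (t, x) + dev x t + (torus_int (f t) - \<mu>)) (at t)" for t x
    unfolding w_def by (intro DERIV_add Phi_deriv_time h)
  have dtw: "dt w t x = lapPhi (t, x) + (f t x - \<mu>)" for t x
    using DERIV_imp_deriv[OF dw[of x t]] by (simp add: dt_def dev_def)
  have p: "((\<lambda>k. w t (x + k *\<^sub>R axis i 1)) has_real_derivative G i (t, x + 0 *\<^sub>R axis i 1) + 0) (at 0)" for t x i
    unfolding w_def by (intro DERIV_add Phi_deriv DERIV_const)
  have pdw: "pd i (w t) = (\<lambda>x. G i (t, x))" for i t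
    using pdI(2)[OF p] by (auto simp: fun_eq_iff)
  have q: "((\<lambda>k. (\<lambda>x. G i (t, x)) (x + k *\<^sub>R axis j 1)) has_real_derivative GG i j (t, x + 0 *\<^sub>R axis j 1)) (at 0)" for t x i j
    by (rule G_deriv)
  have pd2w: "pd j (pd i (w t)) x = GG i j (t, x)" for i j t x
    unfolding pdw using pdI(2)[OF q] by simp
  have hc: "continuous_on UNIV (\<lambda>p::real \<times> (real^'n). h (fst p))"
  proof -
    have "continuous_on UNIV h" using h DERIV_isCont by (auto intro!: continuous_at_imp_continuous_on)
    then show ?thesis by (rule continuous_on_compose2) (auto intro!: continuous_intros)
  qed
  have "C12per T w"
    unfolding C12per_def
  proof (intro conjI allI)
    show "w (t + T) x = w t x" for t x using per_time(1)[of T t x, OF ft] hper by (simp add: w_def)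
    show "per_space (w t)" for t using per_Phi by (simp add: w_def per_space_def)
    show "continuous_on UNIV (\<lambda>p. w (fst p) (snd p))"
      unfolding w_def using continuous_on_add[OF Phi_cont hc] by simp
    show "(\<lambda>s. w s x) differentiable at t" for t x using dw unfolding real_differentiable_def by blast
    show "continuous_on UNIV (\<lambda>p. dt w (fst p) (snd p))"
      unfolding dtw using continuous_on_add[OF lapPhi_cont continuous_on_diff[OF cont continuous_on_const[of _ \<mu>]]] by simp
    show "pdiff i (w t) x" for i t x by (rule pdI(1)[OF p])
    show "continuous_on UNIV (\<lambda>p. pd i (w (fst p)) (snd p))" for i unfolding pdw using G_cont by simp
    show "pdiff j (pd i (w t)) x" for i j t x unfolding pdw by (rule pdI(1)[OF q])
    show "continuous_on UNIV (\<lambda>p. pd j (pd i (w (fst p))) (snd p))" for i j unfolding pd2w using GG_cont by simp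
  qed
  moreover have "dt w t x - lap (w t) x = f t x - cyl_int T f / T" for t x
    unfolding dtw lap_def pd2w by (simp add: lapPhi_def \<mu>_def)
  moreover have "grad (w t) x = (\<chi> i. G i (t, x))" for t x by (simp add: grad_def pdw)
  ultimately show ?thesis by (rule that)
qed

section \<open>Nonlinear fixed point and the expansion of the eigenvalue\<close>

text \<open>One factor \<open>CARD('n)\<close> passes from components to the norm, the other from
  partial derivatives to a Lipschitz bound; the 2 comes from the oscillation \<open>2 * M\<close> of
  a function bounded by \<open>M\<close>. A single constant thus serves size, Lipschitz bound and
  differences.\<close>

definition grad_const :: "'n::finite itself \<Rightarrow> real" where
  "grad_const _ = real CARD('n) * (real CARD('n) * (2 * decay_const TYPE('n) * weight_int))"

lemma grad_const_nonneg: "grad_const TYPE('n::finite) \<ge> 0"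
  unfolding grad_const_def using decay_const_pos[where 'n='n] weight_int_nonneg by simp

text \<open>A total function of \<open>f\<close>, outside the locale, so that it can enter the
  definition of the iteration map before its argument is known to be a
  \<open>source\<close>.\<close>

definition grad_potential :: "(real \<Rightarrow> real^'n::finite \<Rightarrow> real) \<Rightarrow> real \<times> (real^'n) \<Rightarrow> real^'n" where
  "grad_potential f p = (\<chi> i. source.G f i p)"

lemma card_mult_le: "a \<ge> 0 \<Longrightarrow> a \<le> real CARD('n::finite) * a"
  using mult_right_mono[of 1 "real CARD('n)" a] by (simp add: Suc_leI)

lemma grad_potential_bound:
  fixes f :: "real \<Rightarrow> real^'n::finite \<Rightarrow> real"
  assumes "source f M L"
  shows "norm (grad_potential f p) \<le> grad_const TYPE('n) * M"
proof -
  interpret source f M L by fact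
  have "norm (grad_potential f p) \<le> real CARD('n) * (2 * decay_const TYPE('n) * weight_int * M)"
    by (rule norm_vec_le) (simp add: grad_potential_def G_bound)
  also have "\<dots> \<le> real CARD('n) * (real CARD('n) * (2 * decay_const TYPE('n) * weight_int * M))"
    using decay_const_pos[where 'n='n] weight_int_nonneg M0 by (intro mult_left_mono card_mult_le) auto
  finally show ?thesis by (simp add: grad_const_def)
qed

lemma grad_potential_lipschitz:
  fixes f :: "real \<Rightarrow> real^'n::finite \<Rightarrow> real"
  assumes "source f M L"
  shows "norm (grad_potential f (t, x) - grad_potential f (t, y)) \<le> grad_const TYPE('n) * (L + 2 * M) * norm (x - y)"
proof -
  interpret source f M L by fact
  have "\<bar>G i (t, x) - G i (t, y)\<bar> \<le> decay_const TYPE('n) * (L + 2 * M) * weight_int * real CARD('n) * norm (x - y)" for i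
  proof (rule lipschitz_pd_bounded[where u="\<lambda>x. G i (t, x)"])
    fix j x
    have d: "((\<lambda>h. G i (t, x + h *\<^sub>R axis j 1)) has_real_derivative GG i j (t, x + 0 *\<^sub>R axis j 1)) (at 0)"
      by (rule G_deriv)
    show "pdiff j (\<lambda>x. G i (t, x)) x" by (rule pdI(1)[OF d])
    have "pd j (\<lambda>x. G i (t, x)) x = GG i j (t, x)" using pdI(2)[OF d] by simp
    then show "\<bar>pd j (\<lambda>x. G i (t, x)) x\<bar> \<le> decay_const TYPE('n) * (L + 2 * M) * weight_int" using GG_bound by simp
  qed
  then have "norm (grad_potential f (t, x) - grad_potential f (t, y)) \<le> real CARD('n) * (decay_const TYPE('n) * (L + 2 * M) * weight_int * real CARD('n) * norm (x - y))"
    by (intro norm_vec_le) (simp add: grad_potential_def)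
  also have "\<dots> \<le> 2 * (real CARD('n) * (decay_const TYPE('n) * (L + 2 * M) * weight_int * real CARD('n) * norm (x - y)))"
    using decay_const_pos[where 'n='n] weight_int_nonneg M0 L0 by simp
  finally show ?thesis by (simp add: grad_const_def algebra_simps)
qed

text \<open>By linearity the difference is the gradient potential of \<open>f1 - f2\<close>, again a
  source, whose size is governed by \<open>\<delta>\<close>.\<close>

lemma grad_potential_diff_bound:
  fixes f1 f2 :: "real \<Rightarrow> real^'n::finite \<Rightarrow> real"
  assumes s1: "source f1 M L" and s2: "source f2 M L" and d: "\<And>t x. \<bar>f1 t x - f2 t x\<bar> \<le> \<delta>"
  shows "norm (grad_potential f1 p - grad_potential f2 p) \<le> grad_const TYPE('n) * \<delta>"
proof -
  interpret S1: source f1 M L by fact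
  interpret S2: source f2 M L by fact
  let ?f = "\<lambda>t x. f1 t x - f2 t x"
  interpret D: source ?f \<delta> "2 * L"
  proof
    show "continuous_on UNIV (\<lambda>p. f1 (fst p) (snd p) - f2 (fst p) (snd p))"
      by (intro continuous_on_diff S1.cont S2.cont)
    show "per_space (\<lambda>x. f1 t x - f2 t x)" for t
      using S1.per[of t] S2.per[of t] by (simp add: per_space_def)
    show "\<bar>f1 t x - f2 t x - (f1 t y - f2 t y)\<bar> \<le> 2 * L * norm (x - y)" for t x y
      using S1.lip[of t x y] S2.lip[of t x y] by linarith
  qed (use d S1.L0 in auto)
  have "D.G i p = S1.G i p - S2.G i p" for i
  proof -
    have "D.G i p = (\<integral>s. indicator {0<..} s * S1.kern (heatD i) s p - indicator {0<..} s * S2.kern (heatD i) s p \<partial>lborel)"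
      unfolding D.G_def potential_def
    proof (rule Bochner_Integration.integral_cong[OF refl])
      fix s :: real
      show "indicator {0<..} s * D.kern (heatD i) s p = indicator {0<..} s * S1.kern (heatD i) s p - indicator {0<..} s * S2.kern (heatD i) s p"
        using conv_diff[OF gaussian_kernel_integrable[OF gaussian_kernel_heatD] S1.bcont_f S2.bcont_f, of s i "fst p - s" "fst p - s" "snd p"]
        by (simp add: S1.kern_def S2.kern_def D.kern_def indicator_def)
    qed
    also have "\<dots> = S1.G i p - S2.G i p"
      unfolding S1.G_def S2.G_def potential_def
      by (rule Bochner_Integration.integral_diff)
        (rule potential_integrable[where w="S1.kern (heatD i)", OF S1.kern_cont_time[OF gaussian_kernel_heatD] S1.kern_heatD_bound]
          potential_integrable[where w="S2.kern (heatD i)", OF S2.kern_cont_time[OF gaussian_kernel_heatD] S2.kern_heatD_bound]; assumption)+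
    finally show ?thesis .
  qed
  then have "grad_potential f1 p - grad_potential f2 p = grad_potential ?f p" by (simp add: grad_potential_def vec_eq_iff)
  then show ?thesis using grad_potential_bound[OF D.source_axioms] by simp
qed

lemma continuous_on_grad_potential:
  assumes "source f M L"
  shows "continuous_on UNIV (grad_potential f)"
proof -
  interpret source f M L by fact
  show ?thesis unfolding grad_potential_def[abs_def] by (intro continuous_on_vec_lambda G_cont)
qed

text \<open>Point evaluations are continuous in the supremum norm, so conditions on values at given
  points are closed; the set of admissible sources is an intersection of such conditions.\<close>

lemma closed_bcontfun_le:
  fixes a b :: "'a::topological_space"
  shows "closed {F :: 'a \<Rightarrow>\<^sub>C real. \<bar>apply_bcontfun F a - apply_bcontfun F b\<bar> \<le> c}"
    and "closed {F :: 'a \<Rightarrow>\<^sub>C real. \<bar>apply_bcontfun F a\<bar> \<le> c}"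
    and "closed {F :: 'a \<Rightarrow>\<^sub>C real. apply_bcontfun F a = apply_bcontfun F b}"
proof -
  have e: "continuous_on UNIV (\<lambda>F :: 'a \<Rightarrow>\<^sub>C real. apply_bcontfun F p)" for p
  proof (rule continuous_onI)
    fix F :: "'a \<Rightarrow>\<^sub>C real" and e :: real assume "e > 0"
    then show "\<exists>d>0. \<forall>F'\<in>UNIV. dist F' F < d \<longrightarrow> dist (apply_bcontfun F' p) (apply_bcontfun F p) \<le> e"
      using dist_bounded[of _ p F] by (intro exI[of _ e]) (auto intro: order_trans less_imp_le)
  qed
  show "closed {F :: 'a \<Rightarrow>\<^sub>C real. \<bar>apply_bcontfun F a - apply_bcontfun F b\<bar> \<le> c}"
    "closed {F :: 'a \<Rightarrow>\<^sub>C real. \<bar>apply_bcontfun F a\<bar> \<le> c}"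
    "closed {F :: 'a \<Rightarrow>\<^sub>C real. apply_bcontfun F a = apply_bcontfun F b}"
    by (intro closed_Collect_le closed_Collect_eq continuous_intros e)+
qed

text \<open>The 1 in \<open>B + 1\<close> is room for the perturbation of \<open>g\<close>: the
  first smallness condition on \<open>\<epsilon>\<close> keeps the argument of \<open>H\<close> in
  the ball where \<open>\<Lambda>\<close> and \<open>M\<close> apply, and the second yields the
  contraction and the Lipschitz bound.\<close>

lemma nonlinear_fixed_point:
  fixes g :: "real \<Rightarrow> real^'n::finite \<Rightarrow> real^'n" and H :: "real^'n \<Rightarrow> real"
  assumes gc: "continuous_on UNIV (\<lambda>p. g (fst p) (snd p))"
    and gB: "\<And>t x. norm (g t x) \<le> B"
    and gl: "\<And>t x y. norm (g t x - g t y) \<le> L0 * norm (x - y)" and L0: "L0 \<ge> 0"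
    and gT: "\<And>t x. g (t + T) x = g t x" and gx: "\<And>t x i. g t (x + axis i 1) = g t x"
    and \<Lambda>: "\<Lambda> \<ge> 0" "\<And>p q. norm p \<le> B + 1 \<Longrightarrow> norm q \<le> B + 1 \<Longrightarrow> \<bar>H p - H q\<bar> \<le> \<Lambda> * norm (p - q)"
    and Hc: "continuous_on UNIV H"
    and M: "\<And>p. norm p \<le> B + 1 \<Longrightarrow> \<bar>H p\<bar> \<le> M" "M \<ge> 0"
    and \<epsilon>: "\<epsilon> > 0" "\<epsilon> * (grad_const TYPE('n) * M) \<le> 1" "\<epsilon> * (\<Lambda> * grad_const TYPE('n)) \<le> 1 / 4"
  obtains f L where "source f M L" "\<And>t x. f (t + T) x = f t x"
    "\<And>t x. f t x = H (g t x - \<epsilon> *\<^sub>R grad_potential f (t, x))"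
    "\<And>t x. \<bar>f t x - H (g t x)\<bar> \<le> \<Lambda> * grad_const TYPE('n) * M * \<epsilon>"
proof -
  let ?A = "grad_const TYPE('n)"
  \<comment> \<open>Chosen so that \<open>\<Lambda> * L0 + (L1 + 2 * M) / 4 \<le> L1\<close>, which
    is how the Lipschitz bound reproduces itself when
    \<open>\<epsilon> * (\<Lambda> * ?A) \<le> 1 / 4\<close>.\<close>
  define L1 where "L1 = 2 * (\<Lambda> * L0) + 2 * M"
  have L1: "L1 \<ge> 0" unfolding L1_def using L0 \<Lambda>(1) M(2) by simp
  define S :: "((real \<times> (real^'n)) \<Rightarrow>\<^sub>C real) set" where
    "S = {F. (\<forall>p. \<bar>apply_bcontfun F p\<bar> \<le> M)
      \<and> (\<forall>t x y. \<bar>apply_bcontfun F (t, x) - apply_bcontfun F (t, y)\<bar> \<le> L1 * norm (x - y))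
      \<and> (\<forall>t x. apply_bcontfun F (t + T, x) = apply_bcontfun F (t, x))
      \<and> (\<forall>t x i. apply_bcontfun F (t, x + axis i 1) = apply_bcontfun F (t, x))}"
  define c :: "((real \<times> (real^'n)) \<Rightarrow>\<^sub>C real) \<Rightarrow> real \<Rightarrow> real^'n \<Rightarrow> real" where
    "c F t x = apply_bcontfun F (t, x)" for F t x
  define h where "h F p = H (g (fst p) (snd p) - \<epsilon> *\<^sub>R grad_potential (c F) p)" for F p
  \<comment> \<open>\<open>Bcontfun\<close> is meaningful only when \<open>h F\<close> is bounded
    and continuous, which \<open>app\<close> establishes for \<open>F\<close> in
    \<open>S\<close>.\<close>
  define \<Theta> where "\<Theta> F = Bcontfun (h F)" for F
  have src: "source (c F) M L1" if "F \<in> S" for F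
  proof
    have "continuous_on UNIV (apply_bcontfun F)" using apply_bcontfun[of F] by (simp add: bcontfun_def)
    then show "continuous_on UNIV (\<lambda>p. c F (fst p) (snd p))" by (simp add: c_def)
  qed (use that L1 in \<open>auto simp: S_def c_def per_space_def\<close>)
  have arg: "norm (g t x - \<epsilon> *\<^sub>R grad_potential (c F) (t, x)) \<le> B + 1" if "F \<in> S" for F t x
  proof -
    have "norm (\<epsilon> *\<^sub>R grad_potential (c F) (t, x)) \<le> \<epsilon> * (?A * M)"
      using grad_potential_bound[OF src[OF that], of "(t, x)"] \<epsilon>(1) by simp
    then show ?thesis using norm_triangle_ineq4[of "g t x" "\<epsilon> *\<^sub>R grad_potential (c F) (t, x)"] gB[of t x] \<epsilon>(2) by linarith
  qed
  have app: "apply_bcontfun (\<Theta> F) p = h F p" if "F \<in> S" for F p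
  proof -
    have "continuous_on UNIV (h F)"
      unfolding h_def by (rule continuous_on_compose2[OF Hc])
        (auto intro!: continuous_intros gc continuous_on_grad_potential[OF src[OF that]])
    moreover have "norm (h F q) \<le> M" for q
      unfolding h_def using M(1)[OF arg[OF that, of "fst q" "snd q"]] by simp
    ultimately have "h F \<in> bcontfun" by (intro bcontfun_normI)
    then show ?thesis by (simp add: \<Theta>_def Bcontfun_inverse)
  qed
  have "closed S"
    unfolding S_def
    by (intro closed_Collect_conj closed_Collect_all closed_bcontfun_le)
  then have complete: "complete S" by (simp add: complete_eq_closed)
  have "Bcontfun (\<lambda>_. 0) \<in> S"
  proof -
    have "(\<lambda>_::real \<times> (real^'n). 0::real) \<in> bcontfun" by (rule const_bcontfun)
    then show ?thesis using M(2) L1 by (simp add: S_def Bcontfun_inverse)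
  qed
  then have ne: "S \<noteq> {}" by blast
  have maps: "\<Theta> ` S \<subseteq> S"
  proof (rule image_subsetI)
    fix F assume F: "F \<in> S"
    interpret F: source "c F" M L1 by (rule src[OF F])
    have cT: "c F (t + T) x = c F t x" for t x using F by (simp add: S_def c_def)
    have "\<bar>h F (t, x) - h F (t, y)\<bar> \<le> L1 * norm (x - y)" for t x y
    proof -
      let ?d = "norm (x - y)"
      have "\<bar>h F (t, x) - h F (t, y)\<bar> \<le> \<Lambda> * norm ((g t x - \<epsilon> *\<^sub>R grad_potential (c F) (t, x)) - (g t y - \<epsilon> *\<^sub>R grad_potential (c F) (t, y)))"
        unfolding h_def fst_conv snd_conv by (rule \<Lambda>(2)[OF arg[OF F] arg[OF F]])
      also have "(g t x - \<epsilon> *\<^sub>R grad_potential (c F) (t, x)) - (g t y - \<epsilon> *\<^sub>R grad_potential (c F) (t, y))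
          = (g t x - g t y) - \<epsilon> *\<^sub>R (grad_potential (c F) (t, x) - grad_potential (c F) (t, y))" by (simp add: algebra_simps)
      also have "\<Lambda> * norm \<dots> \<le> \<Lambda> * (L0 * ?d + \<epsilon> * (?A * (L1 + 2 * M) * ?d))"
      proof (rule mult_left_mono[OF order_trans[OF norm_triangle_ineq4 add_mono] \<Lambda>(1)])
        show "norm (\<epsilon> *\<^sub>R (grad_potential (c F) (t, x) - grad_potential (c F) (t, y))) \<le> \<epsilon> * (?A * (L1 + 2 * M) * ?d)"
          using grad_potential_lipschitz[OF src[OF F], of t x y] \<epsilon>(1) by simp
      qed (rule gl)
      also have "\<dots> = (\<Lambda> * L0 + \<epsilon> * (\<Lambda> * ?A) * (L1 + 2 * M)) * ?d" by (simp add: algebra_simps)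
      also have "\<dots> \<le> L1 * ?d"
      proof (rule mult_right_mono)
        have combine: "X + Y \<le> L1" if "Y \<le> 1 / 4 * (L1 + 2 * M)" "0 \<le> X" "L1 = 2 * X + 2 * M" for X Y
          using that M(2) by simp
        have "\<epsilon> * (\<Lambda> * ?A) * (L1 + 2 * M) \<le> 1 / 4 * (L1 + 2 * M)"
          using L1 M(2) by (intro mult_right_mono \<epsilon>(3)) auto
        moreover have "0 \<le> \<Lambda> * L0" using \<Lambda>(1) L0 by simp
        ultimately show "\<Lambda> * L0 + \<epsilon> * (\<Lambda> * ?A) * (L1 + 2 * M) \<le> L1" by (rule combine) (rule L1_def)
      qed simp
      finally show ?thesis .
    qed
    moreover have "h F (t + T, x) = h F (t, x)" for t x
      using F.per_time(2)[OF cT] gT by (simp add: h_def grad_potential_def)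
    moreover have "h F (t, x + axis i 1) = h F (t, x)" for t x i
      using F.per_G gx by (simp add: h_def grad_potential_def)
    moreover have "\<bar>h F p\<bar> \<le> M" for p
      unfolding h_def using M(1)[OF arg[OF F, of "fst p" "snd p"]] by simp
    ultimately show "\<Theta> F \<in> S" by (simp add: S_def app[OF F])
  qed
  have contr: "dist (\<Theta> F) (\<Theta> F') \<le> 1 / 2 * dist F F'" if F: "F \<in> S" "F' \<in> S" for F F'
  proof (rule dist_bound)
    fix p :: "real \<times> (real^'n)"
    obtain t x where p: "p = (t, x)" by (cases p)
    have "\<bar>c F s y - c F' s y\<bar> \<le> dist F F'" for s y
      using dist_bounded[of F "(s, y)" F'] by (simp add: c_def dist_real_def)
    then have g: "norm (grad_potential (c F) p - grad_potential (c F') p) \<le> ?A * dist F F'"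
      by (rule grad_potential_diff_bound[OF src[OF F(1)] src[OF F(2)]])
    have "\<bar>h F p - h F' p\<bar> \<le> \<Lambda> * norm ((g t x - \<epsilon> *\<^sub>R grad_potential (c F) p) - (g t x - \<epsilon> *\<^sub>R grad_potential (c F') p))"
      unfolding h_def p fst_conv snd_conv by (rule \<Lambda>(2)[OF arg[OF F(1)] arg[OF F(2)]])
    also have "(g t x - \<epsilon> *\<^sub>R grad_potential (c F) p) - (g t x - \<epsilon> *\<^sub>R grad_potential (c F') p) = - (\<epsilon> *\<^sub>R (grad_potential (c F) p - grad_potential (c F') p))"
      by (simp add: algebra_simps)
    also have "\<Lambda> * norm \<dots> = \<Lambda> * (\<epsilon> * norm (grad_potential (c F) p - grad_potential (c F') p))"
      using \<epsilon>(1) by simp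
    also have "\<dots> \<le> \<Lambda> * (\<epsilon> * (?A * dist F F'))" using \<Lambda>(1) \<epsilon>(1) g by (intro mult_left_mono) auto
    also have "\<dots> = \<epsilon> * (\<Lambda> * ?A) * dist F F'" by simp
    also have "\<dots> \<le> 1 / 2 * dist F F'" using \<epsilon>(3) by (intro mult_right_mono) auto
    finally show "dist (apply_bcontfun (\<Theta> F) p) (apply_bcontfun (\<Theta> F') p) \<le> 1 / 2 * dist F F'"
      by (simp add: app F dist_real_def)
  qed
  have "\<exists>!F. F \<in> S \<and> \<Theta> F = F"
    by (rule Banach_fix[where c="1 / 2", OF complete ne _ _ maps contr]) simp_all
  then obtain F where F: "F \<in> S" "\<Theta> F = F" by blast
  have eq: "c F t x = H (g t x - \<epsilon> *\<^sub>R grad_potential (c F) (t, x))" for t x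
  proof -
    have "c F t x = apply_bcontfun (\<Theta> F) (t, x)" by (simp add: c_def F(2))
    also have "\<dots> = h F (t, x)" by (rule app[OF F(1)])
    finally show ?thesis by (simp add: h_def)
  qed
  have close: "\<bar>c F t x - H (g t x)\<bar> \<le> \<Lambda> * ?A * M * \<epsilon>" for t x
  proof -
    have "\<bar>c F t x - H (g t x)\<bar> \<le> \<Lambda> * norm (g t x - \<epsilon> *\<^sub>R grad_potential (c F) (t, x) - g t x)"
      by (subst eq, intro \<Lambda>(2) arg[OF F(1)]) (use gB[of t x] in auto)
    also have "\<dots> = \<Lambda> * (\<epsilon> * norm (grad_potential (c F) (t, x)))" using \<epsilon>(1) by simp
    also have "\<dots> \<le> \<Lambda> * (\<epsilon> * (?A * M))"
      using \<epsilon>(1) by (intro mult_left_mono grad_potential_bound[OF src[OF F(1)]] \<Lambda>(1)) auto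
    finally show ?thesis by (simp add: ac_simps)
  qed
  show ?thesis
    by (rule that[OF src[OF F(1)] _ eq close]) (use F(1) in \<open>auto simp: S_def c_def\<close>)
qed

lemma pd_periodic:
  assumes "C12per T f"
  shows "pd i (f (t + T)) x = pd i (f t) x" "per_space (pd i (f t))"
proof -
  have "f (t + T) = f t" using C12perD(1)[OF assms] by (simp add: fun_eq_iff)
  then show "pd i (f (t + T)) x = pd i (f t) x" by simp
  have "f t (x + axis j 1 + h *\<^sub>R axis i 1) = f t (x + h *\<^sub>R axis i 1)" for x h j
  proof -
    have "x + axis j 1 + h *\<^sub>R axis i 1 = (x + h *\<^sub>R axis i 1) + axis j 1" by (simp add: algebra_simps)
    then show ?thesis using C12perD(2)[OF assms, of t] unfolding per_space_def by metis
  qed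
  then show "per_space (pd i (f t))" by (simp add: per_space_def pd_def)
qed

lemma pd2_periodic:
  assumes "C12per T f"
  shows "pd j (pd i (f (t + T))) x = pd j (pd i (f t)) x" "per_space (pd j (pd i (f t)))"
proof -
  have "f (t + T) = f t" using C12perD(1)[OF assms] by (simp add: fun_eq_iff)
  then show "pd j (pd i (f (t + T))) x = pd j (pd i (f t)) x" by simp
  have "pd i (f t) (x + axis k 1 + h *\<^sub>R axis j 1) = pd i (f t) (x + h *\<^sub>R axis j 1)" for x h k
  proof -
    have "x + axis k 1 + h *\<^sub>R axis j 1 = (x + h *\<^sub>R axis j 1) + axis k 1" by (simp add: algebra_simps)
    then show ?thesis using pd_periodic(2)[OF assms, of i t] unfolding per_space_def by metis
  qed
  then show "per_space (pd j (pd i (f t)))" by (simp add: per_space_def pd_def[of j])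
qed

text \<open>The spatial derivatives of first and second order are continuous and periodic, hence
  bounded.\<close>

lemma grad_bounded_lipschitz:
  fixes f :: "real \<Rightarrow> real^'n::finite \<Rightarrow> real"
  assumes T: "T > 0" and f: "C12per T f"
  obtains B L where "\<And>t x. norm (grad (f t) x) \<le> B" "\<And>t x y. norm (grad (f t) x - grad (f t) y) \<le> L * norm (x - y)" "L \<ge> 0"
proof -
  have "\<exists>K. \<forall>t x. \<bar>pd i (f t) x\<bar> \<le> K" for i
    using periodic_bounded[OF T C12perD(7)[OF f] pd_periodic[OF f]] by metis
  then obtain k where k: "\<And>i t x. \<bar>pd i (f t) x\<bar> \<le> k i" by metis
  have "\<exists>K. \<forall>t x. \<bar>pd j (pd i (f t)) x\<bar> \<le> K" for i j
    using periodic_bounded[OF T C12perD(9)[OF f] pd2_periodic[OF f]] by metis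
  then have "\<exists>l. \<forall>i j t x. \<bar>pd j (pd i (f t)) x\<bar> \<le> l i j" by (intro choice allI)
  then obtain l where l: "\<And>i j t x. \<bar>pd j (pd i (f t)) x\<bar> \<le> l i j" by blast
  define K where "K = (\<Sum>i\<in>UNIV. \<bar>k i\<bar>)"
  define K2 where "K2 = (\<Sum>i\<in>UNIV. \<Sum>j\<in>UNIV. \<bar>l i j\<bar>)"
  have "\<bar>pd i (f t) x\<bar> \<le> K" for i t x
    using k[of i t x] member_le_sum[of i UNIV "\<lambda>i. \<bar>k i\<bar>"] unfolding K_def by simp
  then have 1: "norm (grad (f t) x) \<le> real CARD('n) * K" for t x
    by (intro norm_vec_le) (simp add: grad_def)
  have K2: "\<bar>pd j (pd i (f t)) x\<bar> \<le> K2" for i j t x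
    using l[of j i t x] member_le_sum[of j UNIV "\<lambda>j. \<bar>l i j\<bar>"]
      member_le_sum[of i UNIV "\<lambda>i. \<Sum>j\<in>UNIV. \<bar>l i j\<bar>"] unfolding K2_def by (simp add: sum_nonneg)
  have "K2 \<ge> 0" unfolding K2_def by (intro sum_nonneg) auto
  have "\<bar>pd i (f t) x - pd i (f t) y\<bar> \<le> K2 * real CARD('n) * norm (x - y)" for i t x y
    by (rule lipschitz_pd_bounded[OF C12perD(8)[OF f] K2])
  then have "norm (grad (f t) x - grad (f t) y) \<le> real CARD('n) * (K2 * real CARD('n) * norm (x - y))" for t x y
    by (intro norm_vec_le) (simp add: grad_def)
  then have 2: "norm (grad (f t) x - grad (f t) y) \<le> (real CARD('n) * (K2 * real CARD('n))) * norm (x - y)" for t x y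
    by (simp add: ac_simps)
  show ?thesis by (rule that[OF 1 2]) (use \<open>K2 \<ge> 0\<close> in simp)
qed

lemma cyl_int_diff_bound:
  fixes a b :: "real \<Rightarrow> real^'n::finite \<Rightarrow> real"
  assumes T: "T > 0" and a: "continuous_on UNIV (\<lambda>p. a (fst p) (snd p))" and b: "continuous_on UNIV (\<lambda>p. b (fst p) (snd p))"
    and d: "\<And>t x. \<bar>a t x - b t x\<bar> \<le> \<delta>"
  shows "\<bar>cyl_int T a / T - cyl_int T b / T\<bar> \<le> \<delta>"
proof -
  let ?Q = "cbox (0, 0) (T, 1 :: real^'n)"
  have d0: "\<delta> \<ge> 0" using order_trans[OF abs_ge_zero d[of 0 0]] .
  have int: "(\<lambda>p. a (fst p) (snd p)) integrable_on ?Q" "(\<lambda>p. b (fst p) (snd p)) integrable_on ?Q"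
    by (intro integrable_continuous continuous_on_subset[OF a] continuous_on_subset[OF b]; simp)+
  have "((\<lambda>p. a (fst p) (snd p) - b (fst p) (snd p)) has_integral cyl_int T a - cyl_int T b) ?Q"
    unfolding cyl_int_def by (intro has_integral_diff integrable_integral int)
  from has_integral_bound[OF d0 this] have "norm (cyl_int T a - cyl_int T b) \<le> \<delta> * measure lborel ?Q"
    using d by simp
  also have "measure lborel ?Q = T" using T by (simp add: content_Pair content_unit_cube)
  finally show ?thesis using T by (simp add: diff_divide_distrib[symmetric] field_simps)
qed

theorem theorem1p5:
  fixes T :: real and H :: "real^'n::finite \<Rightarrow> real"
    and m \<psi>0 :: "real \<Rightarrow> real^'n \<Rightarrow> real"
  assumes "T > 0"
    and "hyp_H H"
    and "C12per T m"
    and "C12per T \<psi>0"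
    and "\<forall>t x. dt \<psi>0 t x - lap (\<psi>0 t) x
               = cyl_int T m / (T * measure lborel (cbox (0::real^'n) 1)) - m t x"
    and "cyl_int T \<psi>0 = 0"
  shows "((\<lambda>\<epsilon>. (- eigenvalue T H m \<epsilon> - cyl_int T m / (T * measure lborel (cbox (0::real^'n) 1))) / \<epsilon>)
          \<longlongrightarrow> cyl_int T (\<lambda>t x. H (grad (\<psi>0 t) x)) / (T * measure lborel (cbox (0::real^'n) 1)))
         (at_right 0)"
proof -
  define mbar where "mbar = cyl_int T m / T"
  define g where "g t x = grad (\<psi>0 t) x" for t x
  have C2: "C2 H" using assms(2) by (simp add: hyp_H_def)
  then have Hc: "continuous_on UNIV H" by (simp add: C2_def)
  obtain B L0 where gB: "\<And>t x. norm (g t x) \<le> B" and gl: "\<And>t x y. norm (g t x - g t y) \<le> L0 * norm (x - y)" and L0: "L0 \<ge> 0"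
    unfolding g_def using grad_bounded_lipschitz[OF assms(1,4)] by metis
  have gc: "continuous_on UNIV (\<lambda>p. g (fst p) (snd p))"
    unfolding g_def grad_def by (intro continuous_on_vec_lambda C12perD(7)[OF assms(4)])
  have gT: "g (t + T) x = g t x" for t x
    by (simp add: g_def grad_def pd_periodic(1)[OF assms(4)])
  have gx: "g t (x + axis i 1) = g t x" for t x i
    using pd_periodic(2)[OF assms(4)] by (simp add: g_def grad_def per_space_def)
  obtain \<Lambda> where \<Lambda>: "\<Lambda> \<ge> 0" "\<And>p q. norm p \<le> B + 1 \<Longrightarrow> norm q \<le> B + 1 \<Longrightarrow> \<bar>H p - H q\<bar> \<le> \<Lambda> * norm (p - q)"
    using C2_locally_lipschitz[OF C2] by blast
  have B1: "B \<ge> 0" using gB[of 0 0] norm_ge_zero order_trans by blast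
  define M where "M = \<bar>H 0\<bar> + \<Lambda> * (B + 1)"
  have M0: "M \<ge> 0" using \<Lambda>(1) B1 by (simp add: M_def)
  have M: "\<bar>H p\<bar> \<le> M" if "norm p \<le> B + 1" for p
  proof -
    have "\<bar>H p - H 0\<bar> \<le> \<Lambda> * norm (p - 0)" using B1 that by (intro \<Lambda>(2)) auto
    also have "\<dots> \<le> \<Lambda> * (B + 1)" using that \<Lambda>(1) by (intro mult_left_mono) auto
    finally show ?thesis unfolding M_def by linarith
  qed
  let ?A = "grad_const TYPE('n)"
  have A0: "?A \<ge> 0" by (rule grad_const_nonneg)
  \<comment> \<open>The sum in the denominator makes both smallness conditions hold at once; the 4
    is the one required by \<open>nonlinear_fixed_point\<close>.\<close>
  define \<epsilon>0 where "\<epsilon>0 = 1 / (4 * (1 + ?A * M + \<Lambda> * ?A))"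
  have den: "1 + ?A * M + \<Lambda> * ?A > 0" using A0 M0 \<Lambda>(1) by (simp add: add_pos_nonneg)
  then have \<epsilon>0: "\<epsilon>0 > 0" by (simp add: \<epsilon>0_def)
  define q where "q \<epsilon> = (- eigenvalue T H m \<epsilon> - mbar) / \<epsilon>" for \<epsilon>
  define cc where "cc = cyl_int T (\<lambda>t x. H (g t x)) / T"
  \<comment> \<open>The quotient is the space-time mean of \<open>f\<close>, which is uniformly
    close to H(\<nabla>\<psi>0); the convergence has a linear rate in \<epsilon>.\<close>
  have main: "\<bar>q \<epsilon> - cc\<bar> \<le> \<Lambda> * ?A * M * \<epsilon>" if \<epsilon>: "0 < \<epsilon>" "\<epsilon> < \<epsilon>0" for \<epsilon>
  proof -
    have "\<epsilon> * (1 + ?A * M + \<Lambda> * ?A) \<le> 1 / 4"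
      using \<epsilon> den by (simp add: \<epsilon>0_def field_simps)
    moreover have "0 \<le> \<epsilon> * (?A * M)" "0 \<le> \<epsilon> * (\<Lambda> * ?A)" using \<epsilon> A0 M0 \<Lambda>(1) by simp_all
    ultimately have small: "\<epsilon> * (?A * M) \<le> 1" "\<epsilon> * (\<Lambda> * ?A) \<le> 1 / 4"
      using \<epsilon> by (auto simp: distrib_left)
    obtain f L where src: "source f M L" and fT: "\<And>t x. f (t + T) x = f t x"
      and feq: "\<And>t x. f t x = H (g t x - \<epsilon> *\<^sub>R grad_potential f (t, x))"
      and fclose: "\<And>t x. \<bar>f t x - H (g t x)\<bar> \<le> \<Lambda> * ?A * M * \<epsilon>"
      using nonlinear_fixed_point[OF gc gB gl L0 gT gx \<Lambda> Hc M M0 \<epsilon>(1) small] by blast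
    interpret source f M L by (rule src)
    obtain w where w: "C12per T w" "\<And>t x. dt w t x - lap (w t) x = f t x - cyl_int T f / T"
      "\<And>t x. grad (w t) x = grad_potential f (t, x)"
      using linear_solution[OF assms(1) fT] unfolding grad_potential_def by metis
    define \<phi> where "\<phi> = (\<lambda>t x. \<psi>0 t x + (- \<epsilon>) * w t x)"
    note C = C12per_combination[OF assms(4) w(1), where c="- \<epsilon>", folded \<phi>_def]
    have gr: "grad (\<phi> t) x = g t x - \<epsilon> *\<^sub>R grad_potential f (t, x)" for t x
      using C(3)[where t=t and x=x] w(3)[of t x, symmetric] by (simp add: g_def grad_def vec_eq_iff \<phi>_def)
    \<comment> \<open>The fixed-point equation says that \<open>f\<close> is \<open>H\<close> of the
      gradient of \<open>\<phi>\<close>, so the source of \<open>w\<close> cancels the nonlinear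
      term.\<close>
    have "eigenvalue T H m \<epsilon> = - mbar - \<epsilon> * (cyl_int T f / T)"
    proof (rule eigenvalue_eqI[OF assms(1) C(1)])
      fix t x
      have "dt \<phi> t x - lap (\<phi> t) x = (dt \<psi>0 t x - lap (\<psi>0 t) x) - \<epsilon> * (dt w t x - lap (w t) x)"
        using C(2,4)[where t=t and x=x] by (simp add: \<phi>_def algebra_simps)
      also have "\<dots> = (mbar - m t x) - \<epsilon> * (f t x - cyl_int T f / T)"
        using assms(5) w(2) by (simp add: mbar_def content_unit_cube)
      finally show "- mbar - \<epsilon> * (cyl_int T f / T) + dt \<phi> t x - lap (\<phi> t) x + \<epsilon> * H (grad (\<phi> t) x) = - m t x"
        unfolding gr feq[symmetric] by (simp add: algebra_simps)
    qed
    then have "q \<epsilon> = cyl_int T f / T" using \<epsilon>(1) by (simp add: q_def)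
    moreover have "continuous_on UNIV (\<lambda>p. H (g (fst p) (snd p)))"
      by (rule continuous_on_compose2[OF Hc gc]) auto
    ultimately show ?thesis
      unfolding cc_def using cyl_int_diff_bound[OF assms(1) cont _ fclose] by simp
  qed
  have "((\<lambda>\<epsilon>. q \<epsilon> - cc) \<longlongrightarrow> 0) (at_right 0)"
  proof (rule Lim_null_comparison)
    show "\<forall>\<^sub>F \<epsilon> in at_right 0. norm (q \<epsilon> - cc) \<le> \<Lambda> * ?A * M * \<epsilon>"
      unfolding eventually_at_right_field using main \<epsilon>0 by auto
    have "((\<lambda>\<epsilon>. \<Lambda> * ?A * M * \<epsilon>) \<longlongrightarrow> \<Lambda> * ?A * M * 0) (at_right 0)" by (intro tendsto_intros)
    then show "((\<lambda>\<epsilon>. \<Lambda> * ?A * M * \<epsilon>) \<longlongrightarrow> 0) (at_right 0)" by simp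
  qed
  then have "(q \<longlongrightarrow> cc) (at_right 0)" by (rule LIM_zero_cancel)
  then show ?thesis by (simp add: q_def[abs_def] cc_def mbar_def g_def content_unit_cube)
qed

end
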